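(* Suppose that Assumption 1 and Assumption 2 (stated in the context) hold. Then for every $\mu\in\mathcal{M}(E)$, the process $W^{h}_{t}(X):=e^{\lambda_{1}t}\langle h,X_{t}\rangle$, $t\ge 0$, is a non-negative $\mathrm{P}_{\mu}$-martingale with respect to the filtration $\{\mathcal{F}_{t}:t\ge 0\}$.
   Context: Setting. $E$ is a locally compact separable metric space with Borel $\sigma$-algebra $\mathcal{B}(E)$; $m$ is a $\sigma$-finite measure on $E$ with full support; $E_\partial=E\cup\{\partial\}$ is the one-point compactification and functions on $E$ are extended by $f(\partial)=0$. $\mathcal{B}_b(E)$, $\mathcal{B}^+(E)$, $\mathcal{B}^+_b(E)$ denote the bounded, the non-negative, and the bounded non-negative Borel functions. $\mathcal{M}(E)$ is the space of finite Borel measures on $E$ with the weak topology; $\langle f,\mu\rangle=\int f\,d\mu$, $(f,g)=\int_E fg\,dm$. A function on $E\times[0,\infty)$ is locally bounded if it is bounded on $E\times[0,T]$ for each $T<\infty$. A probability measure symbol also denotes its expectation. $\xi=(\xi_t,\Pi_x)$ is an $m$-symmetric Hunt process on $E$ with semigroup $\mathfrak{S}_tf(x)=\Pi_x[f(\xi_t)]$, admitting a transition density $p(t,x,y)$ with respect to $m$, symmetric in $(x,y)$; $(\mathcal{E},\mathcal{F})$ is its regular symmetric Dirichlet form on $L^2(E,m)$. Branching mechanism. $\psi(x,f)=\phi^L(x,f(x))+\phi^{NL}(x,f)$, where $\phi^{L}(x,\lambda)=a(x)\lambda+b(x)\lambda^{2}+\int_{(0,\infty)}(e^{-\lambda\theta}-1+\lambda\theta)\Pi^{L}(x,d\theta)$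 with $a\in\mathcal{B}_b(E)$, $b\in\mathcal{B}^+_b(E)$, $(\theta\wedge\theta^2)\Pi^L(x,d\theta)$ a bounded kernel from $E$ to $(0,\infty)$; and $\phi^{NL}(x,f)=-c(x)\pi(x,f)-\int_{(0,\infty)}(1-e^{-\theta\pi(x,f)})\Pi^{NL}(x,d\theta)$ with $c\in\mathcal{B}_b^+(E)$, $\pi(x,dy)$ a probability kernel on $E$ with $\pi(x,\{x\})\not\equiv1$, $\pi(x,f)=\int f(y)\pi(x,dy)$, and $\theta\Pi^{NL}(x,d\theta)$ a bounded kernel from $E$ to $(0,\infty)$. Put $\gamma(x,dy)=\big(c(x)+\int_{(0,\infty)}\theta\Pi^{NL}(x,d\theta)\big)\pi(x,dy)$, $\gamma(x,f)=\int f(y)\gamma(x,dy)$, $\gamma(x)=\gamma(x,1)$, and assume $A=\{x:\gamma(x)>0\}\neq\emptyset$. Superprocess. $X=(X_t)_{t\ge0}$ with laws $\mathrm{P}_\mu$, $\mu\in\mathcal{M}(E)$, is the $\mathcal{M}(E)$-valued Markov process (the coordinate process on the space $\mathcal{W}_0^+$ of right-continuous paths $[0,\infty)\to\mathcal{M}(E)$ having $0$ as a trap, with natural filtration $(\mathcal{F}_t)_{t\ge0}$) such that $X_0=\mu$ and $\mathrm{P}_\mu(e^{-\langle f,X_t\rangle})=e^{-\langle V_tf,\mu\rangle}$ for $f\in\mathcal{B}_b^+(E)$, where $(x,t)\mapsto V_tf(x)$ is the unique non-negative locally bounded solution of $V_tf(x)=\mathfrak{S}_tf(x)-\Pi_x[\int_0^t\psi(\xi_s,V_{t-s}f)ds]$.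 Kato class. A smooth measure of $\xi$ (i.e. the Revuz measure of a positive continuous additive functional of $\xi$ in the strict sense) $\mu$ belongs to $\mathbf{K}(\xi)$ if $\lim_{t\downarrow0}\sup_{x\in E}\int_0^t\int_Ep(s,x,y)\mu(dy)ds=0$. Assumption 1. The measure $\int_E\gamma(x,\cdot)m(dx)$ belongs to $\mathbf{K}(\xi)$. Bilinear form: $\mathcal{Q}(u,v)=\mathcal{E}(u,v)+\int_Ea(x)u(x)v(x)m(dx)-\int_E\int_Eu(y)v(x)\gamma(x,dy)m(dx)$, $u,v\in\mathcal{F}$. Assumption 2. There exist a constant $\lambda_1\in(-\infty,\infty)$ and positive functions $h,\widehat h\in\mathcal{F}$ with $h$ bounded continuous, $\|h\|_{L^2(E,m)}=1$ and $(h,\widehat h)=1$ such that $\mathcal{Q}(h,v)=\lambda_1(h,v)$ and $\mathcal{Q}(v,\widehat h)=\lambda_1(v,\widehat h)$ for all $v\in\mathcal{F}$. *)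

theory Defs
  imports "HOL-Probability.Probability"
begin

section \<open>General notions\<close>

text \<open>The state space \<open>E\<close> is the universe of a type of class \<^class>\<open>metric_space\<close> and
  \<^class>\<open>second_countable_topology\<close> (for metric spaces: separable).\<close>

definition bounded_borel :: "('a::topological_space \<Rightarrow> real) set" where
  "bounded_borel = {f \<in> borel_measurable borel. bounded (range f)}"

definition bounded_borel_nonneg :: "('a::topological_space \<Rightarrow> real) set" where
  "bounded_borel_nonneg = {f \<in> bounded_borel. \<forall>x. 0 \<le> f x}"

definition bounded_continuous :: "('a::topological_space \<Rightarrow> real) set" where
  "bounded_continuous = {f. continuous_on UNIV f \<and> bounded (range f)}"

definition compactly_supported_continuous :: "('a::topological_space \<Rightarrow> real) set" where
  "compactly_supported_continuous = {f. continuous_on UNIV f \<and> compact (closure {x. f x \<noteq> 0})}"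

definition full_support :: "'a::topological_space measure \<Rightarrow> bool" where
  "full_support m \<longleftrightarrow> (\<forall>U. open U \<and> U \<noteq> {} \<longrightarrow> 0 < emeasure m U)"

definition bounded_kernel :: "'b measure \<Rightarrow> ('a::topological_space \<Rightarrow> 'b measure) \<Rightarrow> bool" where
  "bounded_kernel N \<kappa> \<longleftrightarrow>
     (\<forall>x. sets (\<kappa> x) = sets N) \<and>
     (\<forall>B\<in>sets N. (\<lambda>x. emeasure (\<kappa> x) B) \<in> borel_measurable borel) \<and>
     (\<exists>C::real. \<forall>x. emeasure (\<kappa> x) (space N) \<le> ennreal C)"

definition generated_sigma :: "'w set \<Rightarrow> 'i set \<Rightarrow> ('i \<Rightarrow> 'w \<Rightarrow> 's) \<Rightarrow> 's measure \<Rightarrow> 'w measure" where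
  "generated_sigma \<Omega> I X S = sigma \<Omega> {X i -` B \<inter> \<Omega> | i B. i \<in> I \<and> B \<in> sets S}"

definition martingale :: "'w measure \<Rightarrow> (real \<Rightarrow> 'w measure) \<Rightarrow> (real \<Rightarrow> 'w \<Rightarrow> real) \<Rightarrow> bool" where
  "martingale P F W \<longleftrightarrow>
     (\<forall>t\<ge>0. subalgebra P (F t)) \<and>
     (\<forall>s t. 0 \<le> s \<and> s \<le> t \<longrightarrow> sets (F s) \<subseteq> sets (F t)) \<and>
     (\<forall>t\<ge>0. W t \<in> borel_measurable (F t) \<and> integrable P (W t)) \<and>
     (\<forall>s t. 0 \<le> s \<and> s \<le> t \<longrightarrow> (AE w in P. real_cond_exp P (F s) (W t) w = W s w))"

section \<open>Hunt processes\<close>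

text \<open>The one-point compactification \<open>E \<union> {\<partial>}\<close>, with \<^const>\<open>None\<close> as the cemetery \<open>\<partial>\<close>;
  \<open>\<partial>\<close> is isolated if \<open>E\<close> is compact.\<close>

definition one_point_compactification :: "'a::t2_space option topology" where
  "one_point_compactification =
     topology (\<lambda>U. open (Some -` U) \<and> (None \<in> U \<longrightarrow> compact (- (Some -` U))))"

lemma openin_one_point_compactification:
  fixes U :: "'a::t2_space option set"
  shows "openin one_point_compactification U \<longleftrightarrow>
    open (Some -` U) \<and> (None \<in> U \<longrightarrow> compact (- (Some -` U)))"
proof -
  have "istopology (\<lambda>U::'a option set. open (Some -` U) \<and> (None \<in> U \<longrightarrow> compact (- (Some -` U))))"
    unfolding istopology_def
  proof (intro conjI allI impI)
    fix \<K> :: "'a option set set"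
    assume *: "\<forall>K\<in>\<K>. open (Some -` K) \<and> (None \<in> K \<longrightarrow> compact (- (Some -` K)))"
    show op: "open (Some -` \<Union>\<K>)"
      unfolding vimage_Union using * by auto
    assume "None \<in> \<Union>\<K>"
    then obtain K where K: "K \<in> \<K>" "None \<in> K" by auto
    with * have "compact (- (Some -` K))" by auto
    from compact_Int_closed[OF this, of "- (Some -` \<Union>\<K>)"]
    have "compact (- (Some -` K) \<inter> - (Some -` \<Union>\<K>))" using op by (simp add: closed_def)
    moreover have "- (Some -` K) \<inter> - (Some -` \<Union>\<K>) = - (Some -` \<Union>\<K>)" using K by auto
    ultimately show "compact (- (Some -` \<Union>\<K>))" by simp
  qed (auto simp: vimage_Int open_Int compact_Un Compl_Int)
  then show ?thesis
    unfolding one_point_compactification_def by (simp add: topology_inverse')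
qed

definition cemetery_borel :: "'a::t2_space option measure" where
  "cemetery_borel = sigma UNIV {U. openin one_point_compactification U}"

definition extend_zero :: "('a \<Rightarrow> 'b::zero) \<Rightarrow> 'a option \<Rightarrow> 'b" where
  "extend_zero f z = (case z of None \<Rightarrow> 0 | Some x \<Rightarrow> f x)"

text \<open>Time runs through \<open>[0,\<infinity>]\<close> = \<^typ>\<open>ennreal\<close>, with \<open>\<xi>\<^sub>\<infinity> = \<partial>\<close>, so that stopping times may be infinite.\<close>

definition lifetime :: "(ennreal \<Rightarrow> 'w \<Rightarrow> 'a option) \<Rightarrow> 'w \<Rightarrow> ennreal" where
  "lifetime \<xi> \<omega> = Inf {t. \<xi> t \<omega> = None}"

definition raw_filtration ::
  "'w set \<Rightarrow> (ennreal \<Rightarrow> 'w \<Rightarrow> 'a::t2_space option) \<Rightarrow> ennreal \<Rightarrow> 'w measure" where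
  "raw_filtration \<Omega> \<xi> t = generated_sigma \<Omega> {..t} \<xi> cemetery_borel"

definition raw_filtration_right ::
  "'w set \<Rightarrow> (ennreal \<Rightarrow> 'w \<Rightarrow> 'a::t2_space option) \<Rightarrow> ennreal \<Rightarrow> 'w measure" where
  "raw_filtration_right \<Omega> \<xi> t =
     (if t = \<top> then raw_filtration \<Omega> \<xi> \<top>
      else sigma \<Omega> (\<Inter>u\<in>{t<..}. sets (raw_filtration \<Omega> \<xi> u)))"

text \<open>In the strong Markov property and in quasi-left-continuity the filtration is the smallest
  right-continuous one to which \<open>\<xi>\<close> is adapted; requiring them for some right-continuous
  filtration to which \<open>\<xi>\<close> is adapted amounts to the same. Both properties pass from the point
  masses to general initial laws by integration, since the stopping times do not depend on the
  initial law.\<close>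

locale hunt_process =
  fixes \<Omega> :: "'w set"
    and \<xi> :: "ennreal \<Rightarrow> 'w \<Rightarrow> 'a::{metric_space, second_countable_topology} option"
    and \<tau> :: "ennreal \<Rightarrow> 'w \<Rightarrow> 'w"
    and Pr :: "'a option \<Rightarrow> 'w measure"
  assumes locally_compact: "locally_compact_space (euclidean :: 'a topology)"
    and laws: "Pr \<in> cemetery_borel \<rightarrow>\<^sub>M prob_algebra (raw_filtration \<Omega> \<xi> \<top>)"
    and normal: "\<And>x. AE \<omega> in Pr x. \<xi> 0 \<omega> = x"
    and at_infinity: "\<And>\<omega>. \<omega> \<in> \<Omega> \<Longrightarrow> \<xi> \<top> \<omega> = None"
    and cemetery: "\<And>\<omega> t. \<omega> \<in> \<Omega> \<Longrightarrow> lifetime \<xi> \<omega> \<le> t \<Longrightarrow> \<xi> t \<omega> = None"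
    and shift_closed: "\<And>\<omega> t. \<omega> \<in> \<Omega> \<Longrightarrow> \<tau> t \<omega> \<in> \<Omega>"
    and shift: "\<And>\<omega> s t. \<omega> \<in> \<Omega> \<Longrightarrow> \<xi> s (\<tau> t \<omega>) = \<xi> (s + t) \<omega>"
    and right_continuous: "\<And>\<omega> t. \<omega> \<in> \<Omega> \<Longrightarrow> t < \<top> \<Longrightarrow>
          limitin one_point_compactification (\<lambda>s. \<xi> s \<omega>) (\<xi> t \<omega>) (at_right t)"
    and left_limits: "\<And>\<omega> t. \<omega> \<in> \<Omega> \<Longrightarrow> 0 < t \<Longrightarrow> t < \<top> \<Longrightarrow>
          \<exists>z. limitin one_point_compactification (\<lambda>s. \<xi> s \<omega>) z (at_left t)"
    and strong_Markov: "\<And>x \<sigma> s B. stopping_time (raw_filtration_right \<Omega> \<xi>) \<sigma> \<Longrightarrow>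
          B \<in> sets cemetery_borel \<Longrightarrow>
          AE \<omega> in Pr x.
            real_cond_exp (Pr x) (filtration.pre_sigma \<Omega> (raw_filtration_right \<Omega> \<xi>) \<sigma>)
              (\<lambda>\<omega>. indicator B (\<xi> (\<sigma> \<omega> + s) \<omega>)) \<omega>
            = measure (Pr (\<xi> (\<sigma> \<omega>) \<omega>)) {\<omega>' \<in> \<Omega>. \<xi> s \<omega>' \<in> B}"
    and quasi_left_continuous: "\<And>x \<sigma>.
          (\<And>n::nat. stopping_time (raw_filtration_right \<Omega> \<xi>) (\<sigma> n)) \<Longrightarrow>
          (\<And>\<omega>. \<omega> \<in> \<Omega> \<Longrightarrow> incseq (\<lambda>n. \<sigma> n \<omega>)) \<Longrightarrow>
          AE \<omega> in Pr x. (SUP n. \<sigma> n \<omega>) < \<top> \<longrightarrow>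
            limitin one_point_compactification (\<lambda>n. \<xi> (\<sigma> n \<omega>) \<omega>)
              (\<xi> (SUP n. \<sigma> n \<omega>) \<omega>) sequentially"

definition transition_semigroup ::
  "(ennreal \<Rightarrow> 'w \<Rightarrow> 'a option) \<Rightarrow> ('a option \<Rightarrow> 'w measure) \<Rightarrow> real \<Rightarrow> ('a \<Rightarrow> real) \<Rightarrow> 'a \<Rightarrow> real" where
  "transition_semigroup \<xi> Pr t f x = (\<integral>\<omega>. extend_zero f (\<xi> (ennreal t) \<omega>) \<partial>Pr (Some x))"

section \<open>Dirichlet form of a symmetric semigroup\<close>

text \<open>Elements of \<open>L\<^sup>2\<close> and of the form domain are represented by Borel functions; both sets below
  are closed under changes on \<open>m\<close>-null sets.\<close>

definition L2_functions :: "'a::topological_space measure \<Rightarrow> ('a \<Rightarrow> real) set" where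
  "L2_functions m = {u \<in> borel_measurable borel. integrable m (\<lambda>x. (u x)\<^sup>2)}"

definition L2_inner :: "'a measure \<Rightarrow> ('a \<Rightarrow> real) \<Rightarrow> ('a \<Rightarrow> real) \<Rightarrow> real" where
  "L2_inner m u v = (\<integral>x. u x * v x \<partial>m)"

definition L2_norm :: "'a measure \<Rightarrow> ('a \<Rightarrow> real) \<Rightarrow> real" where
  "L2_norm m u = sqrt (L2_inner m u u)"

definition approximating_form ::
  "'a measure \<Rightarrow> (real \<Rightarrow> ('a \<Rightarrow> real) \<Rightarrow> 'a \<Rightarrow> real) \<Rightarrow> real \<Rightarrow> ('a \<Rightarrow> real) \<Rightarrow> ('a \<Rightarrow> real) \<Rightarrow> real" where
  "approximating_form m S t u v = L2_inner m (\<lambda>x. u x - S t u x) v / t"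

definition dirichlet_domain ::
  "'a::topological_space measure \<Rightarrow> (real \<Rightarrow> ('a \<Rightarrow> real) \<Rightarrow> 'a \<Rightarrow> real) \<Rightarrow> ('a \<Rightarrow> real) set" where
  "dirichlet_domain m S =
     {u \<in> L2_functions m. \<exists>l. ((\<lambda>t. approximating_form m S t u u) \<longlongrightarrow> l) (at_right 0)}"

definition dirichlet_form ::
  "'a measure \<Rightarrow> (real \<Rightarrow> ('a \<Rightarrow> real) \<Rightarrow> 'a \<Rightarrow> real) \<Rightarrow> ('a \<Rightarrow> real) \<Rightarrow> ('a \<Rightarrow> real) \<Rightarrow> real" where
  "dirichlet_form m S u v = Lim (at_right 0) (\<lambda>t. approximating_form m S t u v)"

definition dirichlet_form1 ::
  "'a measure \<Rightarrow> (real \<Rightarrow> ('a \<Rightarrow> real) \<Rightarrow> 'a \<Rightarrow> real) \<Rightarrow> ('a \<Rightarrow> real) \<Rightarrow> ('a \<Rightarrow> real) \<Rightarrow> real" where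
  "dirichlet_form1 m S u v = dirichlet_form m S u v + L2_inner m u v"

definition regular_dirichlet ::
  "'a::topological_space measure \<Rightarrow> (real \<Rightarrow> ('a \<Rightarrow> real) \<Rightarrow> 'a \<Rightarrow> real) \<Rightarrow> bool" where
  "regular_dirichlet m S \<longleftrightarrow>
     (\<forall>u\<in>dirichlet_domain m S. \<forall>\<epsilon>>0. \<exists>w\<in>dirichlet_domain m S \<inter> compactly_supported_continuous.
        dirichlet_form1 m S (\<lambda>x. u x - w x) (\<lambda>x. u x - w x) < \<epsilon>) \<and>
     (\<forall>f\<in>compactly_supported_continuous. \<forall>\<epsilon>>0.
        \<exists>w\<in>dirichlet_domain m S \<inter> compactly_supported_continuous. \<forall>x. \<bar>f x - w x\<bar> < \<epsilon>)"

definition open_capacity ::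
  "'a::topological_space measure \<Rightarrow> (real \<Rightarrow> ('a \<Rightarrow> real) \<Rightarrow> 'a \<Rightarrow> real) \<Rightarrow> 'a set \<Rightarrow> ennreal" where
  "open_capacity m S G =
     (INF u\<in>{u \<in> dirichlet_domain m S. AE x in m. x \<in> G \<longrightarrow> 1 \<le> u x}. ennreal (dirichlet_form1 m S u u))"

definition quasi_continuous ::
  "'a::topological_space measure \<Rightarrow> (real \<Rightarrow> ('a \<Rightarrow> real) \<Rightarrow> 'a \<Rightarrow> real) \<Rightarrow> ('a \<Rightarrow> real) \<Rightarrow> bool" where
  "quasi_continuous m S u \<longleftrightarrow>
     (\<forall>\<epsilon>>0. \<exists>G. open G \<and> open_capacity m S G < \<epsilon> \<and> continuous_on (- G) u)"

locale symmetric_hunt_process = hunt_process \<Omega> \<xi> \<tau> Pr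
  for \<Omega> :: "'w set"
    and \<xi> :: "ennreal \<Rightarrow> 'w \<Rightarrow> 'a::{metric_space, second_countable_topology} option"
    and \<tau> :: "ennreal \<Rightarrow> 'w \<Rightarrow> 'w"
    and Pr :: "'a option \<Rightarrow> 'w measure" +
  fixes m :: "'a measure"
    and p :: "real \<Rightarrow> 'a \<Rightarrow> 'a \<Rightarrow> ennreal"
  assumes sets_m: "sets m = sets borel"
    and sigma_finite_m: "sigma_finite_measure m"
    and full_support_m: "full_support m"
    and symmetric: "\<And>t f g. 0 \<le> t \<Longrightarrow> f \<in> borel_measurable borel \<Longrightarrow> g \<in> borel_measurable borel \<Longrightarrow>
          (\<integral>\<^sup>+x. (\<integral>\<^sup>+\<omega>. extend_zero f (\<xi> (ennreal t) \<omega>) \<partial>Pr (Some x)) * g x \<partial>m)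
          = (\<integral>\<^sup>+x. f x * (\<integral>\<^sup>+\<omega>. extend_zero g (\<xi> (ennreal t) \<omega>) \<partial>Pr (Some x)) \<partial>m)"
    and density_measurable: "(\<lambda>(t, x, y). p t x y)
          \<in> borel_measurable (restrict_space borel {0<..} \<Otimes>\<^sub>M borel \<Otimes>\<^sub>M borel)"
    and transition_density: "\<And>t x B. 0 < t \<Longrightarrow> B \<in> sets borel \<Longrightarrow>
          emeasure (Pr (Some x)) {\<omega> \<in> \<Omega>. \<xi> (ennreal t) \<omega> \<in> Some ` B} = (\<integral>\<^sup>+y\<in>B. p t x y \<partial>m)"
    and density_symmetric: "\<And>t x y. 0 < t \<Longrightarrow> p t x y = p t y x"
    and regular: "regular_dirichlet m (transition_semigroup \<xi> Pr)"

section \<open>Smooth measures in the strict sense and the Kato class\<close>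

text \<open>Minimum augmented filtration; \<^term>\<open>Giry_Monad.bind \<mu> Pr\<close> is the law of \<open>\<xi>\<close> with initial distribution \<open>\<mu>\<close>.\<close>

definition augmented_filtration ::
  "'w set \<Rightarrow> (ennreal \<Rightarrow> 'w \<Rightarrow> 'a::t2_space option) \<Rightarrow> ('a option \<Rightarrow> 'w measure) \<Rightarrow> ennreal \<Rightarrow> 'w measure" where
  "augmented_filtration \<Omega> \<xi> Pr t = sigma \<Omega>
     {A. A \<subseteq> \<Omega> \<and> (\<forall>\<mu>\<in>space (prob_algebra cemetery_borel).
        \<exists>B\<in>sets (raw_filtration \<Omega> \<xi> t). \<exists>N\<in>null_sets (Giry_Monad.bind \<mu> Pr). (A - B) \<union> (B - A) \<subseteq> N)}"

text \<open>Positive continuous additive functionals in the strict sense (no exceptional set of starting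
  points). They may become infinite at the lifetime.\<close>

definition strict_pcaf ::
  "'w set \<Rightarrow> (ennreal \<Rightarrow> 'w \<Rightarrow> 'a::t2_space option) \<Rightarrow> (ennreal \<Rightarrow> 'w \<Rightarrow> 'w) \<Rightarrow> ('a option \<Rightarrow> 'w measure) \<Rightarrow>
   (ennreal \<Rightarrow> 'w \<Rightarrow> ennreal) \<Rightarrow> bool" where
  "strict_pcaf \<Omega> \<xi> \<tau> Pr A \<longleftrightarrow>
     (\<forall>t<\<top>. A t \<in> borel_measurable (augmented_filtration \<Omega> \<xi> Pr t)) \<and>
     (\<exists>\<Lambda>\<in>sets (augmented_filtration \<Omega> \<xi> Pr \<top>).
        (\<forall>x. AE \<omega> in Pr (Some x). \<omega> \<in> \<Lambda>) \<and>
        (\<forall>t. 0 < t \<and> t < \<top> \<longrightarrow> \<tau> t ` \<Lambda> \<subseteq> \<Lambda>) \<and>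
        (\<forall>\<omega>\<in>\<Lambda>.
           A 0 \<omega> = 0 \<and>
           continuous_on {..<\<top>} (\<lambda>t. A t \<omega>) \<and>
           (\<forall>t<lifetime \<xi> \<omega>. A t \<omega> < \<top>) \<and>
           (\<forall>t<\<top>. lifetime \<xi> \<omega> \<le> t \<longrightarrow> A t \<omega> = A (lifetime \<xi> \<omega>) \<omega>) \<and>
           (\<forall>s<\<top>. \<forall>t<\<top>. A (s + t) \<omega> = A s \<omega> + A t (\<tau> s \<omega>))))"

text \<open>\<open>\<integral>\<^sub>0\<^sup>t f(\<xi>\<^sub>s) dA\<^sub>s\<close>. The truncations \<open>A \<and> n\<close> only serve to obtain finite-valued distribution
  functions; since \<open>f(\<partial>) = 0\<close>, only times before the lifetime, where \<open>A\<close> is finite, contribute.\<close>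

definition pcaf_integral ::
  "(ennreal \<Rightarrow> 'w \<Rightarrow> 'a option) \<Rightarrow> (ennreal \<Rightarrow> 'w \<Rightarrow> ennreal) \<Rightarrow> ('a \<Rightarrow> ennreal) \<Rightarrow> real \<Rightarrow> 'w \<Rightarrow> ennreal" where
  "pcaf_integral \<xi> A f t \<omega> =
     (SUP n::nat. \<integral>\<^sup>+s\<in>{0..t}. extend_zero f (\<xi> (ennreal s) \<omega>)
        \<partial>interval_measure (\<lambda>s. enn2real (min (A (ennreal s) \<omega>) (of_nat n))))"

text \<open>Completions appear because \<open>A\<close> is only adapted to the augmented filtration.\<close>

definition revuz_measure ::
  "(ennreal \<Rightarrow> 'w \<Rightarrow> 'a::topological_space option) \<Rightarrow> ('a option \<Rightarrow> 'w measure) \<Rightarrow> 'a measure \<Rightarrow>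
   (ennreal \<Rightarrow> 'w \<Rightarrow> ennreal) \<Rightarrow> 'a measure \<Rightarrow> bool" where
  "revuz_measure \<xi> Pr m A \<nu> \<longleftrightarrow>
     sets \<nu> = sets borel \<and>
     (\<forall>f\<in>borel_measurable borel.
        ((\<lambda>t. (\<integral>\<^sup>+x. (\<integral>\<^sup>+\<omega>. pcaf_integral \<xi> A f t \<omega> \<partial>completion (Pr (Some x))) \<partial>completion m)
               / ennreal t)
         \<longlongrightarrow> (\<integral>\<^sup>+x. f x \<partial>\<nu>)) (at_right 0))"

definition smooth_measure_strict ::
  "'w set \<Rightarrow> (ennreal \<Rightarrow> 'w \<Rightarrow> 'a::t2_space option) \<Rightarrow> (ennreal \<Rightarrow> 'w \<Rightarrow> 'w) \<Rightarrow> ('a option \<Rightarrow> 'w measure) \<Rightarrow>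
   'a measure \<Rightarrow> 'a measure \<Rightarrow> bool" where
  "smooth_measure_strict \<Omega> \<xi> \<tau> Pr m \<nu> \<longleftrightarrow>
     (\<exists>A. strict_pcaf \<Omega> \<xi> \<tau> Pr A \<and> revuz_measure \<xi> Pr m A \<nu>)"

definition kato_class ::
  "'w set \<Rightarrow> (ennreal \<Rightarrow> 'w \<Rightarrow> 'a::t2_space option) \<Rightarrow> (ennreal \<Rightarrow> 'w \<Rightarrow> 'w) \<Rightarrow> ('a option \<Rightarrow> 'w measure) \<Rightarrow>
   'a measure \<Rightarrow> (real \<Rightarrow> 'a \<Rightarrow> 'a \<Rightarrow> ennreal) \<Rightarrow> 'a measure set" where
  "kato_class \<Omega> \<xi> \<tau> Pr m p =
     {\<nu>. smooth_measure_strict \<Omega> \<xi> \<tau> Pr m \<nu> \<and>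
         ((\<lambda>t. SUP x. \<integral>\<^sup>+s\<in>{0<..t}. (\<integral>\<^sup>+y. p s x y \<partial>\<nu>) \<partial>lborel) \<longlongrightarrow> 0) (at_right 0)}"

section \<open>Branching mechanism\<close>

definition phi_local ::
  "('a \<Rightarrow> real) \<Rightarrow> ('a \<Rightarrow> real) \<Rightarrow> ('a \<Rightarrow> real measure) \<Rightarrow> 'a \<Rightarrow> real \<Rightarrow> real" where
  "phi_local a b \<Pi>L x l = a x * l + b x * l\<^sup>2 + (\<integral>\<theta>. (exp (- l * \<theta>) - 1 + l * \<theta>) \<partial>\<Pi>L x)"

definition phi_nonlocal ::
  "('a \<Rightarrow> real) \<Rightarrow> ('a \<Rightarrow> 'a measure) \<Rightarrow> ('a \<Rightarrow> real measure) \<Rightarrow> 'a \<Rightarrow> ('a \<Rightarrow> real) \<Rightarrow> real" where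
  "phi_nonlocal c \<pi> \<Pi>NL x f =
     - c x * (\<integral>y. f y \<partial>\<pi> x) - (\<integral>\<theta>. (1 - exp (- \<theta> * (\<integral>y. f y \<partial>\<pi> x))) \<partial>\<Pi>NL x)"

definition branching_psi where
  "branching_psi a b \<Pi>L c \<pi> \<Pi>NL x f = phi_local a b \<Pi>L x (f x) + phi_nonlocal c \<pi> \<Pi>NL x f"

definition gamma_kernel ::
  "('a \<Rightarrow> real) \<Rightarrow> ('a \<Rightarrow> 'a measure) \<Rightarrow> ('a \<Rightarrow> real measure) \<Rightarrow> 'a \<Rightarrow> 'a measure" where
  "gamma_kernel c \<pi> \<Pi>NL x = scale_measure (ennreal (c x) + (\<integral>\<^sup>+\<theta>. ennreal \<theta> \<partial>\<Pi>NL x)) (\<pi> x)"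

definition mix_measure :: "'a::topological_space measure \<Rightarrow> ('a \<Rightarrow> 'a measure) \<Rightarrow> 'a measure" where
  "mix_measure m \<kappa> = measure_of UNIV (sets borel) (\<lambda>B. \<integral>\<^sup>+x. emeasure (\<kappa> x) B \<partial>m)"

text \<open>The measures \<open>\<Pi>L x\<close> and \<open>\<Pi>NL x\<close> live on \<open>(0,\<infinity>)\<close>.\<close>

locale branching_mechanism =
  fixes a b :: "'a::{metric_space, second_countable_topology} \<Rightarrow> real"
    and \<Pi>L :: "'a \<Rightarrow> real measure"
    and c :: "'a \<Rightarrow> real"
    and \<pi> :: "'a \<Rightarrow> 'a measure"
    and \<Pi>NL :: "'a \<Rightarrow> real measure"
  assumes a: "a \<in> bounded_borel"
    and b: "b \<in> bounded_borel_nonneg"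
    and sets_\<Pi>L: "\<And>x. sets (\<Pi>L x) = sets (restrict_space borel {0<..})"
    and \<Pi>L: "bounded_kernel (restrict_space borel {0<..})
               (\<lambda>x. density (\<Pi>L x) (\<lambda>\<theta>. ennreal (min \<theta> (\<theta>\<^sup>2))))"
    and c: "c \<in> bounded_borel_nonneg"
    and \<pi>: "\<pi> \<in> borel \<rightarrow>\<^sub>M prob_algebra borel"
    and \<pi>_nontrivial: "\<exists>x. measure (\<pi> x) {x} \<noteq> 1"
    and sets_\<Pi>NL: "\<And>x. sets (\<Pi>NL x) = sets (restrict_space borel {0<..})"
    and \<Pi>NL: "bounded_kernel (restrict_space borel {0<..})
               (\<lambda>x. density (\<Pi>NL x) (\<lambda>\<theta>. ennreal \<theta>))"
    and gamma_nonzero: "{x. 0 < emeasure (gamma_kernel c \<pi> \<Pi>NL x) UNIV} \<noteq> {}"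

text \<open>As an element of the form domain, \<open>u\<close> must be represented by a quasi-continuous version here:
  the mixture of the kernels \<open>\<gamma>(x, \<cdot>)\<close> may be singular with respect to \<open>m\<close>. For \<open>v\<close> the choice
  of the version is immaterial.\<close>

definition Q_form ::
  "'a measure \<Rightarrow> (real \<Rightarrow> ('a \<Rightarrow> real) \<Rightarrow> 'a \<Rightarrow> real) \<Rightarrow> ('a \<Rightarrow> real) \<Rightarrow> ('a \<Rightarrow> 'a measure) \<Rightarrow>
   ('a \<Rightarrow> real) \<Rightarrow> ('a \<Rightarrow> real) \<Rightarrow> real" where
  "Q_form m S a \<gamma> u v =
     dirichlet_form m S u v + (\<integral>x. a x * u x * v x \<partial>m) - (\<integral>x. (\<integral>y. u y * v x \<partial>\<gamma> x) \<partial>m)"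

section \<open>Superprocesses\<close>

definition finite_borel_measures :: "'a::topological_space measure set" where
  "finite_borel_measures = {\<mu>. sets \<mu> = sets borel \<and> finite_measure \<mu>}"

definition weak_topology :: "'a::topological_space measure topology" where
  "weak_topology = topology_generated_by
     {{\<mu> \<in> finite_borel_measures. (\<integral>x. f x \<partial>\<mu>) \<in> U} | f U. f \<in> bounded_continuous \<and> open U}"

definition weak_borel :: "'a::topological_space measure measure" where
  "weak_borel = sigma finite_borel_measures {U. openin weak_topology U}"

text \<open>Right-continuous paths \<open>[0,\<infinity>) \<rightarrow> \<M>(E)\<close> with the zero measure as a trap; as extensional
  functions, paths carry no information at negative times.\<close>

definition path_space :: "(real \<Rightarrow> 'a::topological_space measure) set" where
  "path_space = {w \<in> {0..} \<rightarrow>\<^sub>E finite_borel_measures.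
     (\<forall>t\<ge>0. limitin weak_topology w (w t) (at_right t)) \<and>
     (\<forall>s t. 0 \<le> s \<and> s \<le> t \<and> w s = null_measure borel \<longrightarrow> w t = null_measure borel)}"

definition path_sigma :: "(real \<Rightarrow> 'a::topological_space measure) measure" where
  "path_sigma = generated_sigma path_space {0..} (\<lambda>t w. w t) weak_borel"

definition path_filtration :: "real \<Rightarrow> (real \<Rightarrow> 'a::topological_space measure) measure" where
  "path_filtration t = generated_sigma path_space {0..t} (\<lambda>s w. w s) weak_borel"

definition log_laplace_solution ::
  "(ennreal \<Rightarrow> 'w \<Rightarrow> 'a::topological_space option) \<Rightarrow> ('a option \<Rightarrow> 'w measure) \<Rightarrow>
   ('a \<Rightarrow> ('a \<Rightarrow> real) \<Rightarrow> real) \<Rightarrow> ('a \<Rightarrow> real) \<Rightarrow> (real \<Rightarrow> 'a \<Rightarrow> real) \<Rightarrow> bool" where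
  "log_laplace_solution \<xi> Pr \<psi> f v \<longleftrightarrow>
     (\<lambda>(x, t). v t x) \<in> borel_measurable (borel \<Otimes>\<^sub>M restrict_space borel {0..}) \<and>
     (\<forall>t\<ge>0. \<forall>x. 0 \<le> v t x) \<and>
     (\<forall>T\<ge>0. \<exists>C. \<forall>t\<in>{0..T}. \<forall>x. \<bar>v t x\<bar> \<le> C) \<and>
     (\<forall>t\<ge>0. \<forall>x. v t x = transition_semigroup \<xi> Pr t f x
        - (\<integral>\<omega>. (LINT s:{0..t}|lborel. extend_zero (\<lambda>y. \<psi> y (v (t - s))) (\<xi> (ennreal s) \<omega>)) \<partial>Pr (Some x)))"

locale superprocess =
  symmetric_hunt_process \<Omega> \<xi> \<tau> Pr m p + branching_mechanism a b \<Pi>L c \<pi> \<Pi>NL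
  for \<Omega> :: "'w set"
    and \<xi> :: "ennreal \<Rightarrow> 'w \<Rightarrow> 'a::{metric_space, second_countable_topology} option"
    and \<tau> :: "ennreal \<Rightarrow> 'w \<Rightarrow> 'w"
    and Pr :: "'a option \<Rightarrow> 'w measure"
    and m :: "'a measure"
    and p :: "real \<Rightarrow> 'a \<Rightarrow> 'a \<Rightarrow> ennreal"
    and a b :: "'a \<Rightarrow> real"
    and \<Pi>L :: "'a \<Rightarrow> real measure"
    and c :: "'a \<Rightarrow> real"
    and \<pi> :: "'a \<Rightarrow> 'a measure"
    and \<Pi>NL :: "'a \<Rightarrow> real measure" +
  fixes V :: "real \<Rightarrow> ('a \<Rightarrow> real) \<Rightarrow> 'a \<Rightarrow> real"
    and P :: "'a measure \<Rightarrow> (real \<Rightarrow> 'a measure) measure"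
  assumes V_solution: "\<And>f. f \<in> bounded_borel_nonneg \<Longrightarrow>
          log_laplace_solution \<xi> Pr (branching_psi a b \<Pi>L c \<pi> \<Pi>NL) f (\<lambda>t. V t f)"
    and V_unique: "\<And>f v t. f \<in> bounded_borel_nonneg \<Longrightarrow>
          log_laplace_solution \<xi> Pr (branching_psi a b \<Pi>L c \<pi> \<Pi>NL) f v \<Longrightarrow> 0 \<le> t \<Longrightarrow> v t = V t f"
    and path_laws: "P \<in> weak_borel \<rightarrow>\<^sub>M prob_algebra path_sigma"
    and initial: "\<And>\<mu>. \<mu> \<in> finite_borel_measures \<Longrightarrow> AE w in P \<mu>. w 0 = \<mu>"
    and Markov: "\<And>\<mu> s t B. \<mu> \<in> finite_borel_measures \<Longrightarrow> 0 \<le> s \<Longrightarrow> 0 \<le> t \<Longrightarrow> B \<in> sets weak_borel \<Longrightarrow>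
          AE w in P \<mu>. real_cond_exp (P \<mu>) (path_filtration t) (\<lambda>w. indicator B (w (t + s))) w
            = measure (P (w t)) {w' \<in> path_space. w' s \<in> B}"
    and Laplace: "\<And>\<mu> f t. \<mu> \<in> finite_borel_measures \<Longrightarrow> f \<in> bounded_borel_nonneg \<Longrightarrow> 0 \<le> t \<Longrightarrow>
          (\<integral>w. exp (- (\<integral>x. f x \<partial>w t)) \<partial>P \<mu>) = exp (- (\<integral>x. V t f x \<partial>\<mu>))"

end

theory Submission
  imports Defs
begin

text \<open>Let \<open>S\<close> be the semigroup of \<open>\<xi>\<close> and \<open>\<gamma> f (x) = \<gamma>(x, f)\<close>. As \<open>n \<rightarrow> \<infinity>\<close>, the functions \<open>n V\<^sub>t(h / n)\<close>
  converge to the first moment \<open>u\<^sub>t(x)\<close> of \<open>\<langle>h, X\<^sub>t\<rangle>\<close> under \<open>\<delta>\<^sub>x\<close>, while the branching term becomes linear, so that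
  \<open>u\<^sub>t = S\<^sub>t h - \<integral>\<^sub>0\<^sup>t S\<^sub>s (a u\<^sub>t\<^sub>-\<^sub>s - \<gamma> u\<^sub>t\<^sub>-\<^sub>s) ds\<close>. Locally bounded solutions of this equation are unique.
  On the other hand, \<open>h\<close> solves \<open>\<E>(h, v) = (g, v)\<close> with the bounded function
  \<open>g = \<lambda>\<^sub>1 h - a h + \<gamma> h\<close>. Taking \<open>\<integral>\<^sub>0\<^sup>t S\<^sub>s v ds\<close> as test function gives \<open>h - S\<^sub>t h = \<integral>\<^sub>0\<^sup>t S\<^sub>s g ds\<close>
  almost everywhere; absolute continuity of the transition function and right
  continuity of the paths make it hold everywhere. Hence \<open>exp(- \<lambda>\<^sub>1 t) h\<close> solves the linear equation
  too, so it equals \<open>u\<^sub>t\<close>, and the Markov property turns this into the martingale property.\<close>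

section \<open>Path measurability and transition kernels of a Hunt process\<close>

text \<open>The argument stays with bounded Borel functions and pointwise identities. As h is
  bounded and continuous, \<open>\<gamma> h\<close> is a bounded function defined at every point and
  can be a summand of g. The form enters only as a limit of approximating forms, and the test
  functions are chosen so that this limit can be computed explicitly. The process is known through
  its Laplace functionals alone, which is why its mean is reached by way of V. With
  \<open>Z = <h, X_t>\<close>, the variables \<open>n (1 - exp (- Z / n))\<close> increase to Z and
  have explicit expectations, so Fatou's lemma yields integrability before any equation for the mean
  is available. The limit requires bounds on \<open>n V_t(h / n)\<close> that are uniform in n.
  Local boundedness of V, taken for each n separately, gives none, and the two-sided bound on the
  branching term is quadratic in the size of the function. A one-sided bound suffices, however: the
  quadratic and the local jump terms have a favourable sign, the rest is linear, and a Gronwall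
  estimate applies.\<close>

lemma sets_cemetery_borel: "sets cemetery_borel = sigma_sets UNIV {U. openin one_point_compactification U}"
  by (simp add: cemetery_borel_def)

lemma space_cemetery_borel [simp]: "space cemetery_borel = UNIV"
  by (simp add: cemetery_borel_def)

lemma Some_image_open: "open V \<Longrightarrow> Some ` V \<in> sets cemetery_borel"
  unfolding sets_cemetery_borel
  by (rule sigma_sets.Basic) (auto simp: openin_one_point_compactification inj_vimage_image_eq)

lemma Some_image_borel [measurable]:
  assumes "B \<in> sets (borel :: 'a::t2_space measure)"
  shows "Some ` B \<in> sets cemetery_borel"
proof -
  have "B \<in> sigma_sets UNIV {S. open S}"
    using assms by (simp add: borel_def)
  then show ?thesis
  proof induct
    case (Compl V)
    have "Some ` (UNIV - V) = Some ` (UNIV :: 'a set) - Some ` V" by auto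
    with Compl Some_image_open[of "UNIV :: 'a set"] show ?case by (simp add: sets.Diff)
  next
    case (Union A)
    have "Some ` \<Union> (range A) = (\<Union>i. Some ` A i)" by auto
    with Union show ?case by simp
  qed (auto intro: Some_image_open)
qed

lemma None_borel [measurable]: "{None} \<in> sets (cemetery_borel :: 'a::t2_space option measure)"
proof -
  have "space cemetery_borel - Some ` (UNIV :: 'a set) \<in> sets cemetery_borel"
    by (intro sets.Diff sets.top Some_image_borel) auto
  moreover have "space cemetery_borel - Some ` (UNIV :: 'a set) = {None}"
    by auto (metis not_None_eq rangeI)
  ultimately show ?thesis by simp
qed

text \<open>Any open set of the compactification is the image of an open set of E, up to the point
  \<open>None\<close>, and the preimage of \<open>None\<close> is the complement of that of E. So
  only open subsets of E have to be checked.\<close>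

lemma measurable_into_cemetery:
  assumes "\<And>V :: 'a::t2_space set. open V \<Longrightarrow> {x \<in> space M. f x \<in> Some ` V} \<in> sets M"
  shows "f \<in> M \<rightarrow>\<^sub>M cemetery_borel"
  unfolding cemetery_borel_def
proof (rule measurable_measure_of)
  fix U :: "'a option set" assume "U \<in> {U. openin one_point_compactification U}"
  then have U: "open (Some -` U)" by (simp add: openin_one_point_compactification)
  have 1: "{x \<in> space M. f x \<in> Some ` (Some -` U)} \<in> sets M" "{x \<in> space M. f x \<in> range Some} \<in> sets M"
    using assms[OF U] assms[OF open_UNIV] by simp_all
  have "f -` U \<inter> space M = {x \<in> space M. f x \<in> Some ` (Some -` U)} \<union>
     (if None \<in> U then space M - {x \<in> space M. f x \<in> range Some} else {})"
    by (auto simp: image_iff) (metis not_None_eq)+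
  also have "\<dots> \<in> sets M" using 1 by auto
  finally show "f -` U \<inter> space M \<in> sets M" .
qed auto

lemma measurable_Some [measurable]: "Some \<in> borel \<rightarrow>\<^sub>M (cemetery_borel :: 'a::t2_space option measure)"
  by (rule measurable_into_cemetery) (auto simp: inj_image_mem_iff)

text \<open>The parameter q is carried along because later integrands depend on time as well as on
  the state, as in \<open>\<psi> y (V (t - s) f)\<close> evaluated along the path.\<close>

lemma measurable_extend_zero_pair:
  fixes F :: "'q \<Rightarrow> 'a::t2_space \<Rightarrow> 'b::{zero, topological_space}"
  assumes F: "(\<lambda>(q, x). F q x) \<in> borel_measurable (M \<Otimes>\<^sub>M borel)"
  shows "(\<lambda>(q, z). extend_zero (F q) z) \<in> borel_measurable (M \<Otimes>\<^sub>M cemetery_borel)"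
proof -
  \<comment> \<open>A left inverse of \<open>Some\<close>. Its value at \<open>None\<close> is
    arbitrary, because the case distinction below replaces it by 0.\<close>
  define inv_Some :: "'a option \<Rightarrow> 'a" where "inv_Some = case_option undefined id"
  have [measurable]: "inv_Some \<in> cemetery_borel \<rightarrow>\<^sub>M borel"
  proof (rule borel_measurableI)
    fix V :: "'a set" assume V: "open V"
    have "inv_Some -` V \<inter> space cemetery_borel = Some ` V \<union> (if undefined \<in> V then {None} else {})"
      by (auto simp: inv_Some_def image_iff split: option.splits)
    then show "inv_Some -` V \<inter> space cemetery_borel \<in> sets cemetery_borel"
      using V None_borel by (auto simp: Some_image_open sets.insert_in_sets)
  qed
  have [measurable]: "Measurable.pred cemetery_borel (\<lambda>z :: 'a option. z = None)"
    unfolding pred_def using None_borel by simp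
  have "(\<lambda>(q, z). extend_zero (F q) z) =
     (\<lambda>p. if snd p = None then 0 else (\<lambda>(q, x). F q x) (fst p, inv_Some (snd p)))"
    by (auto simp: extend_zero_def inv_Some_def fun_eq_iff split: option.splits)
  also have "\<dots> \<in> borel_measurable (M \<Otimes>\<^sub>M cemetery_borel)"
    by (intro measurable_If measurable_const measurable_compose[OF _ F]) measurable
  finally show ?thesis .
qed

lemma measurable_extend_zero [measurable]:
  assumes "f \<in> borel_measurable (borel :: 'a::t2_space measure)"
  shows "extend_zero f \<in> borel_measurable cemetery_borel"
proof -
  have "(\<lambda>(q :: unit, z). extend_zero f z) \<in> borel_measurable (count_space UNIV \<Otimes>\<^sub>M cemetery_borel)"
    by (intro measurable_extend_zero_pair) (use assms in \<open>simp add: case_prod_beta\<close>)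
  then have "(\<lambda>z. (\<lambda>(q :: unit, z). extend_zero f z) ((), z)) \<in> borel_measurable cemetery_borel"
    by (rule measurable_compose[rotated]) measurable
  then show ?thesis by simp
qed

lemma extend_zero_simps [simp]: "extend_zero f None = 0" "extend_zero f (Some x) = f x"
  by (auto simp: extend_zero_def)

text \<open>A right-continuous path is the limit of its values at grid points to the right. The grid
  point depends on t only through an integer, so each approximation is a countable choice among
  measurable functions of w. Writing \<open>max 0 t\<close> lets the time variable range over all
  reals.\<close>

lemma borel_measurable_right_continuous:
  fixes Z :: "real \<Rightarrow> 'w \<Rightarrow> real"
  assumes [measurable]: "\<And>t. 0 \<le> t \<Longrightarrow> Z t \<in> borel_measurable M"
    and right: "\<And>w t. w \<in> space M \<Longrightarrow> 0 \<le> t \<Longrightarrow> ((\<lambda>s. Z s w) \<longlongrightarrow> Z t w) (at_right t)"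
  shows "(\<lambda>(t, w). Z (max 0 t) w) \<in> borel_measurable (borel \<Otimes>\<^sub>M M)"
proof -
  \<comment> \<open>Adding 1 after rounding down puts \<open>q n t\<close> strictly to the right of
    t, as a limit along \<open>at_right\<close> demands, even if t is itself a grid point.\<close>
  define q :: "nat \<Rightarrow> real \<Rightarrow> real" where "q n t = (real_of_int \<lfloor>t * real (Suc n)\<rfloor> + 1) / real (Suc n)" for n t
  have q_gt: "t < q n t" and q_le: "q n t \<le> t + 1 / real (Suc n)" for n t
    unfolding q_def by (simp_all add: field_simps del: of_nat_Suc) linarith+
  have q_lim: "(\<lambda>n. q n t) \<longlonglongrightarrow> t" for t
  proof (rule tendsto_sandwich)
    show "\<forall>\<^sub>F n in sequentially. t \<le> q n t" using q_gt by (auto intro!: always_eventually less_imp_le)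
    show "\<forall>\<^sub>F n in sequentially. q n t \<le> t + 1 / real (Suc n)" using q_le by (auto intro!: always_eventually)
    have "(\<lambda>n. t + 1 / real (Suc n)) \<longlonglongrightarrow> t + 0"
      by (intro tendsto_intros LIMSEQ_Suc[OF lim_1_over_n])
    then show "(\<lambda>n. t + 1 / real (Suc n)) \<longlonglongrightarrow> t" by simp
  qed auto
  show ?thesis
  proof (rule borel_measurable_LIMSEQ_real)
    fix p :: "real \<times> 'w" assume p: "p \<in> space (borel \<Otimes>\<^sub>M M)"
    obtain t w where tw: "p = (t, w)" "w \<in> space M" using p by (auto simp: space_pair_measure)
    have "filterlim (\<lambda>n. q n (max 0 t)) (at_right (max 0 t)) sequentially"
      unfolding filterlim_at using q_lim q_gt
      by (auto intro!: always_eventually simp: less_imp_neq[THEN not_sym])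
    from filterlim_compose[OF right[OF tw(2), of "max 0 t"] this]
    show "(\<lambda>n. case p of (t, w) \<Rightarrow> Z (q n (max 0 t)) w) \<longlonglongrightarrow> (case p of (t, w) \<Rightarrow> Z (max 0 t) w)"
      by (simp add: tw)
  next
    fix n
    have *: "(\<lambda>p :: real \<times> 'w. (\<lambda>i p. Z (max 0 ((real_of_int i + 1) / real (Suc n))) (snd p)) \<lfloor>max 0 (fst p) * real (Suc n)\<rfloor> p)
        \<in> borel_measurable (borel \<Otimes>\<^sub>M M)"
      by (rule measurable_compose_countable) measurable
    have "max 0 (q n (max 0 t)) = q n (max 0 t)" for t
      using q_gt[of "max 0 t" n] by simp
    then have "max 0 ((real_of_int \<lfloor>max 0 t * real (Suc n)\<rfloor> + 1) / real (Suc n)) = q n (max 0 t)" for t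
      by (simp add: q_def del: of_nat_Suc)
    with * show "(\<lambda>p. case p of (t, w) \<Rightarrow> Z (q n (max 0 t)) w) \<in> borel_measurable (borel \<Otimes>\<^sub>M M)"
      by (simp only: case_prod_beta)
  qed
qed

lemma (in prob_space) sigma_finite_subalgebraI: "subalgebra M F \<Longrightarrow> sigma_finite_subalgebra M F"
  by (intro finite_measure_subalgebra_is_sigma_finite)
     (simp add: finite_measure_subalgebra_def finite_measure_subalgebra_axioms_def finite_measure_axioms)

section \<open>Coordinate maps and transition kernels on E with the cemetery\<close>

context hunt_process
begin

abbreviation (input) "\<F> \<equiv> raw_filtration \<Omega> \<xi> \<top>"

lemma space_raw_filtration [simp]: "space (raw_filtration \<Omega> \<xi> t) = \<Omega>"
  unfolding raw_filtration_def generated_sigma_def by (rule space_measure_of) auto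

lemma sets_raw_filtration:
  "sets (raw_filtration \<Omega> \<xi> t) = sigma_sets \<Omega> {\<xi> i -` B \<inter> \<Omega> | i B. i \<in> {..t} \<and> B \<in> sets cemetery_borel}"
  unfolding raw_filtration_def generated_sigma_def by (rule sets_measure_of) auto

lemma measurable_xi_raw: "s \<le> t \<Longrightarrow> \<xi> s \<in> raw_filtration \<Omega> \<xi> t \<rightarrow>\<^sub>M cemetery_borel"
  by (rule measurableI) (auto simp: sets_raw_filtration intro!: sigma_sets.Basic)

lemma measurable_xi [measurable]: "\<xi> t \<in> \<F> \<rightarrow>\<^sub>M cemetery_borel"
  by (rule measurable_xi_raw) simp

lemma sets_Pr [measurable_cong]: "sets (Pr z) = sets \<F>"
  and prob_space_Pr: "prob_space (Pr z)"
  using measurable_space[OF laws, of z] by (auto simp: space_prob_algebra)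

lemma space_Pr [simp]: "space (Pr z) = \<Omega>"
  using sets_eq_imp_space_eq[OF sets_Pr] by simp

lemma absorbing: "\<omega> \<in> \<Omega> \<Longrightarrow> \<xi> t \<omega> = None \<Longrightarrow> t \<le> s \<Longrightarrow> \<xi> s \<omega> = None"
  by (rule cemetery) (auto simp: lifetime_def intro: Inf_lower2)

text \<open>A continuous f need not vanish at infinity, so \<open>extend_zero f\<close> may be
  discontinuous at \<open>None\<close>. At a time when the path is in the cemetery, absorption
  replaces continuity; elsewhere f is composed with the path inside E, which is open in the
  compactification.\<close>

lemma right_continuous_extend_zero:
  fixes f :: "'a \<Rightarrow> real"
  assumes f: "continuous_on UNIV f" and \<omega>: "\<omega> \<in> \<Omega>" and t: "t < \<top>"
  shows "((\<lambda>s. extend_zero f (\<xi> s \<omega>)) \<longlongrightarrow> extend_zero f (\<xi> t \<omega>)) (at_right t)"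
proof (cases "\<xi> t \<omega>")
  case None
  have "\<forall>\<^sub>F s in at_right t. extend_zero f (\<xi> s \<omega>) = 0"
    using absorbing[OF \<omega> None] by (auto simp: eventually_at_filter intro!: always_eventually)
  then show ?thesis unfolding None by (simp add: tendsto_eventually)
next
  case (Some y)
  show ?thesis unfolding Some
  proof (rule topological_tendstoI)
    fix U assume U: "open U" "extend_zero f (Some y) \<in> U"
    have "openin one_point_compactification (Some ` (f -` U))"
      using f U by (auto simp: openin_one_point_compactification inj_vimage_image_eq continuous_on_open_vimage)
    moreover have "Some y \<in> Some ` (f -` U)" using U by auto
    ultimately have "\<forall>\<^sub>F s in at_right t. \<xi> s \<omega> \<in> Some ` (f -` U)"
      using right_continuous[OF \<omega> t] Some by (auto simp: limitin_def)
    then show "\<forall>\<^sub>F s in at_right t. extend_zero f (\<xi> s \<omega>) \<in> U"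
      by eventually_elim auto
  qed
qed

lemma right_continuous_extend_zero_real:
  fixes f :: "'a \<Rightarrow> real"
  assumes f: "continuous_on UNIV f" and \<omega>: "\<omega> \<in> \<Omega>" and t: "0 \<le> t"
  shows "((\<lambda>s. extend_zero f (\<xi> (ennreal s) \<omega>)) \<longlongrightarrow> extend_zero f (\<xi> (ennreal t) \<omega>)) (at_right t)"
proof (rule filterlim_compose[OF right_continuous_extend_zero[OF f \<omega>]])
  show "filterlim ennreal (at_right (ennreal t)) (at_right t)"
    unfolding filterlim_at
    using t by (auto intro!: tendsto_intros simp: eventually_at_filter ennreal_less_iff less_imp_neq ennreal_eq_0_iff)
qed simp

text \<open>Each open V is the set where some continuous f is positive, and
  \<open>extend_zero f\<close> along a path is a right-continuous real function of time. This
  reduces joint measurability to the real-valued case.\<close>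

lemma measurable_xi_pair [measurable]:
  "(\<lambda>(s, \<omega>). \<xi> (ennreal s) \<omega>) \<in> borel \<Otimes>\<^sub>M \<F> \<rightarrow>\<^sub>M cemetery_borel"
proof (rule measurable_into_cemetery)
  fix V :: "'a set" assume V: "open V"
  \<comment> \<open>By convention the distance to the empty set is 0, so \<open>V = UNIV\<close>
    needs an f of its own.\<close>
  define f where "f x = (if V = UNIV then 1 else infdist x (- V))" for x
  have f: "continuous_on UNIV f"
    unfolding f_def by (cases "V = UNIV") (auto intro!: continuous_intros)
  have f_pos: "0 < f x \<longleftrightarrow> x \<in> V" for x
  proof (cases "V = UNIV")
    case False
    have "closed (- V)" using V by auto
    moreover have "- V \<noteq> {}" using False by auto
    ultimately have "x \<in> - V \<longleftrightarrow> infdist x (- V) = 0" by (rule in_closed_iff_infdist_zero)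
    with infdist_nonneg[of x "- V"] show ?thesis by (auto simp: f_def False)
  qed (simp add: f_def)
  have [measurable]: "f \<in> borel_measurable borel" using f by (rule borel_measurable_continuous_onI)
  have [measurable]: "(\<lambda>(t, \<omega>). extend_zero f (\<xi> (ennreal (max 0 t)) \<omega>)) \<in> borel_measurable (borel \<Otimes>\<^sub>M \<F>)"
  proof (rule borel_measurable_right_continuous[where Z = "\<lambda>t \<omega>. extend_zero f (\<xi> (ennreal t) \<omega>)"])
    show "((\<lambda>s. extend_zero f (\<xi> (ennreal s) \<omega>)) \<longlongrightarrow> extend_zero f (\<xi> (ennreal t) \<omega>)) (at_right t)"
      if "\<omega> \<in> space \<F>" "0 \<le> t" for t \<omega>
      by (rule right_continuous_extend_zero_real[OF f]) (use that in auto)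
  qed measurable
  have "{p \<in> space (borel \<Otimes>\<^sub>M \<F>). (case p of (s, \<omega>) \<Rightarrow> \<xi> (ennreal s) \<omega>) \<in> Some ` V} =
    {p \<in> space (borel \<Otimes>\<^sub>M \<F>). 0 < (case p of (t, \<omega>) \<Rightarrow> extend_zero f (\<xi> (ennreal (max 0 t)) \<omega>))}"
  proof -
    have "0 < extend_zero f z \<longleftrightarrow> z \<in> Some ` V" for z using f_pos by (cases z) auto
    moreover have "ennreal (max 0 s) = ennreal s" for s by (simp add: max_def ennreal_neg)
    ultimately show ?thesis by (simp only: case_prod_beta)
  qed
  also have "\<dots> \<in> sets (borel \<Otimes>\<^sub>M \<F>)" by measurable
  finally show "{p \<in> space (borel \<Otimes>\<^sub>M \<F>). (case p of (s, \<omega>) \<Rightarrow> \<xi> (ennreal s) \<omega>) \<in> Some ` V}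
     \<in> sets (borel \<Otimes>\<^sub>M \<F>)" .
qed

text \<open>Keeping the cemetery as a state makes these probability measures even when the process
  is killed, and the Chapman-Kolmogorov equation becomes a single \<open>bind\<close>.\<close>

definition transition :: "real \<Rightarrow> 'a option \<Rightarrow> 'a option measure" where
  "transition s z = distr (Pr z) cemetery_borel (\<xi> (ennreal s))"

lemma sets_transition [simp, measurable_cong]: "sets (transition s z) = sets cemetery_borel"
  by (simp add: transition_def)

lemma space_transition [simp]: "space (transition s z) = UNIV"
  by (simp add: transition_def)

lemma measurable_xi_Pr [measurable]: "\<xi> t \<in> Pr z \<rightarrow>\<^sub>M cemetery_borel"
  by (simp add: measurable_cong_sets[OF sets_Pr refl] measurable_xi)

lemma prob_space_transition: "prob_space (transition s z)"
  unfolding transition_def by (intro prob_space.prob_space_distr prob_space_Pr measurable_xi_Pr)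

lemma measurable_transition [measurable]: "(\<lambda>(s, z). transition s z) \<in> borel \<Otimes>\<^sub>M cemetery_borel \<rightarrow>\<^sub>M prob_algebra cemetery_borel"
  unfolding transition_def case_prod_beta
  by (rule measurable_distr_prob_space2[where M = "\<F>"]) (use laws in measurable)

lemma measurable_transition1 [measurable]: "transition s \<in> cemetery_borel \<rightarrow>\<^sub>M prob_algebra cemetery_borel"
proof -
  have "(\<lambda>z. (\<lambda>(s, z). transition s z) (s, z)) \<in> cemetery_borel \<rightarrow>\<^sub>M prob_algebra cemetery_borel"
    by measurable
  then show ?thesis by simp
qed

text \<open>The intersection over later times is already a sigma-algebra, so the
  \<open>sigma\<close> in the definition adds no sets. Time \<open>\<top>\<close> has no later times
  and is treated apart.\<close>

lemma raw_filtration_right: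
  "space (raw_filtration_right \<Omega> \<xi> t) = \<Omega>"
  "t < \<top> \<Longrightarrow> sets (raw_filtration_right \<Omega> \<xi> t) = (\<Inter>u\<in>{t<..}. sets (raw_filtration \<Omega> \<xi> u))"
  "sets (raw_filtration_right \<Omega> \<xi> \<top>) = sets \<F>"
proof -
  have *: "(\<Inter>u\<in>{t<..}. sets (raw_filtration \<Omega> \<xi> u)) \<subseteq> Pow \<Omega>" if "t < \<top>"
  proof -
    have "(\<Inter>u\<in>{t<..}. sets (raw_filtration \<Omega> \<xi> u)) \<subseteq> sets \<F>"
      using that by (intro INT_lower) auto
    also have "\<dots> \<subseteq> Pow \<Omega>" using sets.space_closed[of \<F>] by simp
    finally show ?thesis .
  qed
  show "space (raw_filtration_right \<Omega> \<xi> t) = \<Omega>"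
  proof (cases "t = \<top>")
    case False
    then have "t < \<top>" by (simp add: top.not_eq_extremum)
    from *[OF this] False show ?thesis by (simp add: raw_filtration_right_def)
  qed (simp add: raw_filtration_right_def)
  show "sets (raw_filtration_right \<Omega> \<xi> \<top>) = sets \<F>"
    by (simp add: raw_filtration_right_def)
  assume t: "t < \<top>"
  have "sigma_algebra \<Omega> (\<Inter>u\<in>{t<..}. sets (raw_filtration \<Omega> \<xi> u))"
    unfolding sigma_algebra_iff2
  proof (intro conjI ballI allI impI *[OF t])
    fix A assume "A \<in> (\<Inter>u\<in>{t<..}. sets (raw_filtration \<Omega> \<xi> u))"
    then show "\<Omega> - A \<in> (\<Inter>u\<in>{t<..}. sets (raw_filtration \<Omega> \<xi> u))"
      by (metis (no_types, lifting) INT_iff sets.compl_sets space_raw_filtration)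
  next
    fix A :: "nat \<Rightarrow> 'w set" assume "range A \<subseteq> (\<Inter>u\<in>{t<..}. sets (raw_filtration \<Omega> \<xi> u))"
    then have "range A \<subseteq> sets (raw_filtration \<Omega> \<xi> u)" if "u \<in> {t<..}" for u using that by blast
    then show "\<Union> (range A) \<in> (\<Inter>u\<in>{t<..}. sets (raw_filtration \<Omega> \<xi> u))"
      by (intro INT_I sets.countable_UN) auto
  qed simp
  from sigma_algebra.sets_measure_of_eq[OF this] t
  show "sets (raw_filtration_right \<Omega> \<xi> t) = (\<Inter>u\<in>{t<..}. sets (raw_filtration \<Omega> \<xi> u))"
    by (simp add: raw_filtration_right_def less_imp_neq)
qed

lemma filtration_raw_filtration_right: "filtration \<Omega> (raw_filtration_right \<Omega> \<xi>)"
proof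
  fix i j :: ennreal assume ij: "i \<le> j"
  show "sets (raw_filtration_right \<Omega> \<xi> i) \<subseteq> sets (raw_filtration_right \<Omega> \<xi> j)"
  proof (cases "j = \<top>")
    case True
    show ?thesis
    proof (cases "i = \<top>")
      case False
      then have "i < \<top>" by (simp add: top.not_eq_extremum)
      then have "sets (raw_filtration_right \<Omega> \<xi> i) \<subseteq> sets \<F>"
        unfolding raw_filtration_right(2)[OF \<open>i < \<top>\<close>] by (intro INT_lower) simp
      with True show ?thesis by (simp add: raw_filtration_right)
    qed (simp add: True)
  next
    case False
    then have "j < \<top>" by (simp add: top.not_eq_extremum)
    moreover from this ij have "i < \<top>" by (rule le_less_trans[rotated])
    ultimately show ?thesis using ij by (auto simp: raw_filtration_right)
  qed
qed (rule raw_filtration_right)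

lemma transition_eq_return:
  assumes "AE \<omega> in Pr z. \<xi> (ennreal s) \<omega> = y"
  shows "transition s z = return cemetery_borel y"
proof -
  interpret prob_space "Pr z" by (rule prob_space_Pr)
  have "transition s z = distr (Pr z) cemetery_borel (\<lambda>_. y)"
    unfolding transition_def using assms by (intro distr_cong_AE) auto
  also have "\<dots> = return cemetery_borel y"
    by (intro measure_eqI)
       (auto simp: emeasure_distr emeasure_space_1 space_Pr[symmetric] simp del: space_Pr split: split_indicator)
  finally show ?thesis .
qed

lemma transition_0: "transition 0 z = return cemetery_borel z"
  using normal[of z] by (intro transition_eq_return) simp

lemma transition_None:
  assumes "0 \<le> s"
  shows "transition s None = return cemetery_borel None"
proof (rule transition_eq_return)
  show "AE \<omega> in Pr None. \<xi> (ennreal s) \<omega> = None"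
    using normal[of None] AE_space by eventually_elim (auto intro: absorbing)
qed

text \<open>The strong Markov property at the constant stopping time r, integrated over the whole
  space.\<close>

lemma chapman_kolmogorov:
  assumes r: "0 \<le> r" and s: "0 \<le> s"
  shows "transition (r + s) z = transition r z \<bind> transition s"
proof (rule measure_eqI)
  have [measurable]: "transition s \<in> cemetery_borel \<rightarrow>\<^sub>M subprob_algebra cemetery_borel"
    by (rule measurable_prob_algebraD) measurable
  show sets: "sets (transition (r + s) z) = sets (transition r z \<bind> transition s)"
    by (subst sets_bind[where N = cemetery_borel]) auto
  fix B assume "B \<in> sets (transition (r + s) z)"
  then have B [measurable]: "B \<in> sets cemetery_borel" by simp
  interpret prob_space "Pr z" by (rule prob_space_Pr)
  interpret filtration \<Omega> "raw_filtration_right \<Omega> \<xi>" by (rule filtration_raw_filtration_right)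
  let ?G = "pre_sigma (\<lambda>_. ennreal r)"
  have st: "stopping_time (raw_filtration_right \<Omega> \<xi>) (\<lambda>_. ennreal r)" by (rule stopping_time_const)
  have "subalgebra (Pr z) ?G"
    unfolding subalgebra_def
  proof (intro conjI subsetI)
    fix A assume "A \<in> sets ?G"
    \<comment> \<open>At time \<open>\<top>\<close> the condition defining the pre-sigma-algebra
      concerns A itself, since the constant r never exceeds \<open>\<top>\<close>.\<close>
    from sets_pre_sigmaD[OF st this, of \<top>] show "A \<in> sets (Pr z)"
      by (simp add: raw_filtration_right sets_Pr)
  qed (simp add: space_pre_sigma)
  then interpret sigma_finite_subalgebra "Pr z" ?G
    by (rule sigma_finite_subalgebraI)
  have rs: "ennreal r + ennreal s = ennreal (r + s)" using r s by simp
  let ?f = "\<lambda>\<omega>. indicator B (\<xi> (ennreal r + ennreal s) \<omega>) :: real"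
  have "measure (transition (r + s) z) B = (\<integral>\<omega>. ?f \<omega> \<partial>Pr z)"
  proof -
    have "measure (transition (r + s) z) B = (\<integral>y. indicator B y \<partial>transition (r + s) z)" by simp
    also have "\<dots> = (\<integral>\<omega>. ?f \<omega> \<partial>Pr z)"
      unfolding transition_def rs by (subst integral_distr) auto
    finally show ?thesis .
  qed
  also have "\<dots> = (\<integral>\<omega>. real_cond_exp (Pr z) ?G ?f \<omega> \<partial>Pr z)"
    by (rule real_cond_exp_int(2)[symmetric])
       (intro integrable_const_bound[where B = 1], auto simp: indicator_def)
  also have "\<dots> = (\<integral>\<omega>. measure (transition s (\<xi> (ennreal r) \<omega>)) B \<partial>Pr z)"
  proof (rule integral_cong_AE)
    show "AE \<omega> in Pr z. real_cond_exp (Pr z) ?G ?f \<omega> = measure (transition s (\<xi> (ennreal r) \<omega>)) B"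
      using strong_Markov[OF st B, of z "ennreal s"] 
      by (simp add: transition_def measure_distr vimage_def Int_def conj_commute)
  qed measurable
  also have "\<dots> = (\<integral>y. measure (transition s y) B \<partial>transition r z)"
    unfolding transition_def[of r] by (subst integral_distr) auto
  finally have "measure (transition (r + s) z) B = (\<integral>y. measure (transition s y) B \<partial>transition r z)" .
  moreover have "emeasure (transition r z \<bind> transition s) B = (\<integral>\<^sup>+y. emeasure (transition s y) B \<partial>transition r z)"
    by (rule emeasure_bind[where N = cemetery_borel]) auto
  moreover have "(\<integral>\<^sup>+y. emeasure (transition s y) B \<partial>transition r z) = ennreal (\<integral>y. measure (transition s y) B \<partial>transition r z)"
  proof -
    interpret T: prob_space "transition s y" for y by (rule prob_space_transition)
    interpret T': prob_space "transition r z" by (rule prob_space_transition)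
    show ?thesis
      unfolding T.emeasure_eq_measure
      by (rule nn_integral_eq_integral) (auto intro!: T'.integrable_const_bound[where B = 1])
  qed
  ultimately show "emeasure (transition (r + s) z) B = emeasure (transition r z \<bind> transition s) B"
    using prob_space_transition[of "r + s" z] by (simp add: finite_measure.emeasure_eq_measure prob_space_def)
qed

end

section \<open>The semigroup on bounded Borel functions\<close>

lemma bounded_borelI:
  assumes "f \<in> borel_measurable borel" "\<And>x. \<bar>f x\<bar> \<le> C"
  shows "f \<in> bounded_borel"
  using assms by (auto simp: bounded_borel_def bounded_iff)

lemma bounded_borel_measurable [measurable_dest]: "f \<in> bounded_borel \<Longrightarrow> f \<in> borel_measurable borel"
  by (simp add: bounded_borel_def)

lemma bounded_borelE:
  assumes "f \<in> bounded_borel"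
  obtains C where "0 < C" "\<And>x. \<bar>f x\<bar> \<le> C"
proof -
  from assms obtain C where "\<And>x. \<bar>f x\<bar> \<le> C" by (auto simp: bounded_borel_def bounded_iff)
  then have "\<And>x. \<bar>f x\<bar> \<le> max 1 C" by (meson max.coboundedI2)
  with that[of "max 1 C"] show ?thesis by simp
qed

text \<open>Pushing \<open>L x\<close> forward under \<open>y \<mapsto> (x, y)\<close> moves the
  parameter from the integrand into the measure, which leaves a fixed function integrated against a
  measurable kernel.\<close>

lemma integral_measurable_subprob_algebra2:
  fixes f :: "'q \<Rightarrow> 'z \<Rightarrow> real"
  assumes f [measurable]: "(\<lambda>(x, y). f x y) \<in> borel_measurable (M \<Otimes>\<^sub>M N)"
    and L [measurable]: "L \<in> M \<rightarrow>\<^sub>M subprob_algebra N"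
  shows "(\<lambda>x. \<integral>y. f x y \<partial>L x) \<in> borel_measurable M"
proof -
  note measurable_distr2 [measurable]
  have "(\<lambda>x. integral\<^sup>L (distr (L x) (M \<Otimes>\<^sub>M N) (\<lambda>y. (x, y))) (\<lambda>(x, y). f x y)) \<in> borel_measurable M"
    by (rule measurable_compose[OF _ integral_measurable_subprob_algebra[OF f]]) measurable
  also have "?this \<longleftrightarrow> ?thesis"
  proof (rule measurable_cong)
    fix x assume x [measurable]: "x \<in> space M"
    have "sets (L x) = sets N" using measurable_space[OF L x] by (simp add: space_subprob_algebra)
    then have [measurable]: "Pair x \<in> L x \<rightarrow>\<^sub>M M \<Otimes>\<^sub>M N" by (simp add: x cong: measurable_cong_sets)
    show "integral\<^sup>L (distr (L x) (M \<Otimes>\<^sub>M N) (\<lambda>y. (x, y))) (\<lambda>(x, y). f x y) = (\<integral>y. f x y \<partial>L x)"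
      by (subst integral_distr) auto
  qed
  finally show ?thesis .
qed

lemma measurable_section:
  assumes "(\<lambda>(s :: real, y). F s y :: real) \<in> borel_measurable (borel \<Otimes>\<^sub>M borel)"
  shows "F s \<in> borel_measurable borel"
  using measurable_compose[OF measurable_Pair1' assms, of s] by simp

lemma dominated_convergence_at_right:
  fixes f' :: "real \<Rightarrow> 'z \<Rightarrow> real"
  assumes [measurable]: "f \<in> borel_measurable M" "\<And>s. t < s \<Longrightarrow> f' s \<in> borel_measurable M"
    and lim: "AE z in M. ((\<lambda>s. f' s z) \<longlongrightarrow> f z) (at_right t)"
    and bound: "\<And>s. t < s \<Longrightarrow> AE z in M. \<bar>f' s z\<bar> \<le> g z" and g: "integrable M g"
  shows "((\<lambda>s. \<integral>z. f' s z \<partial>M) \<longlongrightarrow> (\<integral>z. f z \<partial>M)) (at_right t)"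
  unfolding tendsto_at_iff_sequentially comp_def
proof (intro allI impI)
  fix X assume X: "\<forall>i. X i \<in> {t<..} - {t}" "X \<longlonglongrightarrow> t"
  show "(\<lambda>i. \<integral>z. f' (X i) z \<partial>M) \<longlonglongrightarrow> (\<integral>z. f z \<partial>M)"
  proof (rule integral_dominated_convergence[OF _ _ g])
    show "AE z in M. (\<lambda>i. f' (X i) z) \<longlonglongrightarrow> f z"
      using lim by eventually_elim (use X in \<open>auto simp: tendsto_at_iff_sequentially comp_def\<close>)
  qed (use X bound in auto)
qed

lemma integrable_indicator_Icc [simp]: "integrable lborel (indicat_real {c :: real..d})"
  by (rule integrable_real_indicator) (auto simp: emeasure_lborel_Icc_eq)

text \<open>A bound on the L1 norms that is uniform over a bounded time interval gives integrability
  on the product. M is only sigma-finite, so that path laws, m and Lebesgue measure are all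
  covered.\<close>

lemma
  fixes G :: "real \<Rightarrow> 'z \<Rightarrow> real"
  assumes M: "sigma_finite_measure M"
    and G [measurable]: "(\<lambda>(s, z). G s z) \<in> borel_measurable (borel \<Otimes>\<^sub>M M)"
    and int: "\<And>s. s \<in> {c..d} \<Longrightarrow> integrable M (G s)" "\<And>s. s \<in> {c..d} \<Longrightarrow> (\<integral>z. \<bar>G s z\<bar> \<partial>M) \<le> C"
  shows set_lborel_Fubini: "(\<integral>z. (LINT s:{c..d}|lborel. G s z) \<partial>M) = (LINT s:{c..d}|lborel. \<integral>z. G s z \<partial>M)"
    and set_lborel_Fubini_integrable: "integrable M (\<lambda>z. LINT s:{c..d}|lborel. G s z)"
proof -
  interpret M: sigma_finite_measure M by fact
  interpret pair_sigma_finite lborel M ..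
  let ?f = "\<lambda>s z. indicator {c..d} s * G s z"
  have 1: "integrable (lborel \<Otimes>\<^sub>M M) (\<lambda>(s, z). ?f s z)"
  proof (rule Fubini_integrable)
    show "integrable lborel (\<lambda>s. \<integral>z. norm (case (s, z) of (s, z) \<Rightarrow> ?f s z) \<partial>M)"
    proof (rule Bochner_Integration.integrable_bound)
      show "integrable lborel (\<lambda>s. indicator {c..d} s * C)" by simp
      show "AE s in lborel. norm (\<integral>z. norm (case (s, z) of (s, z) \<Rightarrow> ?f s z) \<partial>M) \<le> norm (indicator {c..d} s * C)"
      proof (rule AE_I2)
        fix s
        have "(\<integral>z. \<bar>G s z\<bar> \<partial>M) \<le> \<bar>C\<bar>" if "s \<in> {c..d}" using int(2)[OF that] by simp
        then show "norm (\<integral>z. norm (case (s, z) of (s, z) \<Rightarrow> ?f s z) \<partial>M) \<le> norm (indicator {c..d} s * C)"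
          by (auto simp: abs_mult split: split_indicator)
      qed
    qed measurable
    show "AE s in lborel. integrable M (\<lambda>z. case (s, z) of (s, z) \<Rightarrow> ?f s z)"
      using int(1) by (auto split: split_indicator)
  qed measurable
  have "(\<integral>z. (\<integral>s. ?f s z \<partial>lborel) \<partial>M) = (\<integral>s. (\<integral>z. ?f s z \<partial>M) \<partial>lborel)"
    using 1 by (rule Fubini_integral)
  also have "\<dots> = (LINT s:{c..d}|lborel. \<integral>z. G s z \<partial>M)"
    unfolding set_lebesgue_integral_def by (intro Bochner_Integration.integral_cong) auto
  finally show "(\<integral>z. (LINT s:{c..d}|lborel. G s z) \<partial>M) = (LINT s:{c..d}|lborel. \<integral>z. G s z \<partial>M)"
    by (simp add: set_lebesgue_integral_def)
  show "integrable M (\<lambda>z. LINT s:{c..d}|lborel. G s z)"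
    using integrable_snd[OF 1] by (simp add: set_lebesgue_integral_def)
qed

lemma set_integrable_Icc_bounded:
  fixes \<phi> :: "real \<Rightarrow> real"
  assumes [measurable]: "\<phi> \<in> borel_measurable borel" and bound: "\<And>s. s \<in> {c..d} \<Longrightarrow> \<bar>\<phi> s\<bar> \<le> C"
  shows "set_integrable lborel {c..d} \<phi>"
  unfolding set_integrable_def
proof (rule Bochner_Integration.integrable_bound)
  show "integrable lborel (\<lambda>s. indicator {c..d} s * C)" by simp
qed (use bound in \<open>force split: split_indicator\<close>)+

lemma abs_set_integral_Icc_le:
  fixes \<phi> :: "real \<Rightarrow> real"
  assumes "c \<le> d" and bound: "\<And>s. s \<in> {c..d} \<Longrightarrow> \<bar>\<phi> s\<bar> \<le> C"
  shows "\<bar>LINT s:{c..d}|lborel. \<phi> s\<bar> \<le> C * (d - c)"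
proof -
  have "\<bar>LINT s:{c..d}|lborel. \<phi> s\<bar> \<le> (\<integral>s. \<bar>indicator {c..d} s *\<^sub>R \<phi> s\<bar> \<partial>lborel)"
    unfolding set_lebesgue_integral_def by (rule integral_abs_bound)
  also have "\<dots> \<le> (\<integral>s. indicator {c..d} s * C \<partial>lborel)"
    by (rule integral_mono') (use bound in \<open>force split: split_indicator\<close>)+
  also have "\<dots> = C * (d - c)" using \<open>c \<le> d\<close> by simp
  finally show ?thesis .
qed

lemma set_integral_Icc_combine:
  fixes \<phi> :: "real \<Rightarrow> real"
  assumes "\<phi> \<in> borel_measurable borel" "\<And>s. \<bar>\<phi> s\<bar> \<le> C" "u \<le> v" "v \<le> w"
  shows "(LINT s:{u..w}|lborel. \<phi> s) = (LINT s:{u..v}|lborel. \<phi> s) + (LINT s:{v..w}|lborel. \<phi> s)"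
proof -
  have "(LINT s:{u..v} \<union> {v..w}|lborel. \<phi> s) = (LINT s:{u..v}|lborel. \<phi> s) + (LINT s:{v..w}|lborel. \<phi> s)"
  proof (rule set_integral_Un_AE)
    show "AE x in lborel. \<not> (x \<in> {u..v} \<and> x \<in> {v..w})"
      using AE_lborel_singleton[of v] by eventually_elim auto
  qed (use assms in \<open>auto intro!: set_integrable_Icc_bounded\<close>)
  moreover have "{u..v} \<union> {v..w} = {u..w}" using assms by auto
  ultimately show ?thesis by simp
qed

lemma set_integral_Icc_shift:
  fixes \<phi> :: "real \<Rightarrow> real"
  shows "(LINT s:{c..d}|lborel. \<phi> (r + s)) = (LINT s:{r + c..r + d}|lborel. \<phi> s)"
proof -
  have "(LINT s:{r + c..r + d}|lborel. \<phi> s) = (\<integral>s. indicator {r + c..r + d} (r + s) *\<^sub>R \<phi> (r + s) \<partial>lborel)"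
    unfolding set_lebesgue_integral_def by (subst lborel_integral_real_affine[where c = 1 and t = r]) simp_all
  also have "\<dots> = (LINT s:{c..d}|lborel. \<phi> (r + s))"
    unfolding set_lebesgue_integral_def by (intro Bochner_Integration.integral_cong) (auto split: split_indicator)
  finally show ?thesis by simp
qed

text \<open>The fundamental theorem of calculus at a single point of right continuity; away from t
  the integrand is merely bounded and measurable.\<close>

lemma right_continuous_average:
  fixes \<phi> :: "real \<Rightarrow> real"
  assumes [measurable]: "\<phi> \<in> borel_measurable borel" and bound: "\<And>s. \<bar>\<phi> s\<bar> \<le> C"
    and lim: "(\<phi> \<longlongrightarrow> \<phi> t) (at_right t)"
  shows "((\<lambda>r. (LINT s:{t..t + r}|lborel. \<phi> s) / r) \<longlongrightarrow> \<phi> t) (at_right 0)"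
proof (rule tendstoI)
  fix e :: real assume "0 < e"
  then have e: "0 < e / 2" by simp
  from tendstoD[OF lim e] obtain b where b: "t < b" "\<And>s. t < s \<Longrightarrow> s < b \<Longrightarrow> \<bar>\<phi> s - \<phi> t\<bar> < e / 2"
    by (auto simp: eventually_at_right_field dist_real_def)
  show "\<forall>\<^sub>F r in at_right 0. dist ((LINT s:{t..t + r}|lborel. \<phi> s) / r) (\<phi> t) < e"
    unfolding eventually_at_right_field
  proof (intro exI[of _ "b - t"] conjI allI impI)
    fix r assume r: "0 < r" "r < b - t"
    have "(LINT s:{t..t + r}|lborel. \<phi> s - \<phi> t) = (LINT s:{t..t + r}|lborel. \<phi> s) - (LINT s:{t..t + r}|lborel. \<phi> t)"
      by (rule set_integral_diff) (use bound in \<open>auto intro!: set_integrable_Icc_bounded\<close>)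
    also have "(LINT s:{t..t + r}|lborel. \<phi> t) = r * \<phi> t"
      using r by (simp add: set_lebesgue_integral_def)
    finally have "(LINT s:{t..t + r}|lborel. \<phi> s) / r - \<phi> t = (LINT s:{t..t + r}|lborel. \<phi> s - \<phi> t) / r"
      using r by (simp add: field_simps)
    moreover have "\<bar>LINT s:{t..t + r}|lborel. \<phi> s - \<phi> t\<bar> \<le> e / 2 * (t + r - t)"
    proof (rule abs_set_integral_Icc_le)
      show "\<bar>\<phi> s - \<phi> t\<bar> \<le> e / 2" if "s \<in> {t..t + r}" for s
        using b(2)[of s] that r e by (cases "s = t") auto
    qed (use r in simp)
    ultimately have "\<bar>(LINT s:{t..t + r}|lborel. \<phi> s) / r - \<phi> t\<bar> \<le> e / 2"
      using r by (simp add: field_simps)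
    then show "dist ((LINT s:{t..t + r}|lborel. \<phi> s) / r) (\<phi> t) < e"
      using \<open>0 < e\<close> by (simp add: dist_real_def)
  qed (use b in auto)
qed

section \<open>The transition semigroup as an operator on functions on E\<close>

context hunt_process
begin

abbreviation (input) "S \<equiv> transition_semigroup \<xi> Pr"

lemma S_eq:
  assumes [measurable]: "f \<in> borel_measurable borel"
  shows "S t f x = (\<integral>z. extend_zero f z \<partial>transition t (Some x))"
  unfolding transition_semigroup_def transition_def by (subst integral_distr) auto

lemma abs_extend_zero_le: "0 \<le> C \<Longrightarrow> (\<And>x. \<bar>f x\<bar> \<le> C) \<Longrightarrow> \<bar>extend_zero f z\<bar> \<le> (C :: real)"
  by (cases z) auto

lemma abs_S_le:
  assumes "\<And>x. \<bar>f x\<bar> \<le> C"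
  shows "\<bar>S t f x\<bar> \<le> C"
proof -
  interpret prob_space "Pr (Some x)" by (rule prob_space_Pr)
  have C: "0 \<le> C" using assms[of x] by simp
  have "\<bar>S t f x\<bar> \<le> (\<integral>\<omega>. \<bar>extend_zero f (\<xi> (ennreal t) \<omega>)\<bar> \<partial>Pr (Some x))"
    unfolding transition_semigroup_def by (rule integral_abs_bound)
  also have "\<dots> \<le> (\<integral>\<omega>. C \<partial>Pr (Some x))"
    by (rule integral_mono') (use C abs_extend_zero_le[OF C assms] in auto)
  finally show ?thesis by (simp add: prob_space del: space_Pr)
qed

lemma S_nonneg: "(\<And>x. 0 \<le> f x) \<Longrightarrow> 0 \<le> S t f x"
  unfolding transition_semigroup_def
  by (intro Bochner_Integration.integral_nonneg) (auto simp: extend_zero_def split: option.splits)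

lemma integrable_extend_zero:
  assumes "f \<in> bounded_borel"
  shows "integrable (Pr x) (\<lambda>\<omega>. extend_zero f (\<xi> t \<omega>))"
proof -
  interpret prob_space "Pr x" by (rule prob_space_Pr)
  have [measurable]: "f \<in> borel_measurable borel" using assms by measurable
  obtain C where C: "0 < C" "\<And>x. \<bar>f x\<bar> \<le> C" using assms by (metis bounded_borelE)
  show ?thesis
    by (rule integrable_const_bound[where B = C]) (use abs_extend_zero_le[of C f] C in auto)
qed

lemma S_diff:
  assumes "f \<in> bounded_borel" "g \<in> bounded_borel"
  shows "S t (\<lambda>x. f x - g x) x = S t f x - S t g x"
proof -
  have "extend_zero (\<lambda>x. f x - g x) z = extend_zero f z - extend_zero g z" for z
    by (cases z) auto
  then show ?thesis unfolding transition_semigroup_def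
    using integrable_extend_zero[OF assms(1)] integrable_extend_zero[OF assms(2)] by simp
qed

lemma S_cmult: "S t (\<lambda>x. c * f x) x = c * S t f x"
proof -
  have "extend_zero (\<lambda>x. c * f x) z = c * extend_zero f z" for z
    by (cases z) auto
  then show ?thesis unfolding transition_semigroup_def by simp
qed

lemma S_0:
  assumes [measurable]: "f \<in> borel_measurable borel"
  shows "S 0 f x = f x"
  unfolding S_eq[OF assms] transition_0 by (subst integral_return) auto

text \<open>Time, function and starting point may all vary with q, as they do in the integrand
  \<open>S s (\<lambda>y. \<psi> y (V (t - s) f)) x\<close> of the mild equation.\<close>

lemma measurable_S:
  assumes F: "(\<lambda>(q, x). F q x) \<in> borel_measurable (M \<Otimes>\<^sub>M borel)"
    and [measurable]: "g \<in> M \<rightarrow>\<^sub>M borel" "k \<in> M \<rightarrow>\<^sub>M borel"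
  shows "(\<lambda>q. S (g q) (F q) (k q)) \<in> borel_measurable M"
proof -
  have [measurable]: "(\<lambda>(q, z). extend_zero (F q) z) \<in> borel_measurable (M \<Otimes>\<^sub>M cemetery_borel)"
    using F by (rule measurable_extend_zero_pair)
  have "(\<lambda>q. \<integral>z. extend_zero (F q) z \<partial>transition (g q) (Some (k q))) \<in> borel_measurable M"
    by (rule integral_measurable_subprob_algebra2[where N = cemetery_borel])
       (measurable, rule measurable_prob_algebraD, measurable)
  moreover have "S (g q) (F q) (k q) = (\<integral>z. extend_zero (F q) z \<partial>transition (g q) (Some (k q)))" if "q \<in> space M" for q
    by (rule S_eq) (use measurable_compose[OF measurable_Pair1'[OF that] F] in simp)
  ultimately show ?thesis by (simp cong: measurable_cong)
qed

lemma measurable_S' [measurable]: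
  assumes [measurable]: "f \<in> borel_measurable borel"
    and [measurable]: "g \<in> M \<rightarrow>\<^sub>M borel" "k \<in> M \<rightarrow>\<^sub>M borel"
  shows "(\<lambda>q. S (g q) f (k q)) \<in> borel_measurable M"
  by (rule measurable_S) measurable

lemma S_bounded_borel:
  assumes f: "f \<in> bounded_borel"
  shows "S t f \<in> bounded_borel"
proof -
  have [measurable]: "f \<in> borel_measurable borel" using f by measurable
  obtain C where C: "0 < C" "\<And>x. \<bar>f x\<bar> \<le> C" using f by (metis bounded_borelE)
  show ?thesis by (rule bounded_borelI[OF _ abs_S_le[OF C(2)]]) measurable
qed

text \<open>Chapman-Kolmogorov holds on E with the cemetery, while the semigroup acts on functions
  on E. The two fit together because functions are extended by 0 and the cemetery is
  absorbing.\<close>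

lemma S_semigroup:
  assumes f: "f \<in> bounded_borel" and rs: "0 \<le> r" "0 \<le> s"
  shows "S (r + s) f x = S r (S s f) x"
proof -
  have [measurable]: "f \<in> borel_measurable borel" using f by measurable
  obtain C where C: "0 < C" "\<And>x. \<bar>f x\<bar> \<le> C" using f by (metis bounded_borelE)
  interpret T: prob_space "transition t z" for t z by (rule prob_space_transition)
  have "S (r + s) f x = (\<integral>z. extend_zero f z \<partial>(transition r (Some x) \<bind> transition s))"
    unfolding S_eq[OF \<open>f \<in> borel_measurable borel\<close>] chapman_kolmogorov[OF rs] ..
  also have "\<dots> = (\<integral>z. (\<integral>y. extend_zero f y \<partial>transition s z) \<partial>transition r (Some x))"
  proof (rule integral_bind[where K = cemetery_borel and B = C and B' = 1])
    show "transition s \<in> transition r (Some x) \<rightarrow>\<^sub>M subprob_algebra cemetery_borel"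
      by (rule measurable_prob_algebraD) measurable
    show "AE z in transition r (Some x). emeasure (transition s z) (space (transition s z)) \<le> ennreal 1"
      by (simp add: T.emeasure_space_1 del: space_transition)
    show "finite_measure (transition r (Some x))" by unfold_locales
  qed (use C abs_extend_zero_le[of C f] in auto)
  also have "\<dots> = (\<integral>z. extend_zero (S s f) z \<partial>transition r (Some x))"
  proof (rule Bochner_Integration.integral_cong[OF refl])
    show "(\<integral>y. extend_zero f y \<partial>transition s z) = extend_zero (S s f) z" for z
    proof (cases z)
      case None
      show ?thesis unfolding None transition_None[OF rs(2)] by (subst integral_return) auto
    qed (simp add: S_eq)
  qed
  also have "\<dots> = S r (S s f) x" by (rule S_eq[symmetric]) measurable
  finally show ?thesis .
qed

lemma S_right_continuous:
  assumes f: "continuous_on UNIV f" "\<And>x. \<bar>f x\<bar> \<le> C" and t: "0 \<le> t"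
  shows "((\<lambda>s. S s f x) \<longlongrightarrow> S t f x) (at_right t)"
  unfolding transition_semigroup_def
proof (rule dominated_convergence_at_right)
  interpret prob_space "Pr (Some x)" by (rule prob_space_Pr)
  have [measurable]: "f \<in> borel_measurable borel" using f(1) by (rule borel_measurable_continuous_onI)
  show "(\<lambda>\<omega>. extend_zero f (\<xi> (ennreal t) \<omega>)) \<in> borel_measurable (Pr (Some x))" by measurable
  show "(\<lambda>\<omega>. extend_zero f (\<xi> (ennreal s) \<omega>)) \<in> borel_measurable (Pr (Some x))" for s by measurable
  show "AE \<omega> in Pr (Some x). ((\<lambda>s. extend_zero f (\<xi> (ennreal s) \<omega>)) \<longlongrightarrow> extend_zero f (\<xi> (ennreal t) \<omega>)) (at_right t)"
    using right_continuous_extend_zero_real[OF f(1) _ t] by (auto intro: AE_I2)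
  show "AE \<omega> in Pr (Some x). \<bar>extend_zero f (\<xi> (ennreal s) \<omega>)\<bar> \<le> C" for s
    using abs_extend_zero_le[of C f] f(2) order_trans[OF abs_ge_zero f(2)] by auto
  show "integrable (Pr (Some x)) (\<lambda>_. C)" by simp
qed

text \<open>Turns the expectation of a time integral along the path, the form of the log-Laplace
  equation, into a time integral of semigroup terms. From here on paths of the Hunt process are no
  longer needed in that equation.\<close>

lemma path_integral:
  assumes F [measurable]: "(\<lambda>(s, y). F s y) \<in> borel_measurable (borel \<Otimes>\<^sub>M borel)"
    and C: "\<And>s y. s \<in> {0..t} \<Longrightarrow> \<bar>F s y\<bar> \<le> C"
  shows "(\<integral>\<omega>. (LINT s:{0..t}|lborel. extend_zero (F s) (\<xi> (ennreal s) \<omega>)) \<partial>Pr (Some x))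
    = (LINT s:{0..t}|lborel. S s (F s) x)"
  unfolding transition_semigroup_def
proof (rule set_lborel_Fubini)
  interpret prob_space "Pr (Some x)" by (rule prob_space_Pr)
  show "sigma_finite_measure (Pr (Some x))" by unfold_locales
  have "(\<lambda>p. (\<lambda>(s, z). extend_zero (F s) z) (fst p, (\<lambda>(s, \<omega>). \<xi> (ennreal s) \<omega>) p)) \<in> borel_measurable (borel \<Otimes>\<^sub>M Pr (Some x))"
    by (rule measurable_compose[OF _ measurable_extend_zero_pair[OF F]]) measurable
  then show meas: "(\<lambda>(s, \<omega>). extend_zero (F s) (\<xi> (ennreal s) \<omega>)) \<in> borel_measurable (borel \<Otimes>\<^sub>M Pr (Some x))"
    by (simp add: case_prod_beta)
  fix s assume s: "s \<in> {0..t}"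
  have C0: "0 \<le> C" using C[OF s, of x] by simp
  have bnd: "\<bar>extend_zero (F s) z\<bar> \<le> C" for z
    by (rule abs_extend_zero_le) (use C0 C[OF s] in auto)
  show int: "integrable (Pr (Some x)) (\<lambda>\<omega>. extend_zero (F s) (\<xi> (ennreal s) \<omega>))"
    using measurable_compose[OF measurable_Pair1'[of s borel] meas] bnd
    by (intro integrable_const_bound[where B = C]) auto
  have "(\<integral>\<omega>. \<bar>extend_zero (F s) (\<xi> (ennreal s) \<omega>)\<bar> \<partial>Pr (Some x)) \<le> (\<integral>\<omega>. C \<partial>Pr (Some x))"
    by (rule integral_mono) (use bnd int in auto)
  then show "(\<integral>\<omega>. \<bar>extend_zero (F s) (\<xi> (ennreal s) \<omega>)\<bar> \<partial>Pr (Some x)) \<le> C"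
    by (simp add: prob_space del: space_Pr)
qed

lemma S_set_integral:
  assumes f: "f \<in> bounded_borel" and r: "0 \<le> r" and c: "0 \<le> c"
  shows "S r (\<lambda>x. LINT s:{c..d}|lborel. S s f x) x = (LINT s:{r + c..r + d}|lborel. S s f x)"
proof -
  have [measurable]: "f \<in> borel_measurable borel" using f by measurable
  obtain C where C: "0 < C" "\<And>x. \<bar>f x\<bar> \<le> C" using f by (metis bounded_borelE)
  interpret prob_space "transition r (Some x)" by (rule prob_space_transition)
  have [measurable]: "(\<lambda>(s, z). extend_zero (S s f) z) \<in> borel_measurable (borel \<Otimes>\<^sub>M cemetery_borel)"
    by (rule measurable_extend_zero_pair) measurable
  have bnd: "\<bar>extend_zero (S s f) z\<bar> \<le> C" for s z
    by (rule abs_extend_zero_le) (use C abs_S_le[of f C] in auto)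
  have int: "integrable (transition r (Some x)) (extend_zero (S s f))" for s
    by (rule integrable_const_bound[where B = C]) (use bnd in auto)
  have ext: "extend_zero (\<lambda>x. LINT s:{c..d}|lborel. S s f x) = (\<lambda>z. LINT s:{c..d}|lborel. extend_zero (S s f) z)"
  proof
    show "extend_zero (\<lambda>x. LINT s:{c..d}|lborel. S s f x) z = (LINT s:{c..d}|lborel. extend_zero (S s f) z)" for z
      by (cases z) (auto simp: set_lebesgue_integral_def)
  qed
  have meas: "(\<lambda>x. LINT s:{c..d}|lborel. S s f x) \<in> borel_measurable borel"
    unfolding set_lebesgue_integral_def by measurable
  have "S r (\<lambda>x. LINT s:{c..d}|lborel. S s f x) x
      = (\<integral>z. (LINT s:{c..d}|lborel. extend_zero (S s f) z) \<partial>transition r (Some x))"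
    unfolding S_eq[OF meas] ext ..
  also have "\<dots> = (LINT s:{c..d}|lborel. \<integral>z. extend_zero (S s f) z \<partial>transition r (Some x))"
  proof (rule set_lborel_Fubini)
    have "(\<integral>z. \<bar>extend_zero (S s f) z\<bar> \<partial>transition r (Some x)) \<le> (\<integral>z. C \<partial>transition r (Some x))" for s
      by (rule integral_mono) (use bnd int in auto)
    then show "(\<integral>z. \<bar>extend_zero (S s f) z\<bar> \<partial>transition r (Some x)) \<le> C" for s
      using prob_space by simp
  qed (use int in \<open>auto simp: sigma_finite_measure_axioms\<close>)
  also have "\<dots> = (LINT s:{c..d}|lborel. S (r + s) f x)"
  proof (rule set_lebesgue_integral_cong)
    have "(\<integral>z. extend_zero (S s f) z \<partial>transition r (Some x)) = S (r + s) f x" if "s \<in> {c..d}" for s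
      using S_semigroup[OF f r, of s x] that c by (subst S_eq[symmetric]) auto
    then show "\<forall>s. s \<in> {c..d} \<longrightarrow> (\<integral>z. extend_zero (S s f) z \<partial>transition r (Some x)) = S (r + s) f x" by blast
  qed simp
  also have "\<dots> = (LINT s:{r + c..r + d}|lborel. S s f x)"
    by (rule set_integral_Icc_shift)
  finally show ?thesis .
qed

end

section \<open>From the weak to the pointwise eigenvalue equation\<close>

context symmetric_hunt_process
begin

declare sets_m [measurable_cong]

lemma measurable_m [simp]: "borel_measurable m = borel_measurable borel"
  by (rule measurable_cong_sets[OF sets_m refl])

lemma space_m [simp]: "space m = UNIV"
  using sets_eq_imp_space_eq[OF sets_m] by simp

lemma nn_S:
  assumes f: "f \<in> bounded_borel" "\<And>x. 0 \<le> f x"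
  shows "(\<integral>\<^sup>+\<omega>. extend_zero (\<lambda>x. ennreal (f x)) (\<xi> (ennreal t) \<omega>) \<partial>Pr (Some x)) = ennreal (S t f x)"
proof -
  have "extend_zero (\<lambda>x. ennreal (f x)) z = ennreal (extend_zero f z)" for z by (cases z) auto
  moreover have "0 \<le> extend_zero f z" for z using f(2) by (cases z) auto
  ultimately show ?thesis
    unfolding transition_semigroup_def using integrable_extend_zero[OF f(1)]
    by (simp add: nn_integral_eq_integral)
qed

lemma nn_symmetric:
  assumes f: "f \<in> bounded_borel" "\<And>x. 0 \<le> f x" and v: "v \<in> bounded_borel" "\<And>x. 0 \<le> v x"
  shows "(\<integral>\<^sup>+x. ennreal (S t f x * v x) \<partial>m) = (\<integral>\<^sup>+x. ennreal (f x * S t v x) \<partial>m)"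
proof -
  have [measurable]: "f \<in> borel_measurable borel" "v \<in> borel_measurable borel" using f v by measurable
  \<comment> \<open>For negative t both sides are taken at time 0, because \<open>ennreal\<close>
    truncates; this spares a sign hypothesis on t.\<close>
  have "ennreal (max 0 t) = ennreal t" by (simp add: max_def ennreal_neg)
  with symmetric[of "max 0 t" "\<lambda>x. ennreal (f x)" "\<lambda>x. ennreal (v x)"]
  have "(\<integral>\<^sup>+x. ennreal (S t f x) * ennreal (v x) \<partial>m) = (\<integral>\<^sup>+x. ennreal (f x) * ennreal (S t v x) \<partial>m)"
    by (simp add: nn_S f v)
  then show ?thesis by (simp add: ennreal_mult f v S_nonneg)
qed

text \<open>Symmetry moves the semigroup from v to the constant 1, where
  \<open>S t 1 \<le> 1\<close>. Thus the L1 contraction is the dual of the sub-Markov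
  property.\<close>

lemma
  assumes v: "v \<in> bounded_borel" "\<And>x. 0 \<le> v x" "integrable m v"
  shows integrable_S: "integrable m (S t v)" and integral_S_le: "(\<integral>x. S t v x \<partial>m) \<le> (\<integral>x. v x \<partial>m)"
proof -
  have [measurable]: "v \<in> borel_measurable borel" using v by measurable
  have one: "(\<lambda>_ :: 'a. 1 :: real) \<in> bounded_borel" by (rule bounded_borelI[where C = 1]) auto
  have "(\<integral>\<^sup>+x. ennreal (S t v x) \<partial>m) = (\<integral>\<^sup>+x. ennreal (S t (\<lambda>_. 1) x * v x) \<partial>m)"
    using nn_symmetric[OF one _ v(1,2), of t] by simp
  also have "\<dots> \<le> (\<integral>\<^sup>+x. ennreal (v x) \<partial>m)"
  proof (rule nn_integral_mono, rule ennreal_leI)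
    show "S t (\<lambda>_. 1) x * v x \<le> v x" for x
      using abs_S_le[of "\<lambda>_. 1" 1 t x] v(2)[of x] by (simp add: mult_left_le_one_le S_nonneg)
  qed
  also have "\<dots> = ennreal (\<integral>x. v x \<partial>m)" using v by (intro nn_integral_eq_integral) auto
  finally have *: "(\<integral>\<^sup>+x. ennreal (S t v x) \<partial>m) \<le> ennreal (\<integral>x. v x \<partial>m)" .
  then show int: "integrable m (S t v)"
    by (intro integrableI_bounded) (auto simp: S_nonneg v order_le_less_trans)
  from * show "(\<integral>x. S t v x \<partial>m) \<le> (\<integral>x. v x \<partial>m)"
    using nn_integral_eq_integral[OF int] v by (simp add: S_nonneg Bochner_Integration.integral_nonneg)
qed

lemma integrable_bounded_mult:
  assumes f: "f \<in> bounded_borel" and v: "integrable m v"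
  shows "integrable m (\<lambda>x. f x * v x)" "integrable m (\<lambda>x. v x * f x)"
proof -
  have [measurable]: "f \<in> borel_measurable borel" using f by measurable
  have [measurable]: "v \<in> borel_measurable borel" using borel_measurable_integrable[OF v] by simp
  obtain C where C: "0 < C" "\<And>x. \<bar>f x\<bar> \<le> C" using f by (metis bounded_borelE)
  show "integrable m (\<lambda>x. f x * v x)"
  proof (rule Bochner_Integration.integrable_bound)
    show "integrable m (\<lambda>x. C * v x)" using v by simp
    show "AE x in m. norm (f x * v x) \<le> norm (C * v x)"
      using C by (auto simp: abs_mult intro!: mult_right_mono)
  qed simp
  then show "integrable m (\<lambda>x. v x * f x)" by (simp add: mult.commute)
qed

text \<open>The pairing is between a bounded and an integrable function rather than within L2, as f
  need not be square integrable. Splitting f into positive and negative parts reduces it to the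
  nonnegative identity.\<close>

lemma S_symmetric:
  assumes f: "f \<in> bounded_borel"
    and v: "v \<in> bounded_borel" "\<And>x. 0 \<le> v x" "integrable m v"
  shows "(\<integral>x. S t f x * v x \<partial>m) = (\<integral>x. f x * S t v x \<partial>m)"
proof -
  have [measurable]: "v \<in> borel_measurable borel" "f \<in> borel_measurable borel" using v f by measurable
  have nonneg: "(\<integral>x. S t f x * v x \<partial>m) = (\<integral>x. f x * S t v x \<partial>m)"
    if f: "f \<in> bounded_borel" "\<And>x. 0 \<le> f x" for f
  proof -
    have [measurable]: "f \<in> borel_measurable borel" using f by measurable
    show ?thesis
      using nn_symmetric[OF f v(1,2), of t] by (simp add: integral_eq_nn_integral f v S_nonneg)
  qed
  obtain C where C: "0 < C" "\<And>x. \<bar>f x\<bar> \<le> C" using f by (metis bounded_borelE)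
  define p where "p x = max 0 (f x)" for x
  define n where "n x = max 0 (- f x)" for x
  have p: "p \<in> bounded_borel" "\<And>x. 0 \<le> p x" and n: "n \<in> bounded_borel" "\<And>x. 0 \<le> n x"
  proof -
    have "\<bar>p x\<bar> \<le> C" "\<bar>n x\<bar> \<le> C" for x using C(2)[of x] by (auto simp: p_def n_def)
    then show "p \<in> bounded_borel" "n \<in> bounded_borel"
      unfolding p_def n_def by (auto intro!: bounded_borelI[where C = C])
  qed (auto simp: p_def n_def)
  have f_eq: "f = (\<lambda>x. p x - n x)" by (auto simp: p_def n_def fun_eq_iff)
  note int = integrable_bounded_mult[OF S_bounded_borel[OF p(1)] v(3), of t]
    integrable_bounded_mult[OF S_bounded_borel[OF n(1)] v(3), of t]
    integrable_bounded_mult[OF p(1) integrable_S[OF v], of t]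
    integrable_bounded_mult[OF n(1) integrable_S[OF v], of t]
  show ?thesis
    unfolding f_eq S_diff[OF p(1) n(1)] left_diff_distrib
    using int nonneg[OF p] nonneg[OF n] by simp
qed

text \<open>By the transition density, the law of the process at a positive time does not charge
  m-null sets, whatever the starting point. At \<open>t = 0\<close> this fails, since the law is
  then a point mass.\<close>

lemma S_cong_AE:
  assumes t: "0 < t" and [measurable]: "f \<in> borel_measurable borel" "g \<in> borel_measurable borel"
    and eq: "AE x in m. f x = g x"
  shows "S t f x = S t g x"
proof -
  let ?B = "{x. f x \<noteq> g x}"
  have "?B \<in> sets borel" by measurable
  have "?B \<in> sets m" unfolding sets_m by measurable
  then have null: "?B \<in> null_sets m" using eq AE_iff_null_sets[of ?B m] by simp
  have "emeasure (Pr (Some x)) {\<omega> \<in> \<Omega>. \<xi> (ennreal t) \<omega> \<in> Some ` ?B} = (\<integral>\<^sup>+y\<in>?B. p t x y \<partial>m)"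
    by (rule transition_density[OF t]) measurable
  also have "\<dots> = (\<integral>\<^sup>+y. 0 \<partial>m)"
    using null[THEN AE_not_in] by (intro nn_integral_cong_AE) (auto elim!: AE_mp)
  finally have "emeasure (Pr (Some x)) {\<omega> \<in> \<Omega>. \<xi> (ennreal t) \<omega> \<in> Some ` ?B} = 0" by simp
  moreover have "{\<omega> \<in> space (Pr (Some x)). \<xi> (ennreal t) \<omega> \<in> Some ` ?B} \<in> sets (Pr (Some x))"
    by measurable
  ultimately have "{\<omega> \<in> \<Omega>. \<xi> (ennreal t) \<omega> \<in> Some ` ?B} \<in> null_sets (Pr (Some x))"
    by (simp add: null_setsI)
  then have "AE \<omega> in Pr (Some x). \<omega> \<notin> {\<omega> \<in> \<Omega>. \<xi> (ennreal t) \<omega> \<in> Some ` ?B}" by (rule AE_not_in)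
  then have "AE \<omega> in Pr (Some x). extend_zero f (\<xi> (ennreal t) \<omega>) = extend_zero g (\<xi> (ennreal t) \<omega>)"
    using AE_space
  proof eventually_elim
    case (elim \<omega>)
    then show ?case by (cases "\<xi> (ennreal t) \<omega>") auto
  qed
  then show ?thesis unfolding transition_semigroup_def by (intro integral_cong_AE) measurable
qed

section \<open>Occupation functions as test functions\<close>

context
  fixes v :: "'a \<Rightarrow> real"
  assumes v: "v \<in> bounded_borel" "\<And>x. 0 \<le> v x" "integrable m v"
begin

lemma measurable_v [measurable]: "v \<in> borel_measurable borel"
  using v by measurable

text \<open>For bounded f, symmetry also allows the semigroup to act on f instead of v. The form
  chosen here interchanges with time integrals of \<open>S s v\<close>; the other one serves for
  limits in s.\<close>

definition pairing :: "('a \<Rightarrow> real) \<Rightarrow> real \<Rightarrow> real" where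
  "pairing f s = (\<integral>x. f x * S s v x \<partial>m)"

lemma measurable_pairing:
  assumes [measurable]: "f \<in> borel_measurable borel"
  shows "pairing f \<in> borel_measurable borel"
proof -
  interpret sigma_finite_measure m by (rule sigma_finite_m)
  show ?thesis unfolding pairing_def[abs_def] by measurable
qed

lemma integrable_pairing: "f \<in> bounded_borel \<Longrightarrow> integrable m (\<lambda>x. f x * S s v x)"
  by (rule integrable_bounded_mult[OF _ integrable_S[OF v]])

lemma abs_pairing_integrand_le:
  assumes f: "f \<in> bounded_borel" and C: "\<And>x. \<bar>f x\<bar> \<le> C"
  shows "(\<integral>x. \<bar>f x * S s v x\<bar> \<partial>m) \<le> C * (\<integral>x. v x \<partial>m)"
proof -
  have "(\<integral>x. \<bar>f x * S s v x\<bar> \<partial>m) \<le> (\<integral>x. C * S s v x \<partial>m)"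
  proof (rule integral_mono)
    show "\<bar>f x * S s v x\<bar> \<le> C * S s v x" for x
      using C by (auto simp: abs_mult S_nonneg v intro!: mult_right_mono)
    show "integrable m (\<lambda>x. C * S s v x)" using integrable_S[OF v] by simp
    show "integrable m (\<lambda>x. \<bar>f x * S s v x\<bar>)" using integrable_pairing[OF f] by (rule integrable_abs)
  qed
  also have "\<dots> \<le> C * (\<integral>x. v x \<partial>m)"
    using integral_S_le[OF v] order_trans[OF abs_ge_zero C] by (simp add: mult_left_mono)
  finally show ?thesis .
qed

lemma abs_pairing_le:
  assumes "f \<in> bounded_borel" "\<And>x. \<bar>f x\<bar> \<le> C"
  shows "\<bar>pairing f s\<bar> \<le> C * (\<integral>x. v x \<partial>m)"
  using order_trans[OF integral_abs_bound abs_pairing_integrand_le[OF assms]] by (simp add: pairing_def)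

lemma
  assumes f: "f \<in> bounded_borel"
  shows integral_mult_time_integral:
      "(\<integral>x. f x * (LINT s:{c..d}|lborel. S s v x) \<partial>m) = (LINT s:{c..d}|lborel. pairing f s)"
    and integrable_mult_time_integral: "integrable m (\<lambda>x. f x * (LINT s:{c..d}|lborel. S s v x))"
proof -
  have [measurable]: "f \<in> borel_measurable borel" using f by measurable
  obtain C where C: "0 < C" "\<And>x. \<bar>f x\<bar> \<le> C" using f by (metis bounded_borelE)
  have "(\<lambda>(s, x). f x * S s v x) \<in> borel_measurable (borel \<Otimes>\<^sub>M m)" by measurable
  note * = sigma_finite_m this integrable_pairing[OF f] abs_pairing_integrand_le[OF f C(2)]
  show "(\<integral>x. f x * (LINT s:{c..d}|lborel. S s v x) \<partial>m) = (LINT s:{c..d}|lborel. pairing f s)"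
    unfolding set_integral_mult_right[symmetric] pairing_def by (rule set_lborel_Fubini[OF *])
  show "integrable m (\<lambda>x. f x * (LINT s:{c..d}|lborel. S s v x))"
    unfolding set_integral_mult_right[symmetric] by (rule set_lborel_Fubini_integrable[OF *])
qed

text \<open>With L the generator, formally \<open>- L w = v - S_t v\<close> for
  \<open>w = occupation t\<close>. Testing an equation for \<open>- L f\<close> with w therefore
  reads off \<open>f - S_t f\<close> against v.\<close>

definition occupation :: "real \<Rightarrow> 'a \<Rightarrow> real" where
  "occupation t x = (LINT s:{0..t}|lborel. S s v x)"

lemma occupation_nonneg: "0 \<le> occupation t x"
  unfolding occupation_def set_lebesgue_integral_def
  by (intro Bochner_Integration.integral_nonneg) (auto simp: S_nonneg v split: split_indicator)

lemma occupation_bounded_borel: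
  assumes "0 \<le> t" shows "occupation t \<in> bounded_borel"
proof -
  obtain C where C: "0 < C" "\<And>x. \<bar>v x\<bar> \<le> C" using v(1) by (metis bounded_borelE)
  show ?thesis
  proof (rule bounded_borelI)
    show "occupation t \<in> borel_measurable borel"
      unfolding occupation_def[abs_def] set_lebesgue_integral_def by measurable
    show "\<bar>occupation t x\<bar> \<le> C * (t - 0)" for x
      unfolding occupation_def by (rule abs_set_integral_Icc_le) (use assms abs_S_le[OF C(2)] in auto)
  qed
qed

lemma integrable_occupation: "integrable m (occupation t)"
proof -
  have "(\<lambda>_ :: 'a. 1 :: real) \<in> bounded_borel" by (rule bounded_borelI[where C = 1]) auto
  from integrable_mult_time_integral[OF this, of 0 t] show ?thesis by (simp add: occupation_def[abs_def])
qed

text \<open>\<open>S_r\<close> shifts the window of integration from [0,t] to [r,t+r]. Completing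
  both to [0,t+r] leaves two end pieces, and r and t need not be compared.\<close>

lemma occupation_minus_S:
  assumes t: "0 \<le> t" and r: "0 \<le> r"
  shows "occupation t x - S r (occupation t) x
    = (LINT s:{0..r}|lborel. S s v x) - (LINT s:{t..t + r}|lborel. S s v x)"
proof -
  obtain C where C: "0 < C" "\<And>x. \<bar>v x\<bar> \<le> C" using v(1) by (metis bounded_borelE)
  have meas: "(\<lambda>s. S s v x) \<in> borel_measurable borel" by measurable
  have "S r (occupation t) x = (LINT s:{r..t + r}|lborel. S s v x)"
    unfolding occupation_def[abs_def] using S_set_integral[OF v(1) r, of 0 t x] by (simp add: add.commute)
  moreover have "(LINT s:{0..t + r}|lborel. S s v x) = (LINT s:{0..t}|lborel. S s v x) + (LINT s:{t..t + r}|lborel. S s v x)"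
    by (rule set_integral_Icc_combine[OF meas abs_S_le[OF C(2)]]) (use t r in auto)
  moreover have "(LINT s:{0..t + r}|lborel. S s v x) = (LINT s:{0..r}|lborel. S s v x) + (LINT s:{r..t + r}|lborel. S s v x)"
    by (rule set_integral_Icc_combine[OF meas abs_S_le[OF C(2)]]) (use t r in auto)
  ultimately show ?thesis by (simp add: occupation_def)
qed

text \<open>After division by r, the end pieces of \<open>occupation_minus_S\<close> become averages
  of \<open>pairing f\<close> over shrinking intervals to the right of 0 and of t.\<close>

lemma occupation_generator:
  assumes f: "f \<in> bounded_borel" and t: "0 \<le> t"
    and right: "\<And>u. 0 \<le> u \<Longrightarrow> (pairing f \<longlongrightarrow> pairing f u) (at_right u)"
  shows "((\<lambda>r. (\<integral>x. f x * (occupation t x - S r (occupation t) x) \<partial>m) / r)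
    \<longlongrightarrow> pairing f 0 - pairing f t) (at_right 0)"
proof -
  have [measurable]: "f \<in> borel_measurable borel" using f by measurable
  obtain C where C: "0 < C" "\<And>x. \<bar>f x\<bar> \<le> C" using f by (metis bounded_borelE)
  have avg: "((\<lambda>r. (LINT s:{u..u + r}|lborel. pairing f s) / r) \<longlongrightarrow> pairing f u) (at_right 0)" if "0 \<le> u" for u
    by (rule right_continuous_average[OF measurable_pairing abs_pairing_le[OF f C(2)] right[OF that]]) measurable
  have "(\<integral>x. f x * (occupation t x - S r (occupation t) x) \<partial>m) / r
     = (LINT s:{0..0 + r}|lborel. pairing f s) / r - (LINT s:{t..t + r}|lborel. pairing f s) / r" if "0 < r" for r
    using that by (simp add: occupation_minus_S t right_diff_distrib integrable_mult_time_integral[OF f]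
        integral_mult_time_integral[OF f] diff_divide_distrib)
  then have "\<forall>\<^sub>F r in at_right 0. (LINT s:{0..0 + r}|lborel. pairing f s) / r - (LINT s:{t..t + r}|lborel. pairing f s) / r
    = (\<integral>x. f x * (occupation t x - S r (occupation t) x) \<partial>m) / r"
    by (auto simp: eventually_at_filter intro!: always_eventually)
  with tendsto_diff[OF avg[of 0] avg[OF t]] show ?thesis by (auto elim: Lim_transform_eventually)
qed

text \<open>Symmetry puts the time dependence on \<open>S s f\<close>, where the limit is pointwise,
  and a multiple of v dominates.\<close>

lemma pairing_right_continuous:
  assumes f: "f \<in> bounded_borel" and u: "0 \<le> u"
    and lim: "\<And>x. ((\<lambda>s. S s f x) \<longlongrightarrow> S u f x) (at_right u)"
  shows "(pairing f \<longlongrightarrow> pairing f u) (at_right u)"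
proof -
  have [measurable]: "f \<in> borel_measurable borel" using f by measurable
  obtain C where C: "0 < C" "\<And>x. \<bar>f x\<bar> \<le> C" using f by (metis bounded_borelE)
  have "((\<lambda>s. \<integral>x. S s f x * v x \<partial>m) \<longlongrightarrow> (\<integral>x. S u f x * v x \<partial>m)) (at_right u)"
  proof (rule dominated_convergence_at_right)
    show "AE x in m. ((\<lambda>s. S s f x * v x) \<longlongrightarrow> S u f x * v x) (at_right u)"
      using lim by (auto intro!: AE_I2 tendsto_intros)
    show "AE x in m. \<bar>S s f x * v x\<bar> \<le> C * v x" for s
      using abs_S_le[OF C(2)] v(2) by (auto simp: abs_mult intro!: mult_right_mono)
    show "integrable m (\<lambda>x. C * v x)" using v by simp
  qed simp_all
  then show ?thesis by (simp add: pairing_def[abs_def] S_symmetric[OF f v])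
qed

text \<open>The function \<open>occupation t\<close> need not be continuous in space, so right
  continuity of paths says nothing here. Instead, the two end pieces of length \<open>s - u\<close>
  give a Lipschitz bound in time with constant \<open>2 * C\<close>, where C bounds v.\<close>

lemma occupation_right_continuous:
  assumes t: "0 \<le> t" and u: "0 \<le> u"
  shows "((\<lambda>s. S s (occupation t) x) \<longlongrightarrow> S u (occupation t) x) (at_right u)"
proof -
  obtain C where C: "0 < C" "\<And>x. \<bar>v x\<bar> \<le> C" using v(1) by (metis bounded_borelE)
  have bnd: "\<bar>S s (occupation t) x - S u (occupation t) x\<bar> \<le> 2 * C * (s - u)" if "u \<le> s" for s
  proof -
    have "S s (occupation t) x = S u (S (s - u) (occupation t)) x"
      using S_semigroup[OF occupation_bounded_borel[OF t] u, of "s - u"] that by simp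
    then have "S u (occupation t) x - S s (occupation t) x
       = S u (\<lambda>x. occupation t x - S (s - u) (occupation t) x) x"
      by (simp add: S_diff occupation_bounded_borel t S_bounded_borel)
    also have "\<bar>\<dots>\<bar> \<le> 2 * C * (s - u)"
    proof (rule abs_S_le)
      fix x
      have "\<bar>LINT q:{0..s - u}|lborel. S q v x\<bar> \<le> C * (s - u - 0)"
        by (rule abs_set_integral_Icc_le) (use that abs_S_le[OF C(2)] in auto)
      moreover have "\<bar>LINT q:{t..t + (s - u)}|lborel. S q v x\<bar> \<le> C * (t + (s - u) - t)"
        by (rule abs_set_integral_Icc_le) (use that abs_S_le[OF C(2)] in auto)
      ultimately show "\<bar>occupation t x - S (s - u) (occupation t) x\<bar> \<le> 2 * C * (s - u)"
        using that by (simp add: occupation_minus_S t)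
    qed
    finally show ?thesis by (simp add: abs_minus_commute)
  qed
  have "((\<lambda>s. 2 * C * (s - u)) \<longlongrightarrow> 2 * C * (u - u)) (at_right u)" by (intro tendsto_intros)
  then have "((\<lambda>s. 2 * C * (s - u)) \<longlongrightarrow> 0) (at_right u)" by simp
  moreover have "\<forall>\<^sub>F s in at_right u. norm (S s (occupation t) x - S u (occupation t) x) \<le> 2 * C * (s - u)"
    using bnd by (auto simp: eventually_at_filter intro!: always_eventually)
  ultimately show ?thesis
    by (subst LIM_zero_iff[symmetric]) (rule Lim_null_comparison)
qed

text \<open>Membership requires convergence of the approximating forms on the diagonal, which is the
  generator limit with f taken to be the occupation function itself.\<close>

lemma occupation_in_domain:
  assumes t: "0 \<le> t"
  shows "occupation t \<in> dirichlet_domain m S"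
proof -
  let ?w = "occupation t"
  note w = occupation_bounded_borel[OF t]
  have [measurable]: "?w \<in> borel_measurable borel" using w by measurable
  have "integrable m (\<lambda>x. (?w x)\<^sup>2)"
    using integrable_bounded_mult(1)[OF w integrable_occupation] by (simp add: power2_eq_square)
  moreover have "((\<lambda>r. approximating_form m S r ?w ?w) \<longlongrightarrow> pairing ?w 0 - pairing ?w t) (at_right 0)"
  proof -
    have "(pairing ?w \<longlongrightarrow> pairing ?w u) (at_right u)" if "0 \<le> u" for u
      by (rule pairing_right_continuous[OF w that occupation_right_continuous[OF t that]])
    from occupation_generator[OF w t this] show ?thesis
      by (simp add: approximating_form_def[abs_def] L2_inner_def mult.commute)
  qed
  ultimately show ?thesis by (auto simp: dirichlet_domain_def L2_functions_def)
qed

text \<open>By symmetry \<open>S\<close> moves to the occupation function \<open>w\<close>, where \<open>w - S\<^sub>r w\<close> telescopes; this avoids any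
  strong continuity of the semigroup on \<open>L\<^sup>2\<close>.\<close>

lemma dirichlet_form_occupation:
  assumes f: "continuous_on UNIV f" "f \<in> bounded_borel" and t: "0 \<le> t"
  shows "dirichlet_form m S f (occupation t) = (\<integral>x. f x * v x \<partial>m) - (\<integral>x. S t f x * v x \<partial>m)"
proof -
  let ?w = "occupation t"
  note w = occupation_bounded_borel[OF t] occupation_nonneg integrable_occupation
  obtain C where C: "0 < C" "\<And>x. \<bar>f x\<bar> \<le> C" using f by (metis bounded_borelE)
  have "(pairing f \<longlongrightarrow> pairing f u) (at_right u)" if "0 \<le> u" for u
    by (rule pairing_right_continuous[OF f(2) that S_right_continuous[OF f(1) C(2) that]])
  note occupation_generator[OF f(2) t this]
  moreover have "(\<integral>x. f x * (?w x - S r ?w x) \<partial>m) / r = approximating_form m S r f ?w" for r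
    unfolding approximating_form_def L2_inner_def left_diff_distrib right_diff_distrib
    using integrable_bounded_mult[OF f(2) w(3)] integrable_bounded_mult[OF S_bounded_borel[OF f(2)] w(3), of r]
      integrable_bounded_mult[OF f(2) integrable_S[OF w], of r] S_symmetric[OF f(2) w, of r] by simp
  ultimately have "((\<lambda>r. approximating_form m S r f ?w) \<longlongrightarrow> pairing f 0 - pairing f t) (at_right 0)" by simp
  then have "dirichlet_form m S f ?w = pairing f 0 - pairing f t"
    unfolding dirichlet_form_def by (intro tendsto_Lim) auto
  then show ?thesis
    unfolding pairing_def by (simp add: S_symmetric[OF f(2) v] S_0)
qed

end

text \<open>Applying \<open>S_r\<close> with r > 0 to the almost everywhere identity removes the
  exceptional set, and then r decreases to 0. Continuity of f lets \<open>S_r f\<close> return to f,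
  and boundedness of g makes the shifted time integral converge.\<close>

lemma mild_equation:
  assumes f: "continuous_on UNIV f" "f \<in> bounded_borel" and g: "g \<in> bounded_borel"
    and weak: "\<And>w. w \<in> dirichlet_domain m S \<Longrightarrow> w \<in> bounded_borel \<Longrightarrow> (\<And>x. 0 \<le> w x) \<Longrightarrow> integrable m w \<Longrightarrow>
      dirichlet_form m S f w = (\<integral>x. g x * w x \<partial>m)"
    and t: "0 \<le> t"
  shows "f x - S t f x = (LINT s:{0..t}|lborel. S s g x)"
proof -
  have [measurable]: "f \<in> borel_measurable borel" "g \<in> borel_measurable borel" using f g by measurable
  obtain C where C: "0 < C" "\<And>x. \<bar>f x\<bar> \<le> C" using f by (metis bounded_borelE)
  obtain D where D: "0 < D" "\<And>x. \<bar>g x\<bar> \<le> D" using g by (metis bounded_borelE)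
  let ?U = "\<lambda>x. LINT s:{0..t}|lborel. S s g x"
  define k where "k x = f x - S t f x - ?U x" for x
  have U: "?U \<in> bounded_borel"
  proof (rule bounded_borelI)
    show "?U \<in> borel_measurable borel" unfolding set_lebesgue_integral_def by measurable
    show "\<bar>?U x\<bar> \<le> D * (t - 0)" for x
      by (rule abs_set_integral_Icc_le) (use t abs_S_le[OF D(2)] in auto)
  qed
  have [measurable]: "?U \<in> borel_measurable borel" using U by measurable
  have k_meas [measurable]: "k \<in> borel_measurable borel" unfolding k_def[abs_def] by measurable
  have orth: "(\<integral>x. k x * v x \<partial>m) = 0" if v: "v \<in> bounded_borel" "\<And>x. 0 \<le> v x" "integrable m v" for v
  proof -
    have "(\<integral>x. f x * v x \<partial>m) - (\<integral>x. S t f x * v x \<partial>m) = (\<integral>x. g x * occupation v t x \<partial>m)"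
      using weak[OF occupation_in_domain[OF v t] occupation_bounded_borel[OF v t] occupation_nonneg[OF v] integrable_occupation[OF v]]
        dirichlet_form_occupation[OF v f t] by simp
    also have "\<dots> = (LINT s:{0..t}|lborel. pairing v g s)"
      unfolding occupation_def[OF v] by (rule integral_mult_time_integral[OF v g])
    also have "\<dots> = (LINT s:{0..t}|lborel. \<integral>x. S s g x * v x \<partial>m)"
      by (simp add: pairing_def[OF v] S_symmetric[OF g v])
    also have "\<dots> = (\<integral>x. (LINT s:{0..t}|lborel. S s g x * v x) \<partial>m)"
    proof (rule set_lborel_Fubini[symmetric, OF sigma_finite_m])
      have [measurable]: "v \<in> borel_measurable borel" using v by measurable
      show "(\<lambda>(s, x). S s g x * v x) \<in> borel_measurable (borel \<Otimes>\<^sub>M m)" by measurable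
      fix s
      show *: "integrable m (\<lambda>x. S s g x * v x)"
        by (rule integrable_bounded_mult[OF S_bounded_borel[OF g] v(3)])
      show "(\<integral>x. \<bar>S s g x * v x\<bar> \<partial>m) \<le> (\<integral>x. D * v x \<partial>m)"
      proof (rule integral_mono)
        show "integrable m (\<lambda>x. \<bar>S s g x * v x\<bar>)" using * by (rule integrable_abs)
        show "integrable m (\<lambda>x. D * v x)" using v by simp
        show "\<bar>S s g x * v x\<bar> \<le> D * v x" for x
          using abs_S_le[of g D s x, OF D(2)] v(2)[of x] by (simp add: abs_mult mult_right_mono)
      qed
    qed
    also have "\<dots> = (\<integral>x. ?U x * v x \<partial>m)" by simp
    finally show ?thesis
      using integrable_bounded_mult(1)[OF f(2) v(3)] integrable_bounded_mult(1)[OF S_bounded_borel[OF f(2)] v(3), of t]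
        integrable_bounded_mult(1)[OF U v(3)]
      by (simp add: k_def left_diff_distrib)
  qed
  \<comment> \<open>m may be infinite, so the indicator of a set need not be integrable.
    Sigma-finiteness provides a strictly positive integrable weight, cut off at 1 to be bounded as
    well.\<close>
  interpret m: sigma_finite_measure m by (rule sigma_finite_m)
  obtain q where q [measurable]: "q \<in> borel_measurable m" and q_fin: "integral\<^sup>N m q \<noteq> \<infinity>"
    and q_pos: "\<And>x. 0 < q x" "\<And>x. q x < \<infinity>"
    using m.Ex_finite_integrable_function by auto
  define Q where "Q x = min 1 (enn2real (q x))" for x
  have [measurable]: "q \<in> borel_measurable borel" using q by simp
  have Q_meas [measurable]: "Q \<in> borel_measurable borel" unfolding Q_def[abs_def] by measurable
  have Q_pos: "0 < Q x" for x using q_pos[of x] by (auto simp: Q_def enn2real_positive_iff)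
  have Q_bounded: "Q \<in> bounded_borel"
    by (rule bounded_borelI[where C = 1]) (use Q_pos less_imp_le in \<open>auto simp: abs_of_pos\<close>, simp add: Q_def)
  have Q_int: "integrable m Q"
  proof (rule integrableI_bounded)
    have "ennreal (norm (Q x)) \<le> q x" for x
    proof -
      have "ennreal (norm (Q x)) \<le> ennreal (enn2real (q x))"
        using Q_pos[of x] by (intro ennreal_leI) (simp add: Q_def)
      also have "\<dots> = q x" using q_pos[of x] by simp
      finally show ?thesis .
    qed
    then have "(\<integral>\<^sup>+x. ennreal (norm (Q x)) \<partial>m) \<le> integral\<^sup>N m q" by (intro nn_integral_mono) auto
    then show "(\<integral>\<^sup>+x. ennreal (norm (Q x)) \<partial>m) < \<infinity>" using q_fin by (simp add: less_top[symmetric] top_unique) (metis top_unique)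
  qed simp
  \<comment> \<open>The values \<open>c = 1\<close> and \<open>c = -1\<close> exclude positive and
    negative values of k in turn; the test function is the weight Q on the set to be
    excluded.\<close>
  have one_sided: "AE x in m. \<not> 0 < c * k x" if "\<bar>c\<bar> = 1" for c
  proof -
    let ?v = "\<lambda>x. indicator {x. 0 < c * k x} x * Q x"
    have v: "?v \<in> bounded_borel" "\<And>x. 0 \<le> ?v x" "integrable m ?v"
    proof -
      show "?v \<in> bounded_borel"
        by (rule bounded_borelI[where C = 1]) (use Q_pos in \<open>auto simp: Q_def indicator_def\<close>)
      show "0 \<le> ?v x" for x using Q_pos[of x] by simp
      have "{x. 0 < c * k x} \<in> sets m" unfolding sets_m by measurable
      with integrable_mult_indicator[OF this Q_int] show "integrable m ?v" by simp
    qed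
    have kb: "k \<in> bounded_borel"
    proof -
      obtain B where B: "0 < B" "\<And>x. \<bar>?U x\<bar> \<le> B" using U by (metis bounded_borelE)
      have "\<bar>k x\<bar> \<le> C + C + B" for x
        unfolding k_def using C(2)[of x] abs_S_le[of f C t x, OF C(2)] B(2)[of x] by linarith
      then show ?thesis by (rule bounded_borelI[OF k_meas])
    qed
    have "(\<integral>x. c * k x * ?v x \<partial>m) = c * (\<integral>x. k x * ?v x \<partial>m)" by (simp add: mult.assoc)
    also have "\<dots> = 0" using orth[OF v] by simp
    finally have "(\<integral>x. c * k x * ?v x \<partial>m) = 0" .
    moreover have "integrable m (\<lambda>x. c * k x * ?v x)"
      using integrable_bounded_mult(1)[OF kb v(3)] by (simp add: mult.assoc)
    moreover have "AE x in m. 0 \<le> c * k x * ?v x"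
      using mult_pos_pos[OF _ Q_pos] by (intro AE_I2) (auto split: split_indicator intro: less_imp_le)
    ultimately have "AE x in m. c * k x * ?v x = 0"
      by (simp add: integral_nonneg_eq_0_iff_AE)
    then show ?thesis
    proof eventually_elim
      case (elim x)
      then show ?case using Q_pos[of x] by (auto simp: indicator_def)
    qed
  qed
  have ae: "AE x in m. f x - S t f x = ?U x"
    using one_sided[of 1, simplified] one_sided[of "-1", simplified] by eventually_elim (simp add: k_def)
  \<comment> \<open>At a positive time r null sets are invisible, so \<open>ae\<close> becomes an
    identity at every single x.\<close>
  have "S r f x - S (r + t) f x = (LINT s:{r..r + t}|lborel. S s g x)" if r: "0 < r" for r
  proof -
    have "S r f x - S (r + t) f x = S r (\<lambda>x. f x - S t f x) x"
      using S_diff[OF f(2) S_bounded_borel[OF f(2)]] S_semigroup[OF f(2), of r t] r t by simp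
    also have "\<dots> = S r ?U x"
      by (rule S_cong_AE[OF r _ _ ae]) measurable
    also have "\<dots> = (LINT s:{r..r + t}|lborel. S s g x)"
      using S_set_integral[OF g, of r 0 t x] r by simp
    finally show ?thesis .
  qed
  note eq = this
  have S_meas: "(\<lambda>s. S s g x) \<in> borel_measurable borel" by measurable
  have diff: "(LINT s:{r..r + t}|lborel. S s g x)
     = ?U x + ((LINT s:{t..t + r}|lborel. S s g x) - (LINT s:{0..r}|lborel. S s g x))" if "0 < r" for r
    using set_integral_Icc_combine[OF S_meas abs_S_le[OF D(2)], of 0 t "t + r"]
      set_integral_Icc_combine[OF S_meas abs_S_le[OF D(2)], of 0 r "t + r"] that t by (simp add: add.commute)
  have small: "((\<lambda>r. LINT s:{u..u + r}|lborel. S s g x) \<longlongrightarrow> 0) (at_right 0)" for u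
  proof (rule Lim_null_comparison)
    show "\<forall>\<^sub>F r in at_right 0. norm (LINT s:{u..u + r}|lborel. S s g x) \<le> D * r"
      unfolding eventually_at_filter
      using abs_set_integral_Icc_le[of u "u + _" "\<lambda>s. S s g x" D] abs_S_le[OF D(2)]
      by (auto intro!: always_eventually)
    have "((\<lambda>r. D * r) \<longlongrightarrow> D * 0) (at_right 0)" by (intro tendsto_intros)
    then show "((\<lambda>r. D * r) \<longlongrightarrow> 0) (at_right 0)" by simp
  qed
  \<comment> \<open>The windows [r,r+t] and [0,t] differ by two end pieces of length r, which vanish
    in the limit.\<close>
  have "((\<lambda>r. ?U x + ((LINT s:{t..t + r}|lborel. S s g x) - (LINT s:{0..0 + r}|lborel. S s g x)))
      \<longlongrightarrow> ?U x + (0 - 0)) (at_right 0)"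
    by (intro tendsto_intros small)
  moreover have "\<forall>\<^sub>F r in at_right 0. ?U x + ((LINT s:{t..t + r}|lborel. S s g x) - (LINT s:{0..0 + r}|lborel. S s g x))
      = S r f x - S (r + t) f x"
    using eq diff by (auto simp: eventually_at_filter intro!: always_eventually)
  ultimately have "((\<lambda>r. S r f x - S (r + t) f x) \<longlongrightarrow> ?U x) (at_right 0)"
    by (auto elim: Lim_transform_eventually)
  moreover have "((\<lambda>r. S r f x - S (r + t) f x) \<longlongrightarrow> S 0 f x - S t f x) (at_right 0)"
  proof (rule tendsto_diff)
    show "((\<lambda>r. S r f x) \<longlongrightarrow> S 0 f x) (at_right 0)"
      by (rule S_right_continuous[OF f(1) C(2)]) simp
    have "filterlim (\<lambda>r. r + t) (at_right t) (at_right 0)"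
      by (auto simp: filterlim_at eventually_at_filter intro!: tendsto_eq_intros always_eventually)
    from filterlim_compose[OF S_right_continuous[OF f(1) C(2) t] this]
    show "((\<lambda>r. S (r + t) f x) \<longlongrightarrow> S t f x) (at_right 0)" .
  qed
  ultimately show ?thesis
    using tendsto_unique[of "at_right (0 :: real)"] by (auto simp: S_0)
qed

end

section \<open>Gronwall estimates and the branching mechanism\<close>

lemma set_integral_exp:
  fixes l :: real
  assumes "c \<le> d"
  shows "(LINT s:{c..d}|lborel. l * exp (l * s)) = exp (l * d) - exp (l * c)"
proof -
  have "(\<integral>s. (l * exp (l * s)) * indicator {c..d} s \<partial>lborel) = exp (l * d) - exp (l * c)"
    by (rule integral_FTC_Icc_real[OF assms, where F = "\<lambda>s. exp (l * s)"])
       (auto intro!: derivative_eq_intros continuous_intros)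
  then show ?thesis by (simp only: set_lebesgue_integral_def real_scaleR_def mult.commute)
qed

text \<open>\<open>F\<close> need not be differentiable, as \<open>G\<close> is only measurable; therefore Fubini instead of
  integration by parts.\<close>

lemma variation_of_constants:
  fixes G F :: "real \<Rightarrow> real"
  assumes [measurable]: "G \<in> borel_measurable borel" and bound: "\<And>s. \<bar>G s\<bar> \<le> C"
    and F: "\<And>s. 0 \<le> s \<Longrightarrow> F s = F0 - (LINT q:{0..s}|lborel. G q)" and t: "0 \<le> t"
  shows "(LINT s:{0..t}|lborel. exp (- l * (t - s)) * (l * F s - G s)) = F t - exp (- l * t) * F0"
proof -
  define E where "E s = l * exp (l * s)" for s
  have [measurable]: "E \<in> borel_measurable borel" unfolding E_def[abs_def] by measurable
  have C: "0 \<le> C" using bound[of 0] by simp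
  \<comment> \<open>The interval depends on s. Written as a conditional, its indicator is seen to be
    jointly measurable in s and q.\<close>
  have ind: "indicator {0..s} q = (if 0 \<le> q \<and> q \<le> s then 1 else 0 :: real)" for s q :: real
    by (simp add: indicator_def)
  have E_le: "\<bar>E s\<bar> \<le> \<bar>l\<bar> * exp (\<bar>l\<bar> * t)" if "s \<in> {0..t}" for s
  proof -
    have "l * s \<le> \<bar>l\<bar> * t" using that by (intro mult_mono) auto
    then show ?thesis by (auto simp: E_def abs_mult intro!: mult_left_mono)
  qed
  have int_exp: "set_integrable lborel {0..t} (\<lambda>s. c * exp (l * s))" for c
    unfolding set_integrable_def by (rule borel_integrable_compact) (auto intro!: continuous_intros)
  have int_G: "set_integrable lborel {c..d} G" for c d
    by (rule set_integrable_Icc_bounded) (use bound in auto)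
  have int_EG: "set_integrable lborel {0..t} (\<lambda>s. exp (l * s) * G s)"
  proof -
    have "\<bar>exp (l * s) * G s\<bar> \<le> exp (\<bar>l\<bar> * t) * C" if "s \<in> {0..t}" for s
    proof -
      have "l * s \<le> \<bar>l\<bar> * t" using that by (intro mult_mono) auto
      then show ?thesis using bound by (auto simp: abs_mult intro!: mult_mono)
    qed
    then show ?thesis by (intro set_integrable_Icc_bounded) auto
  qed
  \<comment> \<open>On the triangle \<open>0 \<le> q \<le> s \<le> t\<close>, fixing q leaves E
    integrated over [q,t], and E is the derivative of \<open>exp (l * s)\<close>.\<close>
  have swap: "(LINT s:{0..t}|lborel. E s * (LINT q:{0..s}|lborel. G q))
     = (LINT q:{0..t}|lborel. exp (l * t) * G q - exp (l * q) * G q)"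
  proof -
    have "(LINT s:{0..t}|lborel. E s * (LINT q:{0..s}|lborel. G q))
      = (LINT s:{0..t}|lborel. \<integral>q. E s * (indicator {0..s} q * G q) \<partial>lborel)"
      by (simp add: set_lebesgue_integral_def)
    also have "\<dots> = (\<integral>q. (LINT s:{0..t}|lborel. E s * (indicator {0..s} q * G q)) \<partial>lborel)"
    proof (rule set_lborel_Fubini[symmetric])
      show "sigma_finite_measure lborel" by unfold_locales
      show "(\<lambda>(s, q). E s * (indicator {0..s} q * G q)) \<in> borel_measurable (borel \<Otimes>\<^sub>M lborel)"
        unfolding ind by measurable
      fix s assume s: "s \<in> {0..t}"
      show int: "integrable lborel (\<lambda>q. E s * (indicator {0..s} q * G q))"
        using int_G[of 0 s] by (simp add: set_integrable_def)
      have "(\<integral>q. \<bar>E s * (indicator {0..s} q * G q)\<bar> \<partial>lborel) \<le> (\<integral>q. \<bar>l\<bar> * exp (\<bar>l\<bar> * t) * (indicator {0..s} q * C) \<partial>lborel)"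
        by (intro integral_mono integrable_abs int)
           (use bound C E_le[OF s] in \<open>auto simp: abs_mult split: split_indicator intro!: mult_mono\<close>)
      also have "\<dots> = \<bar>l\<bar> * exp (\<bar>l\<bar> * t) * (s * C)" using s by simp
      also have "\<dots> \<le> \<bar>l\<bar> * exp (\<bar>l\<bar> * t) * (t * C)"
        using s C by (intro mult_left_mono mult_right_mono) auto
      finally show "(\<integral>q. \<bar>E s * (indicator {0..s} q * G q)\<bar> \<partial>lborel) \<le> \<bar>l\<bar> * exp (\<bar>l\<bar> * t) * (t * C)" .
    qed
    also have "\<dots> = (\<integral>q. indicator {0..t} q *\<^sub>R (exp (l * t) * G q - exp (l * q) * G q) \<partial>lborel)"
    proof (rule Bochner_Integration.integral_cong[OF refl])
      fix q :: real
      show "(LINT s:{0..t}|lborel. E s * (indicator {0..s} q * G q))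
        = indicator {0..t} q *\<^sub>R (exp (l * t) * G q - exp (l * q) * G q)"
      proof (cases "q \<in> {0..t}")
        case True
        have "(LINT s:{0..t}|lborel. E s * (indicator {0..s} q * G q)) = (LINT s:{q..t}|lborel. E s * G q)"
          unfolding set_lebesgue_integral_def
          by (intro Bochner_Integration.integral_cong) (use True in \<open>auto split: split_indicator\<close>)
        also have "\<dots> = (exp (l * t) - exp (l * q)) * G q"
          using set_integral_exp[of q t l] True by (simp add: E_def)
        finally show ?thesis using True by (simp add: left_diff_distrib)
      next
        case False
        then have "(LINT s:{0..t}|lborel. E s * (indicator {0..s} q * G q)) = (LINT s:{0..t}|lborel. 0)"
          by (intro set_lebesgue_integral_cong) (auto split: split_indicator)
        then show ?thesis using False by simp
      qed
    qed
    finally show ?thesis by (simp add: set_lebesgue_integral_def)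
  qed
  have int_EI: "set_integrable lborel {0..t} (\<lambda>s. E s * (LINT q:{0..s}|lborel. G q))"
  proof -
    have [measurable]: "(\<lambda>s. LINT q:{0..s}|lborel. G q) \<in> borel_measurable borel"
      unfolding set_lebesgue_integral_def ind by measurable
    have "\<bar>E s * (LINT q:{0..s}|lborel. G q)\<bar> \<le> \<bar>l\<bar> * exp (\<bar>l\<bar> * t) * (C * t)" if s: "s \<in> {0..t}" for s
    proof -
      have "\<bar>LINT q:{0..s}|lborel. G q\<bar> \<le> C * t"
        using abs_set_integral_Icc_le[of 0 s G C] bound s C mult_left_mono[of s t C] by force
      with E_le[OF s] show ?thesis unfolding abs_mult by (intro mult_mono) auto
    qed
    then show ?thesis by (intro set_integrable_Icc_bounded) auto
  qed
  have "(LINT s:{0..t}|lborel. exp (- l * (t - s)) * (l * F s - G s))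
    = (LINT s:{0..t}|lborel. exp (- l * t) * ((F0 * l) * exp (l * s) - (E s * (LINT q:{0..s}|lborel. G q) + exp (l * s) * G s)))"
  proof (rule set_lebesgue_integral_cong)
    have "exp (- l * (t - s)) = exp (- l * t) * exp (l * s)" for s
      by (simp add: exp_add[symmetric] algebra_simps)
    then show "\<forall>s. s \<in> {0..t} \<longrightarrow> exp (- l * (t - s)) * (l * F s - G s)
      = exp (- l * t) * ((F0 * l) * exp (l * s) - (E s * (LINT q:{0..s}|lborel. G q) + exp (l * s) * G s))"
      by (auto simp: F E_def algebra_simps)
  qed simp
  also have "\<dots> = exp (- l * t) * ((LINT s:{0..t}|lborel. (F0 * l) * exp (l * s))
     - ((LINT s:{0..t}|lborel. E s * (LINT q:{0..s}|lborel. G q)) + (LINT s:{0..t}|lborel. exp (l * s) * G s)))"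
    using int_exp int_EI int_EG by (simp only: set_integral_mult_right set_integral_diff set_integral_add)
  also have "(LINT s:{0..t}|lborel. (F0 * l) * exp (l * s)) = F0 * (exp (l * t) - 1)"
    using set_integral_exp[OF t, of l] by (simp add: mult.assoc del: set_integral_mult_right) (simp add: set_integral_mult_right)
  also have "(LINT s:{0..t}|lborel. E s * (LINT q:{0..s}|lborel. G q))
     = exp (l * t) * (LINT q:{0..t}|lborel. G q) - (LINT s:{0..t}|lborel. exp (l * s) * G s)"
    unfolding swap using int_G int_EG by (simp add: set_integral_diff)
  finally have "(LINT s:{0..t}|lborel. exp (- l * (t - s)) * (l * F s - G s))
    = exp (- l * t) * (F0 * (exp (l * t) - 1) - (exp (l * t) * (LINT q:{0..t}|lborel. G q)
      - (LINT s:{0..t}|lborel. exp (l * s) * G s) + (LINT s:{0..t}|lborel. exp (l * s) * G s)))" .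
  moreover have "exp (- l * t) * exp (l * t) = 1" by (simp add: exp_add[symmetric])
  moreover have "A * (F0 * (E - 1) - (E * I - J + J)) = (F0 - I) - A * F0" if "A * E = 1" for A E I J :: real
    using that by algebra
  ultimately show ?thesis by (simp only: F[OF t])
qed

text \<open>The weight \<open>exp (2 K t)\<close> makes a Volterra operator of norm \<open>K\<close> a contraction with factor 1/2;
  no measurability of the supremum of \<open>D t\<close> is needed.\<close>

lemma gronwall:
  fixes D :: "real \<Rightarrow> 'z \<Rightarrow> real"
  assumes K: "0 \<le> K" and B: "0 \<le> B"
    and bound: "\<And>s y. 0 \<le> s \<Longrightarrow> s \<le> T \<Longrightarrow> D s y \<le> C"
    and step: "\<And>t x M. 0 \<le> t \<Longrightarrow> t \<le> T \<Longrightarrow> 0 \<le> M \<Longrightarrow> (\<And>s y. 0 \<le> s \<Longrightarrow> s \<le> t \<Longrightarrow> D s y \<le> M * exp (2 * K * s)) \<Longrightarrow>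
      D t x \<le> B + M * (exp (2 * K * t) / 2)"
    and t: "0 \<le> t" "t \<le> T"
  shows "D t x \<le> 2 * B * exp (2 * K * t)"
proof -
  \<comment> \<open>\<open>2 * B\<close> is the fixed point of \<open>M \<mapsto> B + M / 2\<close>;
    every application of \<open>step\<close> halves the distance to it, which starts from the a
    priori bound.\<close>
  define M where "M n = 2 * B + \<bar>C\<bar> / 2 ^ n" for n :: nat
  have "\<forall>t x. 0 \<le> t \<longrightarrow> t \<le> T \<longrightarrow> D t x \<le> M n * exp (2 * K * t)" for n
  proof (induction n)
    case 0
    show ?case
    proof (intro allI impI)
      fix t x assume t: "0 \<le> t" "t \<le> T"
      have "D t x \<le> \<bar>C\<bar> * 1" using bound[OF t, of x] by simp
      also have "\<dots> \<le> M 0 * exp (2 * K * t)" using K B t by (intro mult_mono) (auto simp: M_def)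
      finally show "D t x \<le> M 0 * exp (2 * K * t)" .
    qed
  next
    case (Suc n)
    show ?case
    proof (intro allI impI)
      fix t x assume t: "0 \<le> t" "t \<le> T"
      have "D t x \<le> B + M n * (exp (2 * K * t) / 2)"
        by (rule step[OF t]) (use Suc t B in \<open>auto simp: M_def\<close>)
      also have "B * 1 \<le> B * exp (2 * K * t)" using K B t by (intro mult_left_mono) auto
      then have "B + M n * (exp (2 * K * t) / 2) \<le> B * exp (2 * K * t) + M n * (exp (2 * K * t) / 2)" by simp
      also have "\<dots> = M (Suc n) * exp (2 * K * t)" by (simp add: M_def field_simps)
      finally show "D t x \<le> M (Suc n) * exp (2 * K * t)" .
    qed
  qed
  then have *: "D t x \<le> M n * exp (2 * K * t)" for n using t by blast
  have "(\<lambda>n. \<bar>C\<bar> * (1 / 2) ^ n) \<longlonglongrightarrow> \<bar>C\<bar> * 0" by (intro tendsto_intros LIMSEQ_realpow_zero) auto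
  then have "(\<lambda>n. M n * exp (2 * K * t)) \<longlonglongrightarrow> (2 * B + \<bar>C\<bar> * 0) * exp (2 * K * t)"
    unfolding M_def by (intro tendsto_intros) (simp add: power_divide)
  from LIMSEQ_le_const[OF this] * show ?thesis by auto
qed

text \<open>With constant 1 in place of the optimal 1/2, the quadratic bound follows from
  \<open>exp (- y) \<le> 1 / (1 + y)\<close> and
  \<open>(1 - y + y^2) (1 + y) = 1 + y^3\<close>.\<close>

lemma exp_minus_le:
  fixes y :: real
  assumes "0 \<le> y"
  shows "0 \<le> exp (- y) - 1 + y" "exp (- y) - 1 + y \<le> y" "exp (- y) - 1 + y \<le> y\<^sup>2"
proof -
  show "0 \<le> exp (- y) - 1 + y" using exp_ge_add_one_self[of "- y"] by simp
  show "exp (- y) - 1 + y \<le> y" using assms by simp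
  have "exp (- y) \<le> 1 / (1 + y)"
    using exp_ge_add_one_self[of y] assms by (simp add: exp_minus divide_simps)
  also have "\<dots> \<le> 1 - y + y\<^sup>2"
  proof -
    have "1 \<le> (1 - y + y\<^sup>2) * (1 + y)"
    proof -
      have "(1 - y + y\<^sup>2) * (1 + y) = 1 + y ^ 3" by (simp add: algebra_simps power2_eq_square power3_eq_cube)
      then show ?thesis using assms by simp
    qed
    then show ?thesis using assms by (simp add: divide_simps)
  qed
  finally show "exp (- y) - 1 + y \<le> y\<^sup>2" by simp
qed

text \<open>Divided by its bound, a bounded kernel is a sub-probability kernel, for which
  measurability of parametrised integrals has been settled above.\<close>

lemma bounded_kernel_integral_measurable:
  fixes G :: "'q \<Rightarrow> 'b \<Rightarrow> real"
  assumes \<kappa>: "bounded_kernel N \<kappa>" and N: "space N \<noteq> {}"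
    and G [measurable]: "(\<lambda>(q, \<theta>). G q \<theta>) \<in> borel_measurable (M \<Otimes>\<^sub>M N)"
    and [measurable]: "k \<in> M \<rightarrow>\<^sub>M borel"
  shows "(\<lambda>q. \<integral>\<theta>. G q \<theta> \<partial>\<kappa> (k q)) \<in> borel_measurable M"
proof -
  obtain C :: real where C: "\<And>x. emeasure (\<kappa> x) (space N) \<le> ennreal C"
    and sets [measurable_cong]: "\<And>x. sets (\<kappa> x) = sets N"
    and meas: "\<And>B. B \<in> sets N \<Longrightarrow> (\<lambda>x. emeasure (\<kappa> x) B) \<in> borel_measurable borel"
    using \<kappa> by (auto simp: bounded_kernel_def)
  \<comment> \<open>Taking \<open>max 1 C\<close> keeps the factor positive and finite, as the bound
    C may be zero or negative.\<close>
  define c where "c = 1 / max 1 C"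
  have c: "0 < c" by (simp add: c_def)
  define \<kappa>' where "\<kappa>' x = density (\<kappa> x) (\<lambda>_. ennreal c)" for x
  have [measurable]: "\<kappa>' \<in> borel \<rightarrow>\<^sub>M subprob_algebra N"
  proof (rule measurable_subprob_algebra)
    fix x
    show sets': "sets (\<kappa>' x) = sets N" by (simp add: \<kappa>'_def sets)
    have sp: "space (\<kappa> x) = space N" using sets_eq_imp_space_eq[OF sets] .
    show "subprob_space (\<kappa>' x)"
    proof (rule subprob_spaceI)
      have "emeasure (\<kappa>' x) (space N) = ennreal c * emeasure (\<kappa> x) (space N)"
        by (simp add: \<kappa>'_def emeasure_density_const sets)
      also have "\<dots> \<le> ennreal c * ennreal (max 1 C)"
        by (intro mult_left_mono order_trans[OF C] ennreal_leI) auto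
      also have "\<dots> = 1" by (simp add: ennreal_mult[symmetric] c_def)
      finally show "emeasure (\<kappa>' x) (space (\<kappa>' x)) \<le> 1" by (simp add: \<kappa>'_def sp)
      show "space (\<kappa>' x) \<noteq> {}" using N by (simp add: \<kappa>'_def sp)
    qed
  next
    fix A assume "A \<in> sets N"
    then show "(\<lambda>x. emeasure (\<kappa>' x) A) \<in> borel_measurable borel"
      using meas by (simp add: \<kappa>'_def emeasure_density_const sets)
  qed
  have "(\<lambda>q. (1 / c) * (\<integral>\<theta>. G q \<theta> \<partial>\<kappa>' (k q))) \<in> borel_measurable M"
    by (intro borel_measurable_times borel_measurable_const integral_measurable_subprob_algebra2[OF G]) measurable
  moreover have "(1 / c) * (\<integral>\<theta>. G q \<theta> \<partial>\<kappa>' (k q)) = (\<integral>\<theta>. G q \<theta> \<partial>\<kappa> (k q))" if "q \<in> space M" for q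
  proof -
    have "G q \<in> borel_measurable (\<kappa> (k q))"
      using measurable_compose[OF measurable_Pair1'[OF that] G] by (simp add: measurable_cong_sets[OF sets refl])
    then show ?thesis
      unfolding \<kappa>'_def using c by (subst integral_density) auto
  qed
  ultimately show ?thesis by (simp cong: measurable_cong)
qed

section \<open>The branching mechanism and its linearisation at zero\<close>

context branching_mechanism
begin

abbreviation (input) "\<psi> \<equiv> branching_psi a b \<Pi>L c \<pi> \<Pi>NL"

text \<open>The total mass \<gamma>(x) of \<open>gamma_kernel\<close> as a real number; the moment
  is finite by the bounded kernel condition on \<open>\<Pi>NL\<close>.\<close>

definition mean_offspring :: "'a \<Rightarrow> real" where
  "mean_offspring x = c x + (\<integral>\<theta>. \<theta> \<partial>\<Pi>NL x)"

text \<open>The derivative of \<open>\<psi> x\<close> at the zero function in direction f. The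
  quadratic term and the local jumps contribute nothing at first order.\<close>

definition linear_part :: "'a \<Rightarrow> ('a \<Rightarrow> real) \<Rightarrow> real" where
  "linear_part x f = a x * f x - mean_offspring x * (\<integral>y. f y \<partial>\<pi> x)"

declare sets_\<Pi>L [measurable_cong] sets_\<Pi>NL [measurable_cong]

lemma prob_space_\<pi>: "prob_space (\<pi> x)" and sets_\<pi> [measurable_cong]: "sets (\<pi> x) = sets borel"
  using measurable_space[OF \<pi>, of x] by (auto simp: space_prob_algebra)

lemma space_\<pi> [simp]: "space (\<pi> x) = UNIV"
  using sets_eq_imp_space_eq[OF sets_\<pi>] by simp

lemma space_\<Pi>L [simp]: "space (\<Pi>L x) = {0<..}" and space_\<Pi>NL [simp]: "space (\<Pi>NL x) = {0<..}"
  using sets_eq_imp_space_eq[OF sets_\<Pi>L] sets_eq_imp_space_eq[OF sets_\<Pi>NL] by (auto simp: space_restrict_space)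

lemma borel_measurable_restrict_\<Pi>:
  "f \<in> borel_measurable borel \<Longrightarrow> f \<in> borel_measurable (\<Pi>L x)"
  "f \<in> borel_measurable borel \<Longrightarrow> f \<in> borel_measurable (\<Pi>NL x)"
  by (simp_all add: measurable_cong_sets[OF sets_\<Pi>L refl] measurable_cong_sets[OF sets_\<Pi>NL refl] measurable_restrict_space1)

lemma kernel_moment:
  fixes w :: "real \<Rightarrow> real"
  assumes kernel: "bounded_kernel (restrict_space borel {0<..}) (\<lambda>x. density (\<kappa> x) (\<lambda>\<theta>. ennreal (w \<theta>)))"
    and sets: "\<And>x. sets (\<kappa> x) = sets (restrict_space borel {0<..})"
    and w [measurable]: "w \<in> borel_measurable borel" "\<And>\<theta>. 0 < \<theta> \<Longrightarrow> 0 \<le> w \<theta>"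
  obtains C where "0 < C" "\<And>x. integrable (\<kappa> x) w" "\<And>x. (\<integral>\<theta>. w \<theta> \<partial>\<kappa> x) \<le> C"
proof -
  have [measurable]: "w \<in> borel_measurable (\<kappa> x)" for x
    by (simp add: measurable_cong_sets[OF sets refl] measurable_restrict_space1)
  have sp: "space (\<kappa> x) = {0<..}" for x
    using sets_eq_imp_space_eq[OF sets] by (auto simp: space_restrict_space)
  obtain C :: real where "\<And>x. emeasure (density (\<kappa> x) (\<lambda>\<theta>. ennreal (w \<theta>))) {0<..} \<le> ennreal C"
    using kernel by (auto simp: bounded_kernel_def space_restrict_space)
  moreover have "emeasure (density (\<kappa> x) (\<lambda>\<theta>. ennreal (w \<theta>))) {0<..} = (\<integral>\<^sup>+\<theta>. ennreal (w \<theta>) \<partial>\<kappa> x)" for x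
    unfolding sp[of x, symmetric] by (subst emeasure_density) (auto intro!: nn_integral_cong)
  ultimately have C: "(\<integral>\<^sup>+\<theta>. ennreal (w \<theta>) \<partial>\<kappa> x) \<le> ennreal (max 1 C)" for x
    by (metis (no_types, lifting) ennreal_leI max.cobounded2 order_trans)
  have nn: "AE \<theta> in \<kappa> x. 0 \<le> w \<theta>" for x using w(2) by (intro AE_I2) (auto simp: sp)
  have int: "integrable (\<kappa> x) w" for x
    by (rule integrableI_nonneg[OF _ nn]) (use C[of x] in \<open>auto intro: order_le_less_trans\<close>)
  moreover have "(\<integral>\<theta>. w \<theta> \<partial>\<kappa> x) \<le> max 1 C" for x
    using C[of x] nn_integral_eq_integral[OF int nn, of x] by (simp add: ennreal_le_iff)
  ultimately show ?thesis using that[of "max 1 C"] by simp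
qed

lemma moment_\<Pi>L:
  obtains C where "0 < C" "\<And>x. integrable (\<Pi>L x) (\<lambda>\<theta>. min \<theta> (\<theta>\<^sup>2))" "\<And>x. (\<integral>\<theta>. min \<theta> (\<theta>\<^sup>2) \<partial>\<Pi>L x) \<le> C"
  by (rule kernel_moment[OF \<Pi>L sets_\<Pi>L]) auto

lemma moment_\<Pi>NL:
  obtains C where "0 < C" "\<And>x. integrable (\<Pi>NL x) (\<lambda>\<theta>. \<theta>)" "\<And>x. (\<integral>\<theta>. \<theta> \<partial>\<Pi>NL x) \<le> C"
  by (rule kernel_moment[OF \<Pi>NL sets_\<Pi>NL]) auto

lemma integrable_\<Pi>L_min: "integrable (\<Pi>L x) (\<lambda>\<theta>. min \<theta> (\<theta>\<^sup>2))"
  by (rule moment_\<Pi>L)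

lemma integrable_\<Pi>NL: "integrable (\<Pi>NL x) (\<lambda>\<theta>. \<theta>)"
  by (rule moment_\<Pi>NL)

text \<open>The jump measures may have infinite mass near 0, and only their weighted versions are
  bounded kernels. Integrating \<open>G / w\<close> against the weighted kernel recovers the
  integral of G, since w is positive on the half-line.\<close>

lemma weighted_kernel_integral_measurable:
  fixes G :: "'q \<Rightarrow> real \<Rightarrow> real" and w :: "real \<Rightarrow> real"
  assumes kernel: "bounded_kernel (restrict_space borel {0<..}) (\<lambda>x. density (\<kappa> x) (\<lambda>\<theta>. ennreal (w \<theta>)))"
    and sets: "\<And>x. sets (\<kappa> x) = sets (restrict_space borel {0<..})"
    and w [measurable]: "w \<in> borel_measurable borel" "\<And>\<theta>. 0 < \<theta> \<Longrightarrow> 0 < w \<theta>"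
    and G [measurable]: "(\<lambda>(q, \<theta>). G q \<theta>) \<in> borel_measurable (M \<Otimes>\<^sub>M borel)" and k: "k \<in> M \<rightarrow>\<^sub>M borel"
  shows "(\<lambda>q. \<integral>\<theta>. G q \<theta> \<partial>\<kappa> (k q)) \<in> borel_measurable M"
proof -
  have sp: "space (\<kappa> x) = {0<..}" for x
    using sets_eq_imp_space_eq[OF sets] by (auto simp: space_restrict_space)
  have restrict: "f \<in> borel_measurable (\<kappa> x)" if "f \<in> borel_measurable borel" for f :: "real \<Rightarrow> real" and x
    using that by (simp add: measurable_cong_sets[OF sets refl] measurable_restrict_space1)
  have "(\<lambda>(q, \<theta>). G q \<theta> / w \<theta>) \<in> borel_measurable (M \<Otimes>\<^sub>M borel)" by measurable
  moreover have "(\<lambda>p. (fst p, snd p)) \<in> M \<Otimes>\<^sub>M restrict_space borel {0<..} \<rightarrow>\<^sub>M M \<Otimes>\<^sub>M (borel :: real measure)"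
    by (intro measurable_Pair measurable_fst measurable_compose[OF measurable_snd measurable_restrict_space1]) auto
  ultimately have "(\<lambda>(q, \<theta>). G q \<theta> / w \<theta>) \<in> borel_measurable (M \<Otimes>\<^sub>M restrict_space borel {0<..})"
    using measurable_compose by fastforce
  from bounded_kernel_integral_measurable[OF kernel _ this k]
  have "(\<lambda>q. \<integral>\<theta>. G q \<theta> / w \<theta> \<partial>density (\<kappa> (k q)) (\<lambda>\<theta>. ennreal (w \<theta>))) \<in> borel_measurable M"
    by (simp add: space_restrict_space)
  moreover have "(\<integral>\<theta>. G q \<theta> / w \<theta> \<partial>density (\<kappa> (k q)) (\<lambda>\<theta>. ennreal (w \<theta>))) = (\<integral>\<theta>. G q \<theta> \<partial>\<kappa> (k q))"
    if "q \<in> space M" for q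
  proof -
    have [measurable]: "G q \<in> borel_measurable borel"
      using measurable_compose[OF measurable_Pair1'[OF that] G] by simp
    have "(\<integral>\<theta>. G q \<theta> / w \<theta> \<partial>density (\<kappa> (k q)) (\<lambda>\<theta>. ennreal (w \<theta>))) = (\<integral>\<theta>. w \<theta> *\<^sub>R (G q \<theta> / w \<theta>) \<partial>\<kappa> (k q))"
      by (intro integral_density restrict) (use w(2) in \<open>auto simp: sp intro!: AE_I2 less_imp_le\<close>)
    also have "\<dots> = (\<integral>\<theta>. G q \<theta> \<partial>\<kappa> (k q))"
      by (intro Bochner_Integration.integral_cong) (use w(2) in \<open>force simp: sp\<close>)+
    finally show ?thesis .
  qed
  ultimately show ?thesis by (simp cong: measurable_cong)
qed

lemmas measurable_\<Pi>L_integral = weighted_kernel_integral_measurable[OF \<Pi>L sets_\<Pi>L]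
lemmas measurable_\<Pi>NL_integral = weighted_kernel_integral_measurable[OF \<Pi>NL sets_\<Pi>NL]

lemma measurable_\<pi>_integral:
  assumes F [measurable]: "(\<lambda>(q, y). F q y :: real) \<in> borel_measurable (M \<Otimes>\<^sub>M borel)" and [measurable]: "k \<in> M \<rightarrow>\<^sub>M borel"
  shows "(\<lambda>q. \<integral>y. F q y \<partial>\<pi> (k q)) \<in> borel_measurable M"
  using \<pi> [measurable] by (intro integral_measurable_subprob_algebra2[OF F] measurable_prob_algebraD) measurable

lemma measurable_coefficients [measurable]:
  "a \<in> borel_measurable borel" "b \<in> borel_measurable borel" "c \<in> borel_measurable borel"
  using a b c by (auto simp: bounded_borel_nonneg_def bounded_borel_def)

lemma measurable_mean_offspring [measurable]: "mean_offspring \<in> borel_measurable borel"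
  unfolding mean_offspring_def[abs_def]
  by (intro borel_measurable_add measurable_coefficients measurable_\<Pi>NL_integral) measurable

lemma measurable_linear_part:
  assumes F [measurable]: "(\<lambda>(q, y). F q y) \<in> borel_measurable (M \<Otimes>\<^sub>M borel)" and [measurable]: "k \<in> M \<rightarrow>\<^sub>M borel"
  shows "(\<lambda>q. linear_part (k q) (F q)) \<in> borel_measurable M"
proof -
  note measurable_\<pi>_integral[OF F, measurable]
  have [measurable]: "(\<lambda>q. F q (k q)) \<in> borel_measurable M"
    using measurable_compose[of "\<lambda>q. (q, k q)" M "M \<Otimes>\<^sub>M borel", OF _ F] by simp
  show ?thesis unfolding linear_part_def by measurable
qed

text \<open>Prepares the convolution in time of the mild equation. For s in [0,t] the truncation is
  void; it only makes the reversed function total in s.\<close>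

lemma measurable_linear_part_reversed:
  assumes F: "(\<lambda>(s :: real, y). F (max 0 s) y) \<in> borel_measurable (borel \<Otimes>\<^sub>M borel)"
  shows "(\<lambda>(s, y). linear_part y (F (max 0 (t - s)))) \<in> borel_measurable (borel \<Otimes>\<^sub>M borel)"
proof -
  have "(\<lambda>(p, z). (t - fst p, z)) \<in> (borel \<Otimes>\<^sub>M borel) \<Otimes>\<^sub>M borel \<rightarrow>\<^sub>M borel \<Otimes>\<^sub>M borel"
    by measurable
  from measurable_compose[OF this F]
  have "(\<lambda>p. linear_part (snd p) (F (max 0 (t - fst p)))) \<in> borel_measurable (borel \<Otimes>\<^sub>M borel)"
    by (intro measurable_linear_part) (simp_all add: case_prod_beta')
  then show ?thesis by (simp add: case_prod_beta)
qed

lemma measurable_branching: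
  assumes F [measurable]: "(\<lambda>(q, y). F q y) \<in> borel_measurable (M \<Otimes>\<^sub>M borel)" and k [measurable]: "k \<in> M \<rightarrow>\<^sub>M borel"
  shows "(\<lambda>q. \<psi> (k q) (F q)) \<in> borel_measurable M"
proof -
  note measurable_\<pi>_integral[OF F, measurable]
  have [measurable]: "(\<lambda>q. F q (k q)) \<in> borel_measurable M"
    using measurable_compose[of "\<lambda>q. (q, k q)" M "M \<Otimes>\<^sub>M borel", OF _ F] by simp
  have [measurable]: "(\<lambda>q. \<integral>\<theta>. (exp (- F q (k q) * \<theta>) - 1 + F q (k q) * \<theta>) \<partial>\<Pi>L (k q)) \<in> borel_measurable M"
    by (rule measurable_\<Pi>L_integral) measurable
  have [measurable]: "(\<lambda>q. \<integral>\<theta>. (1 - exp (- \<theta> * (\<integral>y. F q y \<partial>\<pi> (k q)))) \<partial>\<Pi>NL (k q)) \<in> borel_measurable M"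
    by (rule measurable_\<Pi>NL_integral) measurable
  show ?thesis unfolding branching_psi_def phi_local_def phi_nonlocal_def by measurable
qed

lemma mean_offspring_nonneg: "0 \<le> mean_offspring x"
  using c unfolding mean_offspring_def
  by (intro add_nonneg_nonneg Bochner_Integration.integral_nonneg) (auto simp: bounded_borel_nonneg_def)

lemma rates_bounded:
  obtains K where "0 < K" "\<And>x. \<bar>a x\<bar> + mean_offspring x \<le> K"
proof -
  obtain A where A: "0 < A" "\<And>x. \<bar>a x\<bar> \<le> A" using a by (metis bounded_borelE)
  have "c \<in> bounded_borel" using c by (simp add: bounded_borel_nonneg_def)
  then obtain C where C: "0 < C" "\<And>x. \<bar>c x\<bar> \<le> C" by (metis bounded_borelE)
  obtain D where D: "0 < D" "\<And>x. (\<integral>\<theta>. \<theta> \<partial>\<Pi>NL x) \<le> D" by (metis moment_\<Pi>NL)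
  have "\<bar>a x\<bar> + mean_offspring x \<le> A + (C + D)" for x
    unfolding mean_offspring_def using A(2)[of x] C(2)[of x] D(2)[of x] by linarith
  with that[of "A + (C + D)"] A C D show ?thesis by simp
qed

lemma integral_gamma_kernel:
  assumes [measurable]: "f \<in> borel_measurable borel"
  shows "(\<integral>y. f y \<partial>gamma_kernel c \<pi> \<Pi>NL x) = mean_offspring x * (\<integral>y. f y \<partial>\<pi> x)"
proof -
  have c0: "0 \<le> c x" using c by (auto simp: bounded_borel_nonneg_def)
  have nonneg: "0 \<le> (\<integral>\<theta>. \<theta> \<partial>\<Pi>NL x)"
    by (intro Bochner_Integration.integral_nonneg) auto
  have "(\<integral>\<^sup>+\<theta>. ennreal \<theta> \<partial>\<Pi>NL x) = ennreal (\<integral>\<theta>. \<theta> \<partial>\<Pi>NL x)"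
    by (rule nn_integral_eq_integral[OF integrable_\<Pi>NL]) (auto intro!: AE_I2)
  then have "ennreal (c x) + (\<integral>\<^sup>+\<theta>. ennreal \<theta> \<partial>\<Pi>NL x) = ennreal (mean_offspring x)"
    using c0 nonneg by (simp add: mean_offspring_def)
  then have "gamma_kernel c \<pi> \<Pi>NL x = density (\<pi> x) (\<lambda>_. ennreal (mean_offspring x))"
    unfolding gamma_kernel_def
    by (intro measure_eqI) (auto simp: emeasure_density_const)
  then show ?thesis using mean_offspring_nonneg[of x] by (simp add: integral_density)
qed

lemma abs_integral_\<pi>_le:
  fixes f :: "'a \<Rightarrow> real"
  assumes "\<And>y. \<bar>f y\<bar> \<le> C"
  shows "\<bar>\<integral>y. f y \<partial>\<pi> x\<bar> \<le> C"
proof -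
  interpret prob_space "\<pi> x" by (rule prob_space_\<pi>)
  have "\<bar>\<integral>y. f y \<partial>\<pi> x\<bar> \<le> (\<integral>y. \<bar>f y\<bar> \<partial>\<pi> x)" by (rule integral_abs_bound)
  also have "\<dots> \<le> (\<integral>y. C \<partial>\<pi> x)"
    by (rule integral_mono') (use assms order_trans[OF abs_ge_zero assms[of x]] in auto)
  finally show ?thesis using prob_space by simp
qed

lemma linear_part_le:
  assumes "\<And>y. \<bar>f y\<bar> \<le> C" and K: "\<bar>a x\<bar> + mean_offspring x \<le> K"
  shows "\<bar>linear_part x f\<bar> \<le> K * C"
proof -
  have C: "0 \<le> C" using assms(1)[of x] by simp
  have "\<bar>linear_part x f\<bar> \<le> \<bar>a x\<bar> * \<bar>f x\<bar> + mean_offspring x * \<bar>\<integral>y. f y \<partial>\<pi> x\<bar>"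
    unfolding linear_part_def using abs_triangle_ineq4[of "a x * f x" "mean_offspring x * (\<integral>y. f y \<partial>\<pi> x)"]
    by (simp add: abs_mult mean_offspring_nonneg)
  also have "\<dots> \<le> \<bar>a x\<bar> * C + mean_offspring x * C"
    using assms(1)[of x] abs_integral_\<pi>_le[of f C x, OF assms(1)]
    by (intro add_mono mult_left_mono) (auto simp: mean_offspring_nonneg)
  also have "\<dots> \<le> K * C" using mult_right_mono[OF K C] by (simp add: distrib_right)
  finally show ?thesis .
qed

text \<open>Two different bounds are required: the second tends to 0 as N grows, but \<theta>^2 may
  fail to be integrable for large jumps; the third does not decay, but is uniform in N and matches
  the integrable function \<open>min \<theta> (\<theta>\<^sup>2)\<close>.\<close>

lemma local_jump_bounds:
  fixes N u \<theta> :: real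
  assumes u: "0 \<le> u" and N: "1 \<le> N" and \<theta>: "0 < \<theta>"
  shows "0 \<le> N * (exp (- (u / N) * \<theta>) - 1 + u / N * \<theta>)"
    and "N * (exp (- (u / N) * \<theta>) - 1 + u / N * \<theta>) \<le> u\<^sup>2 * \<theta>\<^sup>2 / N"
    and "N * (exp (- (u / N) * \<theta>) - 1 + u / N * \<theta>) \<le> (u + u\<^sup>2) * min \<theta> (\<theta>\<^sup>2)"
proof -
  define y where "y = u / N * \<theta>"
  have y: "0 \<le> y" using assms by (simp add: y_def)
  have eq: "N * (exp (- (u / N) * \<theta>) - 1 + u / N * \<theta>) = N * (exp (- y) - 1 + y)" by (simp add: y_def)
  show "0 \<le> N * (exp (- (u / N) * \<theta>) - 1 + u / N * \<theta>)"
    unfolding eq using exp_minus_le(1)[OF y] N by simp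
  have "N * (exp (- y) - 1 + y) \<le> N * y\<^sup>2" using exp_minus_le(3)[OF y] N by (intro mult_left_mono) auto
  also have "\<dots> = u\<^sup>2 * \<theta>\<^sup>2 / N" using N by (simp add: y_def power2_eq_square field_simps)
  finally show 2: "N * (exp (- (u / N) * \<theta>) - 1 + u / N * \<theta>) \<le> u\<^sup>2 * \<theta>\<^sup>2 / N" unfolding eq .
  have "N * (exp (- y) - 1 + y) \<le> N * y" using exp_minus_le(2)[OF y] N by (intro mult_left_mono) auto
  also have "\<dots> = u * \<theta>" using N by (simp add: y_def)
  finally have 1: "N * (exp (- (u / N) * \<theta>) - 1 + u / N * \<theta>) \<le> u * \<theta>" unfolding eq .
  have "u\<^sup>2 * \<theta>\<^sup>2 / N \<le> u\<^sup>2 * \<theta>\<^sup>2" using N by (simp add: divide_le_eq mult_left_le zero_le_mult_iff) (simp add: mult_left_mono[of 1 N "u\<^sup>2 * \<theta>\<^sup>2", simplified])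
  with 1 2 have "N * (exp (- (u / N) * \<theta>) - 1 + u / N * \<theta>) \<le> min (u * \<theta>) (u\<^sup>2 * \<theta>\<^sup>2)" by simp
  also have "\<dots> \<le> (u + u\<^sup>2) * min \<theta> (\<theta>\<^sup>2)"
  proof (cases "\<theta> \<le> \<theta>\<^sup>2")
    case True
    have "min (u * \<theta>) (u\<^sup>2 * \<theta>\<^sup>2) \<le> u * \<theta>" by simp
    also have "\<dots> \<le> (u + u\<^sup>2) * \<theta>" using \<theta> by (intro mult_right_mono) auto
    finally show ?thesis using True by (simp add: min_def)
  next
    case False
    have "min (u * \<theta>) (u\<^sup>2 * \<theta>\<^sup>2) \<le> u\<^sup>2 * \<theta>\<^sup>2" by simp
    also have "\<dots> \<le> (u + u\<^sup>2) * \<theta>\<^sup>2" using u by (intro mult_right_mono) auto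
    finally show ?thesis using False by (simp add: min_def)
  qed
  finally show "N * (exp (- (u / N) * \<theta>) - 1 + u / N * \<theta>) \<le> (u + u\<^sup>2) * min \<theta> (\<theta>\<^sup>2)" .
qed

text \<open>Sandwiches the scaled jump term between \<open>\<theta> * r\<close> and itself minus an
  error of order 1/N. With \<open>\<theta> = 1\<close> the same bounds compare a variable with its
  rescaled Laplace functional.\<close>

lemma nonlocal_jump_bounds:
  fixes N r \<theta> :: real
  assumes r: "0 \<le> r" and N: "1 \<le> N" and \<theta>: "0 < \<theta>"
  shows "0 \<le> N * (1 - exp (- \<theta> * (r / N)))" "N * (1 - exp (- \<theta> * (r / N))) \<le> \<theta> * r"
    and "\<theta> * r - (\<theta> * r)\<^sup>2 / N \<le> N * (1 - exp (- \<theta> * (r / N)))"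
proof -
  define y where "y = \<theta> * (r / N)"
  have y: "0 \<le> y" using assms by (simp add: y_def)
  have Ny: "N * y = \<theta> * r" using N by (simp add: y_def)
  show "0 \<le> N * (1 - exp (- \<theta> * (r / N)))" using y N by (simp add: y_def)
  have "N * (1 - exp (- y)) \<le> N * y" using exp_minus_le(1)[OF y] N by (intro mult_left_mono) auto
  then show "N * (1 - exp (- \<theta> * (r / N))) \<le> \<theta> * r" unfolding Ny by (simp add: y_def)
  have "N * (y - y\<^sup>2) \<le> N * (1 - exp (- y))" using exp_minus_le(3)[OF y] N by (intro mult_left_mono) auto
  moreover have "N * (y - y\<^sup>2) = \<theta> * r - (\<theta> * r)\<^sup>2 / N"
    using N by (simp add: y_def power2_eq_square field_simps)
  ultimately show "\<theta> * r - (\<theta> * r)\<^sup>2 / N \<le> N * (1 - exp (- \<theta> * (r / N)))" by (simp add: y_def)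
qed

text \<open>Linear terms are invariant under the scaling, while the quadratic term gains a factor
  1/N. The factor N stays inside the jump integrals, where the pointwise bounds apply.\<close>

lemma scaled_branching:
  fixes N :: real
  assumes "0 < N"
  shows "N * \<psi> x (\<lambda>y. f y / N) = a x * f x + b x * (f x)\<^sup>2 / N
    + (\<integral>\<theta>. N * (exp (- (f x / N) * \<theta>) - 1 + f x / N * \<theta>) \<partial>\<Pi>L x)
    - c x * (\<integral>y. f y \<partial>\<pi> x) - (\<integral>\<theta>. N * (1 - exp (- \<theta> * ((\<integral>y. f y \<partial>\<pi> x) / N))) \<partial>\<Pi>NL x)"
proof -
  have "N * (A * (u / N) + B * (u / N)\<^sup>2 + J + (- C * (r / N) - J')) = A * u + B * u\<^sup>2 / N + N * J - C * r - N * J'"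
    for A u B J C r J' :: real
    using assms by (simp add: power2_eq_square field_simps)
  then show ?thesis
    by (simp only: branching_psi_def phi_local_def phi_nonlocal_def integral_mult_right_zero integral_divide_zero)
qed

lemma local_jump_integral:
  fixes N u :: real and x :: 'a
  assumes u: "0 \<le> u" and N: "1 \<le> N"
  defines "J \<equiv> \<integral>\<theta>. N * (exp (- (u / N) * \<theta>) - 1 + u / N * \<theta>) \<partial>\<Pi>L x"
  shows "0 \<le> J" "J \<le> (u + u\<^sup>2) * (\<integral>\<theta>. min \<theta> (\<theta>\<^sup>2) \<partial>\<Pi>L x)"
proof -
  show "0 \<le> J" unfolding J_def
    by (intro Bochner_Integration.integral_nonneg) (use local_jump_bounds(1)[OF u N] in auto)
  have "J \<le> (\<integral>\<theta>. (u + u\<^sup>2) * min \<theta> (\<theta>\<^sup>2) \<partial>\<Pi>L x)" unfolding J_def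
    by (rule integral_mono') (use local_jump_bounds(3)[OF u N] integrable_\<Pi>L_min u in auto)
  then show "J \<le> (u + u\<^sup>2) * (\<integral>\<theta>. min \<theta> (\<theta>\<^sup>2) \<partial>\<Pi>L x)" by simp
qed

lemma nonlocal_jump_integral:
  fixes N r :: real and x :: 'a
  assumes r: "0 \<le> r" and N: "1 \<le> N"
  defines "J \<equiv> \<integral>\<theta>. N * (1 - exp (- \<theta> * (r / N))) \<partial>\<Pi>NL x"
  shows "0 \<le> J" "J \<le> r * (\<integral>\<theta>. \<theta> \<partial>\<Pi>NL x)"
proof -
  show "0 \<le> J" unfolding J_def
    by (intro Bochner_Integration.integral_nonneg) (use nonlocal_jump_bounds(1)[OF r N] in auto)
  have "J \<le> (\<integral>\<theta>. \<theta> * r \<partial>\<Pi>NL x)" unfolding J_def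
    by (rule integral_mono') (use nonlocal_jump_bounds(2)[OF r N] integrable_\<Pi>NL r in auto)
  then show "J \<le> r * (\<integral>\<theta>. \<theta> \<partial>\<Pi>NL x)" by (simp add: mult.commute)
qed

lemma integral_\<pi>_nonneg: "(\<And>y. 0 \<le> f y) \<Longrightarrow> 0 \<le> (\<integral>y. (f y :: real) \<partial>\<pi> x)"
  by (intro Bochner_Integration.integral_nonneg) auto

text \<open>D depends on the bound M of the functions but not on N, so it can serve as a majorant
  when N tends to infinity.\<close>

lemma scaled_branching_bounded:
  obtains D where "\<And>x f N. (\<And>y. 0 \<le> f y) \<Longrightarrow> (\<And>y. f y \<le> M) \<Longrightarrow> 1 \<le> N \<Longrightarrow> \<bar>N * \<psi> x (\<lambda>y. f y / N)\<bar> \<le> D"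
proof -
  obtain K where K: "0 < K" "\<And>x. \<bar>a x\<bar> + mean_offspring x \<le> K" by (metis rates_bounded)
  have "b \<in> bounded_borel" using b by (simp add: bounded_borel_nonneg_def)
  then obtain B where B: "0 < B" "\<And>x. \<bar>b x\<bar> \<le> B" by (metis bounded_borelE)
  obtain C where C: "0 < C" "\<And>x. (\<integral>\<theta>. min \<theta> (\<theta>\<^sup>2) \<partial>\<Pi>L x) \<le> C" by (metis moment_\<Pi>L)
  \<comment> \<open>The first summand covers the drift and the nonlocal terms together, the second
    the quadratic term, the third the local jumps.\<close>
  have "\<bar>N * \<psi> x (\<lambda>y. f y / N)\<bar> \<le> K * M + B * M\<^sup>2 + (M + M\<^sup>2) * C"
    if f: "\<And>y. 0 \<le> f y" "\<And>y. f y \<le> M" and N: "1 \<le> N" for x f N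
  proof -
    let ?r = "\<integral>y. f y \<partial>\<pi> x"
    have M: "0 \<le> M" using f[of x] by simp
    have r: "0 \<le> ?r" "?r \<le> M" using integral_\<pi>_nonneg[of f x] abs_integral_\<pi>_le[of f M x] f by auto
    have fM: "(f x)\<^sup>2 \<le> M\<^sup>2" using f by (intro power_mono) auto
    have "\<bar>a x * f x\<bar> \<le> \<bar>a x\<bar> * M" using f by (auto simp: abs_mult intro!: mult_left_mono)
    moreover have "0 \<le> b x * (f x)\<^sup>2 / N" "b x * (f x)\<^sup>2 / N \<le> B * M\<^sup>2"
    proof -
      have b0: "0 \<le> b x" using b by (auto simp: bounded_borel_nonneg_def)
      then show "0 \<le> b x * (f x)\<^sup>2 / N" using N by simp
      have "b x * (f x)\<^sup>2 / N \<le> b x * (f x)\<^sup>2 / 1" using N b0 by (intro divide_left_mono) auto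
      also have "\<dots> \<le> B * M\<^sup>2" using B(2)[of x] b0 fM by (auto intro!: mult_mono)
      finally show "b x * (f x)\<^sup>2 / N \<le> B * M\<^sup>2" .
    qed
    moreover have "(f x + (f x)\<^sup>2) * (\<integral>\<theta>. min \<theta> (\<theta>\<^sup>2) \<partial>\<Pi>L x) \<le> (M + M\<^sup>2) * C"
      using f(1)[of x] f(2)[of x] fM C M
      by (intro mult_mono add_mono Bochner_Integration.integral_nonneg) auto
    moreover have "0 \<le> c x * ?r" using c r by (auto simp: bounded_borel_nonneg_def)
    moreover have "c x * ?r + ?r * (\<integral>\<theta>. \<theta> \<partial>\<Pi>NL x) \<le> mean_offspring x * M"
    proof -
      have "c x * ?r + ?r * (\<integral>\<theta>. \<theta> \<partial>\<Pi>NL x) = mean_offspring x * ?r"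
        by (simp add: mean_offspring_def algebra_simps)
      then show ?thesis using r mean_offspring_nonneg by (simp add: mult_left_mono)
    qed
    moreover have "\<bar>a x\<bar> * M + mean_offspring x * M \<le> K * M"
      using mult_right_mono[OF K(2)[of x] M] by (simp add: distrib_right)
    moreover have "0 < N" using N by simp
    ultimately show ?thesis
      unfolding scaled_branching[OF \<open>0 < N\<close>]
      using local_jump_integral[OF f(1)[of x] N, of x] nonlocal_jump_integral[OF r(1) N, of x]
        mult_nonneg_nonneg[OF mean_offspring_nonneg[of x] M]
      by linarith
  qed
  then show ?thesis using that by blast
qed

text \<open>The quadratic and local jump terms are nonnegative and drop out of an upper bound for
  \<open>- \<psi>\<close>. What remains grows linearly in M, as a Gronwall estimate demands; the
  two-sided bound is quadratic in M.\<close>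

lemma branching_lower_bound:
  assumes f: "\<And>y. 0 \<le> f y" "\<And>y. f y \<le> M" and K: "\<bar>a x\<bar> + mean_offspring x \<le> K"
  shows "- \<psi> x f \<le> K * M"
proof -
  let ?r = "\<integral>y. f y \<partial>\<pi> x"
  have M: "0 \<le> M" using f[of x] by simp
  have r: "0 \<le> ?r" "?r \<le> M" using integral_\<pi>_nonneg[of f x] abs_integral_\<pi>_le[of f M x] f by auto
  have "\<bar>a x * f x\<bar> \<le> \<bar>a x\<bar> * M" using f by (auto simp: abs_mult intro!: mult_left_mono)
  moreover have "0 \<le> b x * (f x)\<^sup>2" using b by (auto simp: bounded_borel_nonneg_def)
  moreover have "c x * ?r + ?r * (\<integral>\<theta>. \<theta> \<partial>\<Pi>NL x) \<le> mean_offspring x * M"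
  proof -
    have "c x * ?r + ?r * (\<integral>\<theta>. \<theta> \<partial>\<Pi>NL x) = mean_offspring x * ?r"
      by (simp add: mean_offspring_def algebra_simps)
    then show ?thesis using r mean_offspring_nonneg by (simp add: mult_left_mono)
  qed
  moreover have "\<bar>a x\<bar> * M + mean_offspring x * M \<le> K * M"
    using mult_right_mono[OF K M] by (simp add: distrib_right)
  \<comment> \<open>For \<open>N = 1\<close> the scaled expression is \<psi> itself.\<close>
  ultimately show ?thesis
    using scaled_branching[of 1 x f] local_jump_integral(1)[OF f(1)[of x], of 1 x]
      nonlocal_jump_integral(2)[OF r(1), of 1 x] by simp
qed

text \<open>The functions vary with n, as the rescaled log-Laplace functionals will. A uniform bound
  and pointwise convergence suffice, because \<open>\<pi> x\<close> is a probability measure and the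
  jump terms have majorants uniform in n.\<close>

lemma scaled_branching_tendsto:
  assumes [measurable]: "\<And>n. f n \<in> borel_measurable borel" "g \<in> borel_measurable borel"
    and f: "\<And>n y. 0 \<le> f n y" "\<And>n y. f n y \<le> M" and lim: "\<And>y. (\<lambda>n. f n y) \<longlonglongrightarrow> g y"
  shows "(\<lambda>n. real (Suc n) * \<psi> x (\<lambda>y. f n y / real (Suc n))) \<longlonglongrightarrow> linear_part x g"
proof -
  let ?N = "\<lambda>n. real (Suc n)"
  let ?r = "\<lambda>n. \<integral>y. f n y \<partial>\<pi> x"
  interpret prob_space "\<pi> x" by (rule prob_space_\<pi>)
  have M: "0 \<le> M" using f[of 0 x] by simp
  have r: "0 \<le> ?r n" "?r n \<le> M" for n
    using integral_\<pi>_nonneg[of "f n" x] abs_integral_\<pi>_le[of "f n" M x] f by auto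
  have r_lim: "?r \<longlonglongrightarrow> (\<integral>y. g y \<partial>\<pi> x)"
    by (rule integral_dominated_convergence[where w = "\<lambda>_. M"]) (use f lim in \<open>auto intro!: AE_I2\<close>)
  have inv: "(\<lambda>n. z / ?N n) \<longlonglongrightarrow> 0" for z :: real
    using LIMSEQ_Suc[OF lim_const_over_n[of z]] by simp
  have fM: "(f n x)\<^sup>2 \<le> M\<^sup>2" for n using f by (intro power_mono) auto
  have local: "(\<lambda>n. \<integral>\<theta>. ?N n * (exp (- (f n x / ?N n) * \<theta>) - 1 + f n x / ?N n * \<theta>) \<partial>\<Pi>L x) \<longlonglongrightarrow> (\<integral>\<theta>. 0 \<partial>\<Pi>L x)"
  proof (rule integral_dominated_convergence[where w = "\<lambda>\<theta>. (M + M\<^sup>2) * min \<theta> (\<theta>\<^sup>2)"])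
    show "integrable (\<Pi>L x) (\<lambda>\<theta>. (M + M\<^sup>2) * min \<theta> (\<theta>\<^sup>2))" using integrable_\<Pi>L_min by simp
    show "AE \<theta> in \<Pi>L x. norm (?N n * (exp (- (f n x / ?N n) * \<theta>) - 1 + f n x / ?N n * \<theta>)) \<le> (M + M\<^sup>2) * min \<theta> (\<theta>\<^sup>2)" for n
    proof (rule AE_I2)
      fix \<theta> assume "\<theta> \<in> space (\<Pi>L x)"
      then have \<theta>: "0 < \<theta>" by simp
      have "(f n x + (f n x)\<^sup>2) * min \<theta> (\<theta>\<^sup>2) \<le> (M + M\<^sup>2) * min \<theta> (\<theta>\<^sup>2)"
        using f fM \<theta> by (intro mult_right_mono add_mono) auto
      then show "norm (?N n * (exp (- (f n x / ?N n) * \<theta>) - 1 + f n x / ?N n * \<theta>)) \<le> (M + M\<^sup>2) * min \<theta> (\<theta>\<^sup>2)"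
        using local_jump_bounds[OF f(1)[of n x] _ \<theta>, of "?N n"] by simp
    qed
    show "AE \<theta> in \<Pi>L x. (\<lambda>n. ?N n * (exp (- (f n x / ?N n) * \<theta>) - 1 + f n x / ?N n * \<theta>)) \<longlonglongrightarrow> 0"
    proof (rule AE_I2)
      fix \<theta> assume "\<theta> \<in> space (\<Pi>L x)"
      then have \<theta>: "0 < \<theta>" by simp
      show "(\<lambda>n. ?N n * (exp (- (f n x / ?N n) * \<theta>) - 1 + f n x / ?N n * \<theta>)) \<longlonglongrightarrow> 0"
      proof (rule Lim_null_comparison[OF always_eventually inv[of "M\<^sup>2 * \<theta>\<^sup>2"]], rule allI)
        fix n
        have "(f n x)\<^sup>2 * \<theta>\<^sup>2 / ?N n \<le> M\<^sup>2 * \<theta>\<^sup>2 / ?N n"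
          using fM by (intro divide_right_mono mult_right_mono) auto
        then show "norm (?N n * (exp (- (f n x / ?N n) * \<theta>) - 1 + f n x / ?N n * \<theta>)) \<le> M\<^sup>2 * \<theta>\<^sup>2 / ?N n"
          using local_jump_bounds[OF f(1)[of n x] _ \<theta>, of "?N n"] by simp
      qed
    qed
  qed (auto intro!: borel_measurable_restrict_\<Pi>)
  have nonlocal: "(\<lambda>n. \<integral>\<theta>. ?N n * (1 - exp (- \<theta> * (?r n / ?N n))) \<partial>\<Pi>NL x) \<longlonglongrightarrow> (\<integral>\<theta>. \<theta> * (\<integral>y. g y \<partial>\<pi> x) \<partial>\<Pi>NL x)"
  proof (rule integral_dominated_convergence[where w = "\<lambda>\<theta>. \<theta> * M"])
    show "integrable (\<Pi>NL x) (\<lambda>\<theta>. \<theta> * M)" using integrable_\<Pi>NL by simp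
    show "AE \<theta> in \<Pi>NL x. norm (?N n * (1 - exp (- \<theta> * (?r n / ?N n)))) \<le> \<theta> * M" for n
    proof (rule AE_I2)
      fix \<theta> assume "\<theta> \<in> space (\<Pi>NL x)"
      then have \<theta>: "0 < \<theta>" by simp
      then have "\<theta> * ?r n \<le> \<theta> * M" using r by (intro mult_left_mono) auto
      then show "norm (?N n * (1 - exp (- \<theta> * (?r n / ?N n)))) \<le> \<theta> * M"
        using nonlocal_jump_bounds[OF r(1)[of n] _ \<theta>, of "?N n"] by simp
    qed
    show "AE \<theta> in \<Pi>NL x. (\<lambda>n. ?N n * (1 - exp (- \<theta> * (?r n / ?N n)))) \<longlonglongrightarrow> \<theta> * (\<integral>y. g y \<partial>\<pi> x)"
    proof (rule AE_I2)
      fix \<theta> assume "\<theta> \<in> space (\<Pi>NL x)"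
      then have \<theta>: "0 < \<theta>" by simp
      have up: "(\<lambda>n. \<theta> * ?r n) \<longlonglongrightarrow> \<theta> * (\<integral>y. g y \<partial>\<pi> x)" using r_lim by (intro tendsto_intros)
      have "(\<lambda>n. (\<theta> * ?r n)\<^sup>2 * (1 / ?N n)) \<longlonglongrightarrow> (\<theta> * (\<integral>y. g y \<partial>\<pi> x))\<^sup>2 * 0"
        by (intro tendsto_intros up inv)
      from tendsto_diff[OF up this]
      have low: "(\<lambda>n. \<theta> * ?r n - (\<theta> * ?r n)\<^sup>2 / ?N n) \<longlonglongrightarrow> \<theta> * (\<integral>y. g y \<partial>\<pi> x)" by simp
      show "(\<lambda>n. ?N n * (1 - exp (- \<theta> * (?r n / ?N n)))) \<longlonglongrightarrow> \<theta> * (\<integral>y. g y \<partial>\<pi> x)"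
        by (rule tendsto_sandwich[OF _ _ low up])
           (use nonlocal_jump_bounds[OF r(1) _ \<theta>] in \<open>auto intro!: always_eventually\<close>)
    qed
  qed (auto intro!: borel_measurable_restrict_\<Pi>)
  have quad: "(\<lambda>n. b x * (f n x)\<^sup>2 * (1 / ?N n)) \<longlonglongrightarrow> b x * (g x)\<^sup>2 * 0"
    by (intro tendsto_intros lim inv)
  have "(\<lambda>n. a x * f n x + b x * (f n x)\<^sup>2 * (1 / ?N n)
    + (\<integral>\<theta>. ?N n * (exp (- (f n x / ?N n) * \<theta>) - 1 + f n x / ?N n * \<theta>) \<partial>\<Pi>L x)
    - c x * ?r n - (\<integral>\<theta>. ?N n * (1 - exp (- \<theta> * (?r n / ?N n))) \<partial>\<Pi>NL x))
    \<longlonglongrightarrow> a x * g x + b x * (g x)\<^sup>2 * 0 + (\<integral>\<theta>. 0 \<partial>\<Pi>L x) - c x * (\<integral>y. g y \<partial>\<pi> x) - (\<integral>\<theta>. \<theta> * (\<integral>y. g y \<partial>\<pi> x) \<partial>\<Pi>NL x)"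
    by (intro tendsto_add tendsto_diff tendsto_mult_left quad local nonlocal lim r_lim)
  then show ?thesis
    by (subst scaled_branching) (simp_all add: linear_part_def mean_offspring_def algebra_simps)
qed

end

section \<open>First moments of the superprocess\<close>

lemma openin_weak_topology_subset: "openin weak_topology U \<Longrightarrow> U \<subseteq> finite_borel_measures"
  by (drule openin_subset) (auto simp: weak_topology_def)

lemma space_weak_borel [simp]: "space weak_borel = finite_borel_measures"
  unfolding weak_borel_def by (rule space_measure_of) (auto dest: openin_weak_topology_subset)

lemma sets_weak_borel: "sets weak_borel = sigma_sets finite_borel_measures {U. openin weak_topology U}"
  unfolding weak_borel_def by (rule sets_measure_of) (auto dest: openin_weak_topology_subset)

lemma measurable_weak_borel_integral:
  assumes f: "f \<in> bounded_continuous"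
  shows "(\<lambda>\<mu>. \<integral>x. f x \<partial>\<mu>) \<in> borel_measurable weak_borel"
proof (rule borel_measurableI)
  fix U :: "real set" assume "open U"
  with f have "openin weak_topology {\<mu> \<in> finite_borel_measures. (\<integral>x. f x \<partial>\<mu>) \<in> U}"
    unfolding weak_topology_def by (intro topology_generated_by_Basis) blast
  then have "{\<mu> \<in> finite_borel_measures. (\<integral>x. f x \<partial>\<mu>) \<in> U} \<in> sets weak_borel"
    unfolding sets_weak_borel by (intro sigma_sets.Basic) simp
  moreover have "(\<lambda>\<mu>. \<integral>x. f x \<partial>\<mu>) -` U \<inter> space weak_borel = {\<mu> \<in> finite_borel_measures. (\<integral>x. f x \<partial>\<mu>) \<in> U}"
    by auto
  ultimately show "(\<lambda>\<mu>. \<integral>x. f x \<partial>\<mu>) -` U \<inter> space weak_borel \<in> sets weak_borel" by simp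
qed

lemma path_space_coordinate: "w \<in> path_space \<Longrightarrow> 0 \<le> t \<Longrightarrow> w t \<in> finite_borel_measures"
  by (auto simp: path_space_def PiE_iff)

lemma space_path_sigma [simp]: "space path_sigma = path_space"
  unfolding path_sigma_def generated_sigma_def by (rule space_measure_of) auto

lemma sets_path_sigma:
  "sets path_sigma = sigma_sets path_space {(\<lambda>w. w i) -` B \<inter> path_space | i B. i \<in> {0..} \<and> B \<in> sets weak_borel}"
  unfolding path_sigma_def generated_sigma_def by (rule sets_measure_of) auto

lemma space_path_filtration [simp]: "space (path_filtration t) = path_space"
  unfolding path_filtration_def generated_sigma_def by (rule space_measure_of) auto

lemma sets_path_filtration:
  "sets (path_filtration t) = sigma_sets path_space {(\<lambda>w. w i) -` B \<inter> path_space | i B. i \<in> {0..t} \<and> B \<in> sets weak_borel}"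
  unfolding path_filtration_def generated_sigma_def by (rule sets_measure_of) auto

lemma measurable_path_filtration: "0 \<le> s \<Longrightarrow> s \<le> t \<Longrightarrow> (\<lambda>w. w s) \<in> path_filtration t \<rightarrow>\<^sub>M weak_borel"
  by (rule measurableI) (auto simp: path_space_coordinate sets_path_filtration intro!: sigma_sets.Basic)

lemma measurable_path_sigma: "0 \<le> s \<Longrightarrow> (\<lambda>w. w s) \<in> path_sigma \<rightarrow>\<^sub>M weak_borel"
  by (rule measurableI) (auto simp: path_space_coordinate sets_path_sigma intro!: sigma_sets.Basic)

lemma sets_path_filtration_mono: "s \<le> t \<Longrightarrow> sets (path_filtration s) \<subseteq> sets (path_filtration t)"
  unfolding sets_path_filtration
  by (rule sigma_sets_mono', rule Collect_mono, intro impI, elim exE conjE, intro exI conjI) auto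

lemma sets_path_filtration_subset: "sets (path_filtration t) \<subseteq> sets path_sigma"
  unfolding sets_path_filtration sets_path_sigma
  by (rule sigma_sets_mono', rule Collect_mono, intro impI, elim exE conjE, intro exI conjI) auto

lemma bounded_continuous_bounded_borel: "f \<in> bounded_continuous \<Longrightarrow> f \<in> bounded_borel"
  by (auto simp: bounded_continuous_def bounded_borel_def intro: borel_measurable_continuous_onI)

section \<open>Limits and one-sided estimates for the semigroup\<close>

lemma set_lborel_dominated_convergence:
  fixes f :: "nat \<Rightarrow> real \<Rightarrow> real"
  assumes [measurable]: "\<And>n. f n \<in> borel_measurable borel" "g \<in> borel_measurable borel"
    and lim: "\<And>s. s \<in> {c..d} \<Longrightarrow> (\<lambda>n. f n s) \<longlonglongrightarrow> g s" and bound: "\<And>n s. s \<in> {c..d} \<Longrightarrow> \<bar>f n s\<bar> \<le> C"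
  shows "(\<lambda>n. LINT s:{c..d}|lborel. f n s) \<longlonglongrightarrow> (LINT s:{c..d}|lborel. g s)"
  unfolding set_lebesgue_integral_def
proof (rule integral_dominated_convergence[where w = "\<lambda>s. indicator {c..d} s * C"])
  show "AE s in lborel. (\<lambda>n. indicator {c..d} s *\<^sub>R f n s) \<longlonglongrightarrow> indicator {c..d} s *\<^sub>R g s"
    using lim by (auto split: split_indicator)
  show "AE s in lborel. norm (indicator {c..d} s *\<^sub>R f n s) \<le> indicator {c..d} s * C" for n
    using bound by (auto split: split_indicator)
qed auto

context hunt_process
begin

text \<open>The sign of C matters because the extended function takes the value 0 in the
  cemetery.\<close>

lemma S_le: "(\<And>x. f x \<le> C) \<Longrightarrow> 0 \<le> C \<Longrightarrow> S t f x \<le> C"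
proof -
  assume f: "\<And>x. f x \<le> C" and C: "0 \<le> C"
  interpret prob_space "Pr (Some x)" by (rule prob_space_Pr)
  have "extend_zero f z \<le> C" for z using f C by (cases z) auto
  then have "S t f x \<le> (\<integral>\<omega>. C \<partial>Pr (Some x))"
    unfolding transition_semigroup_def by (intro integral_mono') (auto simp: C)
  then show ?thesis by (simp add: prob_space del: space_Pr)
qed

lemma S_dominated_convergence:
  assumes [measurable]: "\<And>n. f n \<in> borel_measurable borel" "g \<in> borel_measurable borel"
    and lim: "\<And>y. (\<lambda>n. f n y) \<longlonglongrightarrow> g y" and bound: "\<And>n y. \<bar>f n y\<bar> \<le> C"
  shows "(\<lambda>n. S t (f n) x) \<longlonglongrightarrow> S t g x"
  unfolding transition_semigroup_def
proof (rule integral_dominated_convergence[where w = "\<lambda>_. C"])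
  interpret prob_space "Pr (Some x)" by (rule prob_space_Pr)
  show "integrable (Pr (Some x)) (\<lambda>_. C)" by simp
  have C: "0 \<le> C" using bound[of undefined undefined] by simp
  show "AE \<omega> in Pr (Some x). norm (extend_zero (f n) (\<xi> (ennreal t) \<omega>)) \<le> C" for n
    using abs_extend_zero_le[of C "f n", OF C bound] by simp
  have "(\<lambda>n. extend_zero (f n) z) \<longlonglongrightarrow> extend_zero g z" for z
    using lim by (cases z) auto
  then show "AE \<omega> in Pr (Some x). (\<lambda>n. extend_zero (f n) (\<xi> (ennreal t) \<omega>)) \<longlonglongrightarrow> extend_zero g (\<xi> (ennreal t) \<omega>)"
    by simp
qed measurable

text \<open>This is the source of the factor 1/2 in \<open>gronwall\<close>: integrating
  \<open>K * exp (2 * K * (t - s))\<close> over [0,t] gives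
  \<open>(exp (2 * K * t) - 1) / 2\<close>.\<close>

lemma gronwall_integral_le:
  assumes t: "0 \<le> t" and K: "0 < K" and M: "0 \<le> M"
    and F: "\<And>s y. s \<in> {0..t} \<Longrightarrow> F s y \<le> K * (M * exp (2 * K * (t - s)))"
  shows "(LINT s:{0..t}|lborel. S s (F s) x) \<le> M * (exp (2 * K * t) / 2)"
proof -
  \<comment> \<open>Chosen so that the majorant is c times the derivative of
    \<open>exp (- (2 * K) * s)\<close>, which \<open>set_integral_exp\<close> integrates.\<close>
  define c where "c = - (M * exp (2 * K * t) / 2)"
  have eq: "c * ((- (2 * K)) * exp (- (2 * K) * s)) = K * (M * exp (2 * K * (t - s)))" for s
  proof -
    have "exp (2 * K * t) * exp (- (2 * K) * s) = exp (2 * K * (t - s))"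
      by (simp add: exp_add[symmetric] algebra_simps)
    then show ?thesis by (simp add: c_def algebra_simps)
  qed
  have int: "set_integrable lborel {0..t} (\<lambda>s. c * ((- (2 * K)) * exp (- (2 * K) * s)))"
    unfolding set_integrable_def by (rule borel_integrable_compact) (auto intro!: continuous_intros)
  have "(LINT s:{0..t}|lborel. S s (F s) x) \<le> (LINT s:{0..t}|lborel. c * ((- (2 * K)) * exp (- (2 * K) * s)))"
    unfolding set_lebesgue_integral_def
  \<comment> \<open>F need not be measurable: a Bochner integral that fails to exist is 0 by
    convention, and the majorant is nonnegative.\<close>
  proof (rule integral_mono')
    show "integrable lborel (\<lambda>s. indicator {0..t} s *\<^sub>R (c * ((- (2 * K)) * exp (- (2 * K) * s))))"
      using int by (simp add: set_integrable_def)
    show "indicator {0..t} s *\<^sub>R S s (F s) x \<le> indicator {0..t} s *\<^sub>R (c * ((- (2 * K)) * exp (- (2 * K) * s)))" for s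
      unfolding eq using F K M by (auto split: split_indicator intro!: S_le)
    show "0 \<le> indicator {0..t} s *\<^sub>R (c * ((- (2 * K)) * exp (- (2 * K) * s)))" for s
      unfolding eq using K M by (auto split: split_indicator)
  qed
  also have "\<dots> = c * (exp (- (2 * K) * t) - 1)"
    using set_integral_exp[OF t, of "- (2 * K)"] by (simp only: set_integral_mult_right) simp
  also have "\<dots> = M * (exp (2 * K * t) / 2) - M / 2"
  proof -
    have "- (M * E / 2) * (E' - 1) = M * (E / 2) - M * (E * E') / 2" for E E' :: real
      by (simp add: field_simps)
    moreover have "exp (2 * K * t) * exp (- (2 * K) * t) = 1" by (simp add: exp_add[symmetric])
    ultimately show ?thesis unfolding c_def by (simp only: mult_1_right)
  qed
  finally show ?thesis using M by simp
qed

end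

section \<open>Rescaled log-Laplace functionals\<close>

context superprocess
begin

lemma V_log_laplace:
  assumes f: "f \<in> bounded_borel_nonneg"
  shows "(\<lambda>(s, x). V (max 0 s) f x) \<in> borel_measurable (borel \<Otimes>\<^sub>M borel)"
    and "0 \<le> t \<Longrightarrow> 0 \<le> V t f x"
    and "0 \<le> T \<Longrightarrow> \<exists>C. \<forall>t\<in>{0..T}. \<forall>x. \<bar>V t f x\<bar> \<le> C"
    and "0 \<le> t \<Longrightarrow> V t f x = S t f x
        - (\<integral>\<omega>. (LINT s:{0..t}|lborel. extend_zero (\<lambda>y. \<psi> y (V (t - s) f)) (\<xi> (ennreal s) \<omega>)) \<partial>Pr (Some x))"
proof -
  note V = V_solution[OF f, unfolded log_laplace_solution_def]
  \<comment> \<open>The log-Laplace equation says nothing about V at negative times, so these are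
    mapped to time 0.\<close>
  have "(\<lambda>(s, x). (x, max 0 s)) \<in> borel \<Otimes>\<^sub>M borel \<rightarrow>\<^sub>M borel \<Otimes>\<^sub>M restrict_space borel {0 :: real..}"
    unfolding case_prod_beta by (intro measurable_Pair measurable_restrict_space2) auto
  from measurable_compose[OF this V[THEN conjunct1]]
  show "(\<lambda>(s, x). V (max 0 s) f x) \<in> borel_measurable (borel \<Otimes>\<^sub>M borel)"
    by (simp add: case_prod_beta)
qed (use V_solution[OF f, unfolded log_laplace_solution_def] in auto)

lemma measurable_V [measurable]:
  assumes "f \<in> bounded_borel_nonneg" "0 \<le> t"
  shows "V t f \<in> borel_measurable borel"
  using measurable_section[OF V_log_laplace(1)[OF assms(1)], of t] assms(2) by simp

lemma scaled_bounded_borel_nonneg: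
  assumes "f \<in> bounded_borel_nonneg" and N: "1 \<le> N"
  shows "(\<lambda>x. f x / N) \<in> bounded_borel_nonneg"
proof -
  have f: "f \<in> bounded_borel" "\<And>x. 0 \<le> f x" using assms by (auto simp: bounded_borel_nonneg_def)
  obtain C where C: "0 < C" "\<And>x. \<bar>f x\<bar> \<le> C" using f(1) by (metis bounded_borelE)
  have [measurable]: "f \<in> borel_measurable borel" using f(1) by measurable
  have "(\<lambda>x. f x / N) \<in> bounded_borel"
    by (rule bounded_borelI[where C = "C / N"]) (use C N in \<open>auto simp: divide_right_mono\<close>)
  then show ?thesis using f N by (simp add: bounded_borel_nonneg_def)
qed

text \<open>The difference quotient at 0 of \<open>\<epsilon> \<mapsto> V_t(\<epsilon> f)\<close>
  with \<open>\<epsilon> = 1 / N\<close>; its limit is the first moment.\<close>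

definition rescaled :: "('a \<Rightarrow> real) \<Rightarrow> real \<Rightarrow> real \<Rightarrow> 'a \<Rightarrow> real" where
  "rescaled f N t x = N * V t (\<lambda>y. f y / N) x"

lemma rescaled_nonneg: "f \<in> bounded_borel_nonneg \<Longrightarrow> 1 \<le> N \<Longrightarrow> 0 \<le> t \<Longrightarrow> 0 \<le> rescaled f N t x"
  unfolding rescaled_def using V_log_laplace(2)[OF scaled_bounded_borel_nonneg] by simp

lemma measurable_rescaled:
  assumes "f \<in> bounded_borel_nonneg" "1 \<le> N"
  shows "(\<lambda>(s, y). rescaled f N (max 0 s) y) \<in> borel_measurable (borel \<Otimes>\<^sub>M borel)"
  using V_log_laplace(1)[OF scaled_bounded_borel_nonneg[OF assms]] by (simp add: rescaled_def case_prod_beta)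

lemma measurable_rescaled_branching:
  assumes f: "f \<in> bounded_borel_nonneg" "1 \<le> N"
  shows "(\<lambda>(s, y). N * \<psi> y (\<lambda>z. rescaled f N (max 0 (t - s)) z / N)) \<in> borel_measurable (borel \<Otimes>\<^sub>M borel)"
proof -
  note [measurable] = measurable_rescaled[OF f]
  have "(\<lambda>(p, z). (t - fst p, z)) \<in> (borel \<Otimes>\<^sub>M borel) \<Otimes>\<^sub>M borel \<rightarrow>\<^sub>M borel \<Otimes>\<^sub>M borel"
    by measurable
  from measurable_compose[OF this measurable_rescaled[OF f]]
  have [measurable]: "(\<lambda>p. rescaled f N (max 0 (t - fst (fst p))) (snd p)) \<in> borel_measurable ((borel \<Otimes>\<^sub>M borel) \<Otimes>\<^sub>M borel)"
    by (simp add: case_prod_beta)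
  have "(\<lambda>p. \<psi> (snd p) (\<lambda>z. rescaled f N (max 0 (t - fst p)) z / N)) \<in> borel_measurable (borel \<Otimes>\<^sub>M borel)"
    by (rule measurable_branching) (simp_all add: case_prod_beta)
  then show ?thesis by (simp add: case_prod_beta)
qed

lemma rescaled_locally_bounded:
  assumes f: "f \<in> bounded_borel_nonneg" and N: "1 \<le> N" and t: "0 \<le> t"
  obtains C where "\<And>s x. 0 \<le> s \<Longrightarrow> s \<le> t \<Longrightarrow> rescaled f N s x \<le> C"
proof -
  obtain C where "\<forall>s\<in>{0..t}. \<forall>x. \<bar>V s (\<lambda>y. f y / N) x\<bar> \<le> C"
    using V_log_laplace(3)[OF scaled_bounded_borel_nonneg[OF f N] t] by blast
  then have "rescaled f N s x \<le> N * C" if "0 \<le> s" "s \<le> t" for s x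
    unfolding rescaled_def using that N by (intro mult_left_mono) (auto simp: abs_le_iff)
  then show ?thesis by (rule that)
qed

text \<open>The log-Laplace equation for f/N multiplied by N. The semigroup term is linear and loses
  N altogether; only the branching term still depends on it.\<close>

lemma rescaled_mild:
  assumes f: "f \<in> bounded_borel_nonneg" and N: "1 \<le> N" and t: "0 \<le> t"
  shows "rescaled f N t x = S t f x
    - (LINT s:{0..t}|lborel. S s (\<lambda>y. N * \<psi> y (\<lambda>z. rescaled f N (max 0 (t - s)) z / N)) x)"
proof -
  let ?V = "\<lambda>s. V s (\<lambda>y. f y / N)"
  let ?F = "\<lambda>s y. N * \<psi> y (\<lambda>z. rescaled f N (max 0 (t - s)) z / N)"
  obtain C where C: "\<And>s x. 0 \<le> s \<Longrightarrow> s \<le> t \<Longrightarrow> rescaled f N s x \<le> C"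
    using rescaled_locally_bounded[OF f N t] by blast
  obtain D where D: "\<And>x g N. (\<And>y. 0 \<le> g y) \<Longrightarrow> (\<And>y. g y \<le> C) \<Longrightarrow> 1 \<le> N \<Longrightarrow> \<bar>N * \<psi> x (\<lambda>y. g y / N)\<bar> \<le> D"
    using scaled_branching_bounded by blast
  have "(\<integral>\<omega>. (LINT s:{0..t}|lborel. extend_zero (\<lambda>y. \<psi> y (?V (t - s))) (\<xi> (ennreal s) \<omega>)) \<partial>Pr (Some x))
     = (\<integral>\<omega>. (LINT s:{0..t}|lborel. (1 / N) * extend_zero (?F s) (\<xi> (ennreal s) \<omega>)) \<partial>Pr (Some x))"
  proof (intro Bochner_Integration.integral_cong refl set_lebesgue_integral_cong allI impI)
    fix \<omega> s assume s: "s \<in> {0..t}"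
    have "(\<lambda>z. rescaled f N (max 0 (t - s)) z / N) = ?V (t - s)"
      using s N by (auto simp: rescaled_def fun_eq_iff)
    then show "extend_zero (\<lambda>y. \<psi> y (?V (t - s))) (\<xi> (ennreal s) \<omega>) = (1 / N) * extend_zero (?F s) (\<xi> (ennreal s) \<omega>)"
      using N by (cases "\<xi> (ennreal s) \<omega>") auto
  qed simp
  also have "\<dots> = (1 / N) * (\<integral>\<omega>. (LINT s:{0..t}|lborel. extend_zero (?F s) (\<xi> (ennreal s) \<omega>)) \<partial>Pr (Some x))"
    by simp
  also have "(\<integral>\<omega>. (LINT s:{0..t}|lborel. extend_zero (?F s) (\<xi> (ennreal s) \<omega>)) \<partial>Pr (Some x))
     = (LINT s:{0..t}|lborel. S s (?F s) x)"
    by (rule path_integral[OF measurable_rescaled_branching[OF f N], where C = D])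
       (rule D, use rescaled_nonneg[OF f N] C N in auto)
  finally have "V t (\<lambda>y. f y / N) x = S t (\<lambda>y. (1 / N) * f y) x - (1 / N) * (LINT s:{0..t}|lborel. S s (?F s) x)"
    using V_log_laplace(4)[OF scaled_bounded_borel_nonneg[OF f N] t, of x] by simp
  then show ?thesis
    unfolding rescaled_def[of f N t] S_cmult using N by (simp add: right_diff_distrib)
qed

text \<open>Local boundedness of V supplies an a priori constant that may depend on N. The Gronwall
  iteration forgets this constant and leaves a bound uniform in N.\<close>

lemma rescaled_le:
  assumes f: "f \<in> bounded_borel_nonneg" "\<And>x. f x \<le> B" and N: "1 \<le> N" and t: "0 \<le> t"
    and K: "0 < K" "\<And>x. \<bar>a x\<bar> + mean_offspring x \<le> K"
  shows "rescaled f N t x \<le> 2 * B * exp (2 * K * t)"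
proof -
  have f0: "0 \<le> f x" for x using f by (auto simp: bounded_borel_nonneg_def)
  have B: "0 \<le> B" using f0[of x] f(2)[of x] by simp
  obtain C where C: "\<And>s x. 0 \<le> s \<Longrightarrow> s \<le> t \<Longrightarrow> rescaled f N s x \<le> C"
    using rescaled_locally_bounded[OF f(1) N t] by blast
  show ?thesis
  proof (rule gronwall[where D = "rescaled f N" and T = t and C = C])
    fix u x M assume u: "0 \<le> u" "u \<le> t" and M: "0 \<le> M"
      and le: "\<And>s y. 0 \<le> s \<Longrightarrow> s \<le> u \<Longrightarrow> rescaled f N s y \<le> M * exp (2 * K * s)"
    have "rescaled f N u x = S u f x + (LINT s:{0..u}|lborel. (-1) * S s (\<lambda>y. N * \<psi> y (\<lambda>z. rescaled f N (max 0 (u - s)) z / N)) x)"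
      unfolding rescaled_mild[OF f(1) N u(1)] set_integral_mult_right by simp
    also have "(LINT s:{0..u}|lborel. (-1) * S s (\<lambda>y. N * \<psi> y (\<lambda>z. rescaled f N (max 0 (u - s)) z / N)) x)
      = (LINT s:{0..u}|lborel. S s (\<lambda>y. (-1) * (N * \<psi> y (\<lambda>z. rescaled f N (max 0 (u - s)) z / N))) x)"
      unfolding S_cmult ..
    also have "\<dots> \<le> M * (exp (2 * K * u) / 2)"
    proof (rule gronwall_integral_le[OF u(1) K(1) M])
      fix s y assume s: "s \<in> {0..u}"
      let ?g = "\<lambda>z. rescaled f N (max 0 (u - s)) z / N"
      \<comment> \<open>The lower bound is homogeneous in the size of the function, so the factor N
        cancels and K is independent of N.\<close>
      have "- \<psi> y ?g \<le> K * (M * exp (2 * K * (u - s)) / N)"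
      proof (rule branching_lower_bound[OF _ _ K(2)])
        show "0 \<le> ?g z" for z using rescaled_nonneg[OF f(1) N] N by simp
        show "?g z \<le> M * exp (2 * K * (u - s)) / N" for z
          using le[of "u - s" z] s N by (simp add: divide_right_mono)
      qed
      then have "N * (- \<psi> y ?g) \<le> N * (K * (M * exp (2 * K * (u - s)) / N))"
        using N by (intro mult_left_mono) auto
      then show "(-1) * (N * \<psi> y ?g) \<le> K * (M * exp (2 * K * (u - s)))"
        using N by simp
    qed
    finally show "rescaled f N u x \<le> B + M * (exp (2 * K * u) / 2)"
      using S_le[of f B u x, OF f(2) B] by simp
  qed (use K B C t in auto)
qed

lemma P_prob_space:
  assumes "\<mu> \<in> finite_borel_measures"
  shows "prob_space (P \<mu>)" "sets (P \<mu>) = sets path_sigma" "space (P \<mu>) = path_space"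
  using measurable_space[OF path_laws, of \<mu>] assms
  by (auto simp: space_prob_algebra dest: sets_eq_imp_space_eq)

lemma return_finite_borel: "return borel x \<in> finite_borel_measures"
  using prob_space_return[of x borel] by (auto simp: finite_borel_measures_def prob_space_def)

lemma measurable_coordinate_integral:
  assumes f: "f \<in> bounded_continuous" and \<mu>: "\<mu> \<in> finite_borel_measures" and t: "0 \<le> t"
  shows "(\<lambda>w. \<integral>x. f x \<partial>w t) \<in> borel_measurable (P \<mu>)"
  using measurable_compose[OF measurable_path_sigma[OF t] measurable_weak_borel_integral[OF f]]
  by (simp add: measurable_cong_sets[OF P_prob_space(2)[OF \<mu>] refl])

section \<open>The mean of the superprocess\<close>

context
  fixes f :: "'a \<Rightarrow> real"
  assumes f: "f \<in> bounded_continuous" "\<And>x. 0 \<le> f x"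
begin

lemma f_nonneg: "f \<in> bounded_borel_nonneg"
  using f bounded_continuous_bounded_borel[OF f(1)] by (simp add: bounded_borel_nonneg_def)

lemma rescaled_bounded:
  assumes "0 \<le> t"
  obtains M where "0 \<le> M" "\<And>n s x. 0 \<le> s \<Longrightarrow> s \<le> t \<Longrightarrow> rescaled f (real (Suc n)) s x \<le> M"
proof -
  obtain B where B: "0 < B" "\<And>x. \<bar>f x\<bar> \<le> B"
    using f_nonneg by (auto simp: bounded_borel_nonneg_def elim: bounded_borelE)
  obtain K where K: "0 < K" "\<And>x. \<bar>a x\<bar> + mean_offspring x \<le> K" by (metis rates_bounded)
  have "rescaled f (real (Suc n)) s x \<le> 2 * B * exp (2 * K * t)" if "0 \<le> s" "s \<le> t" for n s x
  proof -
    have "rescaled f (real (Suc n)) s x \<le> 2 * B * exp (2 * K * s)"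
      by (rule rescaled_le[OF f_nonneg _ _ that(1) K]) (use B in \<open>auto simp: abs_le_iff\<close>)
    also have "\<dots> \<le> 2 * B * exp (2 * K * t)"
      using that K B by (intro mult_left_mono) auto
    finally show ?thesis .
  qed
  then show ?thesis using that[of "2 * B * exp (2 * K * t)"] B by auto
qed

text \<open>With \<open>q n = N (1 - exp (- Z / N))\<close>, the Laplace functional gives the
  expectation \<open>N (1 - exp (- y n / N))\<close>, which is at most \<open>y n\<close>, and
  \<open>y n\<close> is bounded. Fatou's lemma makes Z integrable; then \<open>q n \<le> Z\<close>
  dominates and the expectations converge. They differ from \<open>y n\<close> by a quantity of
  order 1/N, so convergence of \<open>y n\<close> is a conclusion and not presupposed.\<close>

lemma
  assumes \<mu>: "\<mu> \<in> finite_borel_measures" and t: "0 \<le> t"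
  shows integrable_first_moment: "integrable (P \<mu>) (\<lambda>w. \<integral>x. f x \<partial>w t)"
    and first_moment_tendsto:
      "(\<lambda>n. \<integral>x. rescaled f (real (Suc n)) t x \<partial>\<mu>) \<longlonglongrightarrow> (\<integral>w. (\<integral>x. f x \<partial>w t) \<partial>P \<mu>)"
proof -
  interpret P: prob_space "P \<mu>" by (rule P_prob_space[OF \<mu>])
  interpret \<mu>: finite_measure \<mu> using \<mu> by (simp add: finite_borel_measures_def)
  have sets_\<mu> [measurable_cong]: "sets \<mu> = sets borel" using \<mu> by (simp add: finite_borel_measures_def)
  let ?N = "\<lambda>n. real (Suc n)"
  define Z where "Z w = (\<integral>x. f x \<partial>w t)" for w :: "real \<Rightarrow> 'a measure"
  have Z_meas [measurable]: "Z \<in> borel_measurable (P \<mu>)"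
    unfolding Z_def[abs_def] by (rule measurable_coordinate_integral[OF f(1) \<mu> t])
  have Z0: "0 \<le> Z w" for w unfolding Z_def by (intro Bochner_Integration.integral_nonneg f)
  obtain M where M: "0 \<le> M" "\<And>n s x. 0 \<le> s \<Longrightarrow> s \<le> t \<Longrightarrow> rescaled f (?N n) s x \<le> M"
    using rescaled_bounded[OF t] by blast
  have N: "1 \<le> ?N n" for n by simp
  have u0: "0 \<le> rescaled f (?N n) t x" for n x by (rule rescaled_nonneg[OF f_nonneg N t])
  have u_meas [measurable]: "rescaled f (?N n) t \<in> borel_measurable borel" for n
    unfolding rescaled_def[abs_def] using scaled_bounded_borel_nonneg[OF f_nonneg N] t by measurable
  define y where "y n = (\<integral>x. rescaled f (?N n) t x \<partial>\<mu>)" for n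
  have y0: "0 \<le> y n" for n unfolding y_def by (intro Bochner_Integration.integral_nonneg u0)
  define Y where "Y = (\<integral>x. M \<partial>\<mu>)"
  have yY: "y n \<le> Y" for n unfolding y_def Y_def
    by (rule integral_mono') (use M t in auto)
  define q where "q n w = ?N n * (1 - exp (- (Z w / ?N n)))" for n w
  have q_meas [measurable]: "q n \<in> borel_measurable (P \<mu>)" for n unfolding q_def[abs_def] by measurable
  \<comment> \<open>The nonlocal jump bounds with jump size 1 and \<open>r = Z w\<close>.\<close>
  have q_bounds: "0 \<le> q n w" "q n w \<le> Z w" "Z w - (Z w)\<^sup>2 / ?N n \<le> q n w" for n w
    using nonlocal_jump_bounds[of "Z w" "?N n" 1] Z0[of w] by (simp_all add: q_def)
  have inv: "(\<lambda>n. z / ?N n) \<longlonglongrightarrow> 0" for z :: real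
    using LIMSEQ_Suc[OF lim_const_over_n[of z]] by simp
  have q_lim: "(\<lambda>n. q n w) \<longlonglongrightarrow> Z w" for w
  proof (rule tendsto_sandwich[where h = "\<lambda>_. Z w"])
    show "(\<lambda>n. Z w - (Z w)\<^sup>2 / ?N n) \<longlonglongrightarrow> Z w"
      using tendsto_diff[OF tendsto_const inv[of "(Z w)\<^sup>2"], of "Z w"] by simp
  qed (use q_bounds in \<open>auto intro!: always_eventually\<close>)
  have int_q: "integrable (P \<mu>) (q n)" for n
    by (rule P.integrable_const_bound[where B = "?N n"]) (auto simp: q_def abs_mult Z0)
  have q_int: "(\<integral>w. q n w \<partial>P \<mu>) = ?N n * (1 - exp (- (y n / ?N n)))" for n
  proof -
    have "(\<integral>w. exp (- (Z w / ?N n)) \<partial>P \<mu>) = exp (- (y n / ?N n))"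
      using Laplace[OF \<mu> scaled_bounded_borel_nonneg[OF f_nonneg N[of n]] t]
      by (simp add: Z_def y_def rescaled_def)
    moreover have "integrable (P \<mu>) (\<lambda>w. exp (- (Z w / ?N n)))"
      by (rule P.integrable_const_bound[where B = 1]) (auto simp: Z0)
    ultimately show ?thesis unfolding q_def by (simp add: P.prob_space)
  qed
  have q_y: "0 \<le> (\<integral>w. q n w \<partial>P \<mu>)" "(\<integral>w. q n w \<partial>P \<mu>) \<le> y n" "y n - (y n)\<^sup>2 / ?N n \<le> (\<integral>w. q n w \<partial>P \<mu>)" for n
    unfolding q_int using nonlocal_jump_bounds[of "y n" "?N n" 1] y0[of n] by simp_all
  have "(\<integral>\<^sup>+w. ennreal (Z w) \<partial>P \<mu>) = (\<integral>\<^sup>+w. liminf (\<lambda>n. ennreal (q n w)) \<partial>P \<mu>)"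
    by (intro nn_integral_cong lim_imp_Liminf[symmetric] tendsto_ennrealI q_lim) simp
  also have "\<dots> \<le> liminf (\<lambda>n. \<integral>\<^sup>+w. ennreal (q n w) \<partial>P \<mu>)"
    by (rule nn_integral_liminf) measurable
  also have "\<dots> \<le> liminf (\<lambda>n :: nat. ennreal Y)"
  proof (rule Liminf_mono, rule always_eventually, rule allI)
    fix n
    have "(\<integral>\<^sup>+w. ennreal (q n w) \<partial>P \<mu>) = ennreal (\<integral>w. q n w \<partial>P \<mu>)"
      by (rule nn_integral_eq_integral[OF int_q]) (use q_bounds in auto)
    also have "\<dots> \<le> ennreal Y" using q_y(2)[of n] yY[of n] by (intro ennreal_leI) simp
    finally show "(\<integral>\<^sup>+w. ennreal (q n w) \<partial>P \<mu>) \<le> ennreal Y" .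
  qed
  also have "\<dots> = ennreal Y" by (simp add: Liminf_const)
  finally have "(\<integral>\<^sup>+w. ennreal (Z w) \<partial>P \<mu>) \<le> ennreal Y" .
  then have int_Z: "integrable (P \<mu>) Z"
    by (intro integrableI_nonneg) (auto simp: Z0 intro: order_le_less_trans)
  then show "integrable (P \<mu>) (\<lambda>w. \<integral>x. f x \<partial>w t)" by (simp add: Z_def[abs_def])
  have Eq: "(\<lambda>n. \<integral>w. q n w \<partial>P \<mu>) \<longlonglongrightarrow> (\<integral>w. Z w \<partial>P \<mu>)"
    by (rule integral_dominated_convergence[OF _ _ int_Z]) (use q_lim q_bounds in auto)
  have diff: "(\<lambda>n. y n - (\<integral>w. q n w \<partial>P \<mu>)) \<longlonglongrightarrow> 0"
  proof (rule Lim_null_comparison[OF always_eventually inv[of "Y\<^sup>2"]], rule allI)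
    fix n
    have "(y n)\<^sup>2 / ?N n \<le> Y\<^sup>2 / ?N n" using y0[of n] yY[of n] by (intro divide_right_mono power_mono) auto
    then show "norm (y n - (\<integral>w. q n w \<partial>P \<mu>)) \<le> Y\<^sup>2 / ?N n" using q_y[of n] by simp
  qed
  from tendsto_add[OF diff Eq] have "y \<longlonglongrightarrow> (\<integral>w. Z w \<partial>P \<mu>)" by simp
  then show "(\<lambda>n. \<integral>x. rescaled f (?N n) t x \<partial>\<mu>) \<longlonglongrightarrow> (\<integral>w. (\<integral>x. f x \<partial>w t) \<partial>P \<mu>)"
    unfolding y_def[abs_def] Z_def .
qed

definition mean :: "real \<Rightarrow> 'a \<Rightarrow> real" where
  "mean t x = (\<integral>w. (\<integral>y. f y \<partial>w t) \<partial>P (return borel x))"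

lemma rescaled_tendsto_mean:
  assumes t: "0 \<le> t"
  shows "(\<lambda>n. rescaled f (real (Suc n)) t x) \<longlonglongrightarrow> mean t x"
proof -
  have "(\<integral>y. rescaled f (real (Suc n)) t y \<partial>return borel x) = rescaled f (real (Suc n)) t x" for n
  proof (rule integral_return)
    show "rescaled f (real (Suc n)) t \<in> borel_measurable borel"
      using measurable_V[OF scaled_bounded_borel_nonneg[OF f_nonneg, of "real (Suc n)"] t]
      unfolding rescaled_def[abs_def] by simp
  qed simp
  with first_moment_tendsto[OF return_finite_borel t, of x] show ?thesis by (simp add: mean_def)
qed

text \<open>Joint measurability in time and space is inherited from V through the limit, without
  recourse to the measurability of the laws in the starting point.\<close>

lemma measurable_mean: "(\<lambda>(s, y). mean (max 0 s) y) \<in> borel_measurable (borel \<Otimes>\<^sub>M borel)"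
proof (rule borel_measurable_LIMSEQ_real)
  show "(\<lambda>p. case p of (s, y) \<Rightarrow> rescaled f (real (Suc n)) (max 0 s) y) \<in> borel_measurable (borel \<Otimes>\<^sub>M borel)" for n
    using measurable_rescaled[OF f_nonneg, of "real (Suc n)"] by simp
qed (auto intro: rescaled_tendsto_mean simp del: of_nat_Suc)

lemma mean_bounded:
  assumes t: "0 \<le> t"
  obtains M where "0 \<le> M" "\<And>s x. 0 \<le> s \<Longrightarrow> s \<le> t \<Longrightarrow> 0 \<le> mean s x \<and> mean s x \<le> M"
proof -
  obtain M where M: "0 \<le> M" "\<And>n s x. 0 \<le> s \<Longrightarrow> s \<le> t \<Longrightarrow> rescaled f (real (Suc n)) s x \<le> M"
    using rescaled_bounded[OF t] by blast
  have "0 \<le> mean s x \<and> mean s x \<le> M" if "0 \<le> s" "s \<le> t" for s x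
  proof
    show "0 \<le> mean s x"
      by (rule LIMSEQ_le_const[OF rescaled_tendsto_mean[OF that(1)]])
         (use rescaled_nonneg[OF f_nonneg _ that(1)] in auto)
    show "mean s x \<le> M"
      by (rule LIMSEQ_le_const2[OF rescaled_tendsto_mean[OF that(1)]]) (use M(2)[OF that] in blast)
  qed
  with M(1) show ?thesis by (rule that)
qed

text \<open>The limit passes through three layers: the branching term at a point, the semigroup at a
  fixed time, and the time integral. The constant D is a majorant for the last two.\<close>

lemma mean_mild:
  assumes t: "0 \<le> t"
  shows "mean t x = S t f x - (LINT s:{0..t}|lborel. S s (\<lambda>y. linear_part y (mean (max 0 (t - s)))) x)"
proof -
  let ?N = "\<lambda>n. real (Suc n)"
  have N: "1 \<le> ?N n" for n by simp
  let ?F = "\<lambda>n s y. ?N n * \<psi> y (\<lambda>z. rescaled f (?N n) (max 0 (t - s)) z / ?N n)"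
  obtain M where M: "0 \<le> M" "\<And>n s x. 0 \<le> s \<Longrightarrow> s \<le> t \<Longrightarrow> rescaled f (?N n) s x \<le> M"
    using rescaled_bounded[OF t] by blast
  obtain D where D: "\<And>x g N. (\<And>y. 0 \<le> g y) \<Longrightarrow> (\<And>y. g y \<le> M) \<Longrightarrow> 1 \<le> N \<Longrightarrow> \<bar>N * \<psi> x (\<lambda>y. g y / N)\<bar> \<le> D"
    using scaled_branching_bounded by blast
  have F_meas: "(\<lambda>(s, y). ?F n s y) \<in> borel_measurable (borel \<Otimes>\<^sub>M borel)" for n
    by (rule measurable_rescaled_branching[OF f_nonneg N])
  have F_bound: "\<bar>?F n s y\<bar> \<le> D" if "s \<in> {0..t}" for n s y
    by (rule D) (use that M rescaled_nonneg[OF f_nonneg N] in auto)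
  note lin_meas = measurable_linear_part_reversed[OF measurable_mean, of t]
  note slice = measurable_section
  have "(\<lambda>n. LINT s:{0..t}|lborel. S s (?F n s) x) \<longlonglongrightarrow> (LINT s:{0..t}|lborel. S s (\<lambda>y. linear_part y (mean (max 0 (t - s)))) x)"
  proof (rule set_lborel_dominated_convergence)
    show "(\<lambda>s. S s (?F n s) x) \<in> borel_measurable borel" for n
      by (rule measurable_S[OF F_meas]) measurable
    show "(\<lambda>s. S s (\<lambda>y. linear_part y (mean (max 0 (t - s)))) x) \<in> borel_measurable borel"
      by (rule measurable_S[OF lin_meas]) measurable
    fix s assume s: "s \<in> {0..t}"
    show "\<bar>S s (?F n s) x\<bar> \<le> D" for n by (rule abs_S_le[OF F_bound[OF s]])
    show "(\<lambda>n. S s (?F n s) x) \<longlonglongrightarrow> S s (\<lambda>y. linear_part y (mean (max 0 (t - s)))) x"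
    proof (rule S_dominated_convergence[OF slice[OF F_meas] slice[OF lin_meas]])
      show "(\<lambda>n. ?F n s y) \<longlonglongrightarrow> linear_part y (mean (max 0 (t - s)))" for y
        by (rule scaled_branching_tendsto[where M = M])
           (use s M slice[OF measurable_rescaled[OF f_nonneg N], where s = "t - s"] slice[OF measurable_mean, where s = "t - s"]
             rescaled_nonneg[OF f_nonneg N] rescaled_tendsto_mean in \<open>auto simp del: of_nat_Suc\<close>)
    qed (rule F_bound[OF s])
  qed
  then have "(\<lambda>n. rescaled f (?N n) t x) \<longlonglongrightarrow> S t f x - (LINT s:{0..t}|lborel. S s (\<lambda>y. linear_part y (mean (max 0 (t - s)))) x)"
    unfolding rescaled_mild[OF f_nonneg N t] by (intro tendsto_intros)
  with rescaled_tendsto_mean[OF t] show ?thesis by (rule LIMSEQ_unique)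
qed

text \<open>Uniqueness for the linear equation: the difference of two solutions obeys the Gronwall
  step with \<open>B = 0\<close>, so it vanishes as soon as it is locally bounded.\<close>

lemma mean_eq:
  assumes H_meas: "(\<lambda>(s, y). H (max 0 s) y) \<in> borel_measurable (borel \<Otimes>\<^sub>M borel)"
    and H_bounded: "\<And>t. 0 \<le> t \<Longrightarrow> \<exists>C. \<forall>s\<in>{0..t}. \<forall>y. \<bar>H s y\<bar> \<le> C"
    and H_mild: "\<And>t x. 0 \<le> t \<Longrightarrow> H t x = S t f x - (LINT s:{0..t}|lborel. S s (\<lambda>y. linear_part y (H (max 0 (t - s)))) x)"
    and t: "0 \<le> t"
  shows "mean t x = H t x"
proof -
  obtain K where K: "0 < K" "\<And>x. \<bar>a x\<bar> + mean_offspring x \<le> K" by (metis rates_bounded)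
  obtain M where M: "0 \<le> M" "\<And>s x. 0 \<le> s \<Longrightarrow> s \<le> t \<Longrightarrow> 0 \<le> mean s x \<and> mean s x \<le> M"
    using mean_bounded[OF t] by blast
  obtain C where "\<forall>s\<in>{0..t}. \<forall>y. \<bar>H s y\<bar> \<le> C" using H_bounded[OF t] by blast
  then have C: "\<bar>H s y\<bar> \<le> C" if "0 \<le> s" "s \<le> t" for s y using that by simp
  note slice = measurable_section and lin_meas = measurable_linear_part_reversed
  have "\<bar>mean t x - H t x\<bar> \<le> 2 * 0 * exp (2 * K * t)"
  proof (rule gronwall[where D = "\<lambda>s y. \<bar>mean s y - H s y\<bar>" and T = t and C = "M + C"])
    show "\<bar>mean s y - H s y\<bar> \<le> M + C" if "0 \<le> s" "s \<le> t" for s y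
      using M(2)[OF that, of y] C[OF that, of y] by linarith
    fix u x L assume u: "0 \<le> u" "u \<le> t" and L: "0 \<le> L"
      and le: "\<And>s y. 0 \<le> s \<Longrightarrow> s \<le> u \<Longrightarrow> \<bar>mean s y - H s y\<bar> \<le> L * exp (2 * K * s)"
    let ?A = "\<lambda>s y. linear_part y (mean (max 0 (u - s)))" and ?B = "\<lambda>s y. linear_part y (H (max 0 (u - s)))"
    have bA: "\<bar>?A s y\<bar> \<le> K * M" and bB: "\<bar>?B s y\<bar> \<le> K * C" if "s \<in> {0..u}" for s y
      using that u M C by (auto intro!: linear_part_le[OF _ K(2)])
    have A: "?A s \<in> bounded_borel" and B: "?B s \<in> bounded_borel" if "s \<in> {0..u}" for s
      by (rule bounded_borelI[OF slice[OF lin_meas[OF measurable_mean]] bA[OF that]]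
          bounded_borelI[OF slice[OF lin_meas[OF H_meas]] bB[OF that]])+
    have int: "set_integrable lborel {0..u} (\<lambda>s. S s (?A s) x)"
    proof (rule set_integrable_Icc_bounded)
      show "(\<lambda>s. S s (?A s) x) \<in> borel_measurable borel"
        by (rule measurable_S[OF lin_meas[OF measurable_mean]]) measurable
      show "\<bar>S s (?A s) x\<bar> \<le> K * M" if "s \<in> {0..u}" for s
        by (rule abs_S_le) (rule bA[OF that])
    qed
    have int': "set_integrable lborel {0..u} (\<lambda>s. S s (?B s) x)"
    proof (rule set_integrable_Icc_bounded)
      show "(\<lambda>s. S s (?B s) x) \<in> borel_measurable borel"
        by (rule measurable_S[OF lin_meas[OF H_meas]]) measurable
      show "\<bar>S s (?B s) x\<bar> \<le> K * C" if "s \<in> {0..u}" for s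
        by (rule abs_S_le) (rule bB[OF that])
    qed
    have diff: "mean u x - H u x = (LINT s:{0..u}|lborel. S s (\<lambda>y. ?B s y - ?A s y) x)"
    proof -
      have "mean u x - H u x = (LINT s:{0..u}|lborel. S s (?B s) x) - (LINT s:{0..u}|lborel. S s (?A s) x)"
        using mean_mild[OF u(1), of x] H_mild[OF u(1), of x] by simp
      also have "\<dots> = (LINT s:{0..u}|lborel. S s (?B s) x - S s (?A s) x)"
        using int int' by (simp add: set_integral_diff)
      also have "\<dots> = (LINT s:{0..u}|lborel. S s (\<lambda>y. ?B s y - ?A s y) x)"
        by (intro set_lebesgue_integral_cong allI impI S_diff[OF B A, symmetric]) auto
      finally show ?thesis .
    qed
    have lin_diff: "?B s y - ?A s y = linear_part y (\<lambda>z. H (u - s) z - mean (u - s) z)" if s: "s \<in> {0..u}" for s y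
    proof -
      interpret prob_space "\<pi> y" by (rule prob_space_\<pi>)
      have [measurable]: "H (u - s) \<in> borel_measurable borel" "mean (u - s) \<in> borel_measurable borel"
        using slice[OF H_meas, of "u - s"] slice[OF measurable_mean, of "u - s"] s by auto
      have "integrable (\<pi> y) (H (u - s))"
        by (rule integrable_const_bound[where B = C]) (use C s u in auto)
      moreover have "integrable (\<pi> y) (mean (u - s))"
        by (rule integrable_const_bound[where B = M]) (use M s u in auto)
      ultimately show ?thesis using s by (simp add: linear_part_def algebra_simps)
    qed
    have bound: "\<bar>?B s y - ?A s y\<bar> \<le> K * (L * exp (2 * K * (u - s)))" if s: "s \<in> {0..u}" for s y
      unfolding lin_diff[OF s]
      by (rule linear_part_le[OF _ K(2)]) (use le s in \<open>auto simp: abs_minus_commute\<close>)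
    have "(LINT s:{0..u}|lborel. S s (\<lambda>y. ?B s y - ?A s y) x) \<le> L * (exp (2 * K * u) / 2)"
      by (rule gronwall_integral_le[OF u(1) K(1) L]) (use bound abs_le_D1 in blast)
    \<comment> \<open>\<open>gronwall_integral_le\<close> is one-sided, so the absolute value takes
      a second application to the negated integrand.\<close>
    moreover have "- (LINT s:{0..u}|lborel. S s (\<lambda>y. ?B s y - ?A s y) x) \<le> L * (exp (2 * K * u) / 2)"
    proof -
      have "- (LINT s:{0..u}|lborel. S s (\<lambda>y. ?B s y - ?A s y) x) = (LINT s:{0..u}|lborel. S s (\<lambda>y. (-1) * (?B s y - ?A s y)) x)"
        unfolding S_cmult set_integral_mult_right by simp
      also have "\<dots> \<le> L * (exp (2 * K * u) / 2)"
        by (rule gronwall_integral_le[OF u(1) K(1) L]) (use bound abs_le_D2 in force)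
      finally show ?thesis .
    qed
    ultimately show "\<bar>mean u x - H u x\<bar> \<le> 0 + L * (exp (2 * K * u) / 2)" unfolding diff by (simp add: abs_le_iff)
  qed (use K t in auto)
  then show ?thesis by simp
qed

text \<open>The branching property for means: the Laplace exponent is linear in the initial measure,
  so integrating the limit for point masses gives the limit for \<mu>.\<close>

lemma first_moment_eq:
  assumes \<mu>: "\<mu> \<in> finite_borel_measures" and t: "0 \<le> t"
  shows "(\<integral>w. (\<integral>x. f x \<partial>w t) \<partial>P \<mu>) = (\<integral>x. mean t x \<partial>\<mu>)"
proof -
  interpret \<mu>: finite_measure \<mu> using \<mu> by (simp add: finite_borel_measures_def)
  have sets_\<mu>: "sets \<mu> = sets borel" using \<mu> by (simp add: finite_borel_measures_def)
  let ?N = "\<lambda>n. real (Suc n)"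
  have N: "1 \<le> ?N n" for n by simp
  obtain M where M: "0 \<le> M" "\<And>n s x. 0 \<le> s \<Longrightarrow> s \<le> t \<Longrightarrow> rescaled f (?N n) s x \<le> M"
    using rescaled_bounded[OF t] by blast
  have "rescaled f (?N n) t \<in> borel_measurable borel" for n
    using measurable_section[OF measurable_rescaled[OF f_nonneg N], where s = t] t by simp
  moreover have "mean t \<in> borel_measurable borel"
    using measurable_section[OF measurable_mean, where s = t] t by simp
  ultimately have "(\<lambda>n. \<integral>x. rescaled f (?N n) t x \<partial>\<mu>) \<longlonglongrightarrow> (\<integral>x. mean t x \<partial>\<mu>)"
    by (intro integral_dominated_convergence[where w = "\<lambda>_. M"])
       (use M t rescaled_nonneg[OF f_nonneg N t] rescaled_tendsto_mean[OF t]
         in \<open>auto simp: measurable_cong_sets[OF sets_\<mu> refl] simp del: of_nat_Suc\<close>)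
  with first_moment_tendsto[OF \<mu> t] show ?thesis by (rule LIMSEQ_unique)
qed

end

text \<open>The Markov property is given for indicators, whereas the pairing with h is unbounded on
  the space of measures. Stating the extension as an identity of nonnegative integrals over A avoids
  integrability conditions, so that monotone approximation applies directly.\<close>

lemma Markov_nn_integral:
  assumes \<mu>: "\<mu> \<in> finite_borel_measures" and s: "0 \<le> s" and t: "0 \<le> t"
    and g: "g \<in> borel_measurable weak_borel" and A: "A \<in> sets (path_filtration t)"
  shows "(\<integral>\<^sup>+w\<in>A. g (w (t + s)) \<partial>P \<mu>) = (\<integral>\<^sup>+w\<in>A. (\<integral>\<^sup>+w'. g (w' s) \<partial>P (w t)) \<partial>P \<mu>)"
proof -
  interpret prob_space "P \<mu>" by (rule P_prob_space[OF \<mu>])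
  have subalg: "subalgebra (P \<mu>) (path_filtration t)"
    using sets_path_filtration_subset by (simp add: subalgebra_def P_prob_space[OF \<mu>])
  interpret sigma_finite_subalgebra "P \<mu>" "path_filtration t"
    using subalg by (rule sigma_finite_subalgebraI)
  note [measurable_cong] = P_prob_space(2)[OF \<mu>]
  have [measurable]: "A \<in> sets (P \<mu>)" using A subalg by (auto simp: subalgebra_def)
  have coord: "(\<lambda>w. w u) \<in> path_sigma \<rightarrow>\<^sub>M weak_borel" if "0 \<le> u" for u
    using measurable_path_sigma[OF that] .
  have ts: "0 \<le> t + s" using s t by simp
  note [measurable] = coord[OF ts] coord[OF t] coord[OF s]
  have kernel [measurable]: "(\<lambda>w. P (w t)) \<in> path_sigma \<rightarrow>\<^sub>M subprob_algebra path_sigma"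
    by (intro measurable_prob_algebraD measurable_compose[OF coord[OF t] path_laws])
  have inner: "(\<lambda>w. \<integral>\<^sup>+w'. g (w' s) \<partial>P (w t)) \<in> borel_measurable path_sigma"
    if "g \<in> borel_measurable weak_borel" for g :: "'a measure \<Rightarrow> ennreal"
    by (rule nn_integral_measurable_subprob_algebra2[OF _ kernel]) (use that in measurable)
  have P_t: "w t \<in> finite_borel_measures" if "w \<in> space (P \<mu>)" for w
    using that path_space_coordinate[OF _ t] by (simp add: P_prob_space[OF \<mu>])
  have meas_s: "(\<lambda>w'. g (w' s)) \<in> borel_measurable (P (w t))"
    if "w \<in> space (P \<mu>)" "g \<in> borel_measurable weak_borel" for w and g :: "'a measure \<Rightarrow> ennreal"
    using measurable_compose[OF coord[OF s] that(2)] by (simp add: measurable_cong_sets[OF P_prob_space(2)[OF P_t[OF that(1)]] refl])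
  have outer_A: "(\<lambda>w. g (w (t + s)) * indicator A w) \<in> borel_measurable (P \<mu>)"
    if "g \<in> borel_measurable weak_borel" for g :: "'a measure \<Rightarrow> ennreal"
  proof -
    have "(\<lambda>w. g (w (t + s))) \<in> borel_measurable (P \<mu>)"
      using measurable_compose[OF coord[OF ts] that] by (simp add: measurable_cong_sets[OF P_prob_space(2)[OF \<mu>] refl])
    then show ?thesis by measurable
  qed
  have inner_A: "(\<lambda>w. (\<integral>\<^sup>+w'. g (w' s) \<partial>P (w t)) * indicator A w) \<in> borel_measurable (P \<mu>)"
    if "g \<in> borel_measurable weak_borel" for g :: "'a measure \<Rightarrow> ennreal"
  proof -
    have "(\<lambda>w. \<integral>\<^sup>+w'. g (w' s) \<partial>P (w t)) \<in> borel_measurable (P \<mu>)"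
      using inner[OF that] by (simp add: measurable_cong_sets[OF P_prob_space(2)[OF \<mu>] refl])
    then show ?thesis by measurable
  qed
  show ?thesis using g
  proof (induction rule: borel_measurable_induct)
    case (cong f g)
    have "f (w (t + s)) = g (w (t + s))" if "w \<in> space (P \<mu>)" for w
      by (rule cong(3)) (use that path_space_coordinate[of w, OF _ ts] in \<open>simp add: P_prob_space[OF \<mu>]\<close>)
    moreover have "(\<integral>\<^sup>+w'. f (w' s) \<partial>P (w t)) = (\<integral>\<^sup>+w'. g (w' s) \<partial>P (w t))" if "w \<in> space (P \<mu>)" for w
    proof (intro nn_integral_cong cong(3))
      show "w' s \<in> space weak_borel" if "w' \<in> space (P (w t))" for w'
        using that path_space_coordinate[of w', OF _ s] by (simp add: P_prob_space[OF P_t[OF \<open>w \<in> space (P \<mu>)\<close>]])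
    qed
    ultimately show ?case using cong(4) by (simp cong: nn_integral_cong)
  next
    \<comment> \<open>Here all functions are bounded, so the conditional expectation can be handled
      in the reals and converted back.\<close>
    case (set B)
    have B [measurable]: "B \<in> sets weak_borel" by fact
    let ?f = "\<lambda>w. indicator B (w (t + s)) :: real"
    have "?f \<in> borel_measurable path_sigma"
      by (rule measurable_compose[OF coord[OF ts] borel_measurable_indicator[OF B]])
    then have f_meas: "?f \<in> borel_measurable (P \<mu>)"
      by (simp add: measurable_cong_sets[OF P_prob_space(2)[OF \<mu>] refl])
    have int: "integrable (P \<mu>) ?f"
      by (rule integrable_const_bound[where B = 1]) (use f_meas in \<open>auto split: split_indicator\<close>)
    let ?k = "\<lambda>w. measure (P (w t)) {w' \<in> path_space. w' s \<in> B}"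
    have set_s: "{w' \<in> path_space. w' s \<in> B} \<in> sets path_sigma"
      using measurable_sets[OF coord[OF s] B] by (simp add: vimage_def Int_def conj_commute)
    have "?k \<in> borel_measurable path_sigma"
      by (rule measurable_compose[OF kernel measurable_measure_subprob_algebra[OF set_s]])
    then have k: "?k \<in> borel_measurable (P \<mu>)"
      by (simp add: measurable_cong_sets[OF P_prob_space(2)[OF \<mu>] refl])
    have inner_eq: "(\<integral>\<^sup>+w'. indicator B (w' s) \<partial>P (w t)) = ennreal (?k w)" if "w \<in> space (P \<mu>)" for w
    proof -
      interpret Q: prob_space "P (w t)" by (rule P_prob_space[OF P_t[OF that]])
      have "(\<integral>\<^sup>+w'. indicator B (w' s) \<partial>P (w t)) = (\<integral>\<^sup>+w'. indicator {w' \<in> path_space. w' s \<in> B} w' \<partial>P (w t))"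
        by (intro nn_integral_cong) (auto simp: P_prob_space[OF P_t[OF that]] split: split_indicator)
      also have "\<dots> = emeasure (P (w t)) {w' \<in> path_space. w' s \<in> B}"
        using set_s by (intro nn_integral_indicator) (simp add: P_prob_space[OF P_t[OF that]])
      finally show ?thesis by (simp add: Q.emeasure_eq_measure)
    qed
    have k_le: "?k w \<le> 1" if "w \<in> space (P \<mu>)" for w
    proof -
      interpret Q: prob_space "P (w t)" by (rule P_prob_space[OF P_t[OF that]])
      show ?thesis by simp
    qed
    have int_k: "integrable (P \<mu>) ?k"
      by (rule integrable_const_bound[where B = 1]) (use k_le k in auto)
    have "(\<integral>\<^sup>+w\<in>A. indicator B (w (t + s)) \<partial>P \<mu>) = (\<integral>\<^sup>+w. ennreal (indicator A w * ?f w) \<partial>P \<mu>)"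
      by (intro nn_integral_cong) (auto split: split_indicator)
    also have "\<dots> = ennreal (\<integral>w. indicator A w * ?f w \<partial>P \<mu>)"
      using integrable_mult_indicator[of A "P \<mu>", OF _ int] by (intro nn_integral_eq_integral) auto
    also have "(\<integral>w. indicator A w * ?f w \<partial>P \<mu>) = (\<integral>w. indicator A w * real_cond_exp (P \<mu>) (path_filtration t) ?f w \<partial>P \<mu>)"
      using real_cond_exp_intA[OF int A] by (simp add: set_lebesgue_integral_def)
    also have "\<dots> = (\<integral>w. indicator A w * ?k w \<partial>P \<mu>)"
    proof (rule integral_cong_AE)
      show "(\<lambda>w. indicator A w * real_cond_exp (P \<mu>) (path_filtration t) ?f w) \<in> borel_measurable (P \<mu>)"
        by measurable
      show "AE w in P \<mu>. indicator A w * real_cond_exp (P \<mu>) (path_filtration t) ?f w = indicator A w * ?k w"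
        using Markov[OF \<mu> s t B] by eventually_elim simp
      show "(\<lambda>w. indicator A w * ?k w) \<in> borel_measurable (P \<mu>)"
        using k by measurable
    qed
    also have "ennreal \<dots> = (\<integral>\<^sup>+w. ennreal (indicator A w * ?k w) \<partial>P \<mu>)"
      using integrable_mult_indicator[of A "P \<mu>", OF _ int_k] by (intro nn_integral_eq_integral[symmetric]) auto
    also have "\<dots> = (\<integral>\<^sup>+w\<in>A. (\<integral>\<^sup>+w'. indicator B (w' s) \<partial>P (w t)) \<partial>P \<mu>)"
      by (intro nn_integral_cong) (auto simp: inner_eq split: split_indicator)
    finally show ?case .
  next
    case (mult u c)
    have u: "u \<in> borel_measurable weak_borel" by fact
    have "(\<integral>\<^sup>+w\<in>A. c * u (w (t + s)) \<partial>P \<mu>) = c * (\<integral>\<^sup>+w\<in>A. u (w (t + s)) \<partial>P \<mu>)"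
      unfolding mult.assoc by (rule nn_integral_cmult[OF outer_A[OF u]])
    also have "\<dots> = (\<integral>\<^sup>+w\<in>A. c * (\<integral>\<^sup>+w'. u (w' s) \<partial>P (w t)) \<partial>P \<mu>)"
      unfolding mult.IH mult.assoc by (rule nn_integral_cmult[OF inner_A[OF u], symmetric])
    also have "\<dots> = (\<integral>\<^sup>+w\<in>A. (\<integral>\<^sup>+w'. c * u (w' s) \<partial>P (w t)) \<partial>P \<mu>)"
      using meas_s[OF _ u] by (intro nn_integral_cong) (simp add: nn_integral_cmult)
    finally show ?case .
  next
    case (add u v)
    have u: "u \<in> borel_measurable weak_borel" and v: "v \<in> borel_measurable weak_borel" by fact+
    have "(\<integral>\<^sup>+w\<in>A. v (w (t + s)) + u (w (t + s)) \<partial>P \<mu>)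
       = (\<integral>\<^sup>+w\<in>A. v (w (t + s)) \<partial>P \<mu>) + (\<integral>\<^sup>+w\<in>A. u (w (t + s)) \<partial>P \<mu>)"
      unfolding distrib_right by (rule nn_integral_add[OF outer_A[OF v] outer_A[OF u]])
    also have "\<dots> = (\<integral>\<^sup>+w\<in>A. (\<integral>\<^sup>+w'. v (w' s) \<partial>P (w t)) + (\<integral>\<^sup>+w'. u (w' s) \<partial>P (w t)) \<partial>P \<mu>)"
      unfolding add.IH distrib_right by (rule nn_integral_add[OF inner_A[OF v] inner_A[OF u], symmetric])
    also have "\<dots> = (\<integral>\<^sup>+w\<in>A. (\<integral>\<^sup>+w'. v (w' s) + u (w' s) \<partial>P (w t)) \<partial>P \<mu>)"
      using meas_s[OF _ u] meas_s[OF _ v] by (intro nn_integral_cong) (simp add: nn_integral_add)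
    finally show ?case by (simp add: add.commute)
  next
    case (seq U)
    have sup: "(SUP i. U i) x = (SUP i. U i x)" for x by (rule SUP_apply)
    have inc: "incseq (\<lambda>i. U i x)" for x using seq(3) by (auto simp: mono_def le_fun_def)
    have "(\<integral>\<^sup>+w\<in>A. (SUP i. U i) (w (t + s)) \<partial>P \<mu>) = (\<integral>\<^sup>+w. (SUP i. U i (w (t + s)) * indicator A w) \<partial>P \<mu>)"
      unfolding sup by (simp add: SUP_mult_right_ennreal)
    also have "\<dots> = (SUP i. \<integral>\<^sup>+w\<in>A. U i (w (t + s)) \<partial>P \<mu>)"
      using inc outer_A[OF seq(1)]
      by (intro nn_integral_monotone_convergence_SUP) (auto simp: mono_def le_fun_def intro!: mult_right_mono)
    also have "\<dots> = (SUP i. \<integral>\<^sup>+w\<in>A. (\<integral>\<^sup>+w'. U i (w' s) \<partial>P (w t)) \<partial>P \<mu>)"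
      unfolding seq.IH ..
    also have "\<dots> = (\<integral>\<^sup>+w. (SUP i. (\<integral>\<^sup>+w'. U i (w' s) \<partial>P (w t)) * indicator A w) \<partial>P \<mu>)"
      using inc inner_A[OF seq(1)]
      by (intro nn_integral_monotone_convergence_SUP[symmetric])
         (auto simp: mono_def le_fun_def intro!: mult_right_mono nn_integral_mono)
    also have "\<dots> = (\<integral>\<^sup>+w\<in>A. (\<integral>\<^sup>+w'. (SUP i. U i) (w' s) \<partial>P (w t)) \<partial>P \<mu>)"
    proof (rule nn_integral_cong)
      fix w assume w: "w \<in> space (P \<mu>)"
      have "(\<integral>\<^sup>+w'. (SUP i. U i) (w' s) \<partial>P (w t)) = (SUP i. \<integral>\<^sup>+w'. U i (w' s) \<partial>P (w t))"
        unfolding sup using inc meas_s[OF w seq(1)]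
        by (intro nn_integral_monotone_convergence_SUP) (auto simp: mono_def le_fun_def)
      then show "(SUP i. (\<integral>\<^sup>+w'. U i (w' s) \<partial>P (w t)) * indicator A w) = (\<integral>\<^sup>+w'. (SUP i. U i) (w' s) \<partial>P (w t)) * indicator A w"
        by (simp add: SUP_mult_right_ennreal)
    qed
    finally show ?case .
  qed
qed

text \<open>By the Markov property at s, the conditional expectation is the first moment after a
  further time \<open>t - s\<close> from the initial measure \<open>w s\<close>. For an
  eigenfunction this is a multiple of the pairing of f with \<open>w s\<close>, and the factors
  combine to \<open>exp (l * s)\<close>.\<close>

lemma martingale_of_eigenfunction:
  assumes f: "f \<in> bounded_continuous" "\<And>x. 0 \<le> f x"
    and eigen: "\<And>t x. 0 \<le> t \<Longrightarrow> mean f t x = exp (- l * t) * f x"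
    and \<mu>: "\<mu> \<in> finite_borel_measures"
  shows "martingale (P \<mu>) path_filtration (\<lambda>t w. exp (l * t) * (\<integral>x. f x \<partial>w t))"
  unfolding martingale_def
proof (intro conjI allI impI)
  let ?Z = "\<lambda>t w. \<integral>x. f x \<partial>(w t :: 'a measure)"
  interpret prob_space "P \<mu>" by (rule P_prob_space[OF \<mu>])
  show subalg: "subalgebra (P \<mu>) (path_filtration t)" for t
    using sets_path_filtration_subset by (simp add: subalgebra_def P_prob_space[OF \<mu>])
  show "sets (path_filtration s) \<subseteq> sets (path_filtration t)" if "0 \<le> s \<and> s \<le> t" for s t :: real
    using sets_path_filtration_mono that by blast
  have meas: "?Z t \<in> borel_measurable (path_filtration t)" if "0 \<le> t" for t
    by (rule measurable_compose[OF measurable_path_filtration[OF that order_refl] measurable_weak_borel_integral[OF f(1)]])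
  then show "(\<lambda>w. exp (l * t) * ?Z t w) \<in> borel_measurable (path_filtration t)" if "0 \<le> t" for t
    using that by (intro borel_measurable_times) auto
  have int: "integrable (P \<mu>) (?Z t)" if "0 \<le> t" for t
    by (rule integrable_first_moment[OF f \<mu> that])
  then show int': "integrable (P \<mu>) (\<lambda>w. exp (l * t) * ?Z t w)" if "0 \<le> t" for t
    using that by simp
  fix s t :: real assume st: "0 \<le> s \<and> s \<le> t"
  then have s: "0 \<le> s" and r: "0 \<le> t - s" and t: "0 \<le> t" by auto
  interpret sigma_finite_subalgebra "P \<mu>" "path_filtration s"
    using subalg by (rule sigma_finite_subalgebraI)
  have Z0: "0 \<le> ?Z u w" for u w by (intro Bochner_Integration.integral_nonneg f)
  have inner: "(\<integral>\<^sup>+w'. ennreal (?Z (t - s) w') \<partial>P \<nu>) = ennreal (exp (- l * (t - s)) * (\<integral>x. f x \<partial>\<nu>))"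
    if \<nu>: "\<nu> \<in> finite_borel_measures" for \<nu>
  proof -
    have "(\<integral>\<^sup>+w'. ennreal (?Z (t - s) w') \<partial>P \<nu>) = ennreal (\<integral>w'. ?Z (t - s) w' \<partial>P \<nu>)"
      by (rule nn_integral_eq_integral[OF integrable_first_moment[OF f \<nu> r]]) (simp add: Z0)
    also have "(\<integral>w'. ?Z (t - s) w' \<partial>P \<nu>) = (\<integral>x. exp (- l * (t - s)) * f x \<partial>\<nu>)"
      unfolding first_moment_eq[OF f \<nu> r] by (rule Bochner_Integration.integral_cong[OF refl eigen[OF r]])
    finally show ?thesis by simp
  qed
  show "AE w in P \<mu>. real_cond_exp (P \<mu>) (path_filtration s) (\<lambda>w. exp (l * t) * ?Z t w) w = exp (l * s) * ?Z s w"
  proof (rule real_cond_exp_charact[OF _ int'[OF t] int'[OF s]])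
    fix A :: "(real \<Rightarrow> 'a measure) set" assume A: "A \<in> sets (path_filtration s)"
    then have A' [measurable]: "A \<in> sets (P \<mu>)" using subalg by (auto simp: subalgebra_def)
    have intA: "integrable (P \<mu>) (\<lambda>w. indicator A w * ?Z u w)" if "0 \<le> u" for u
      using integrable_mult_indicator[OF A' int[OF that]] by simp
    have "(\<lambda>\<nu>. ennreal (\<integral>x. f x \<partial>\<nu>)) \<in> borel_measurable weak_borel"
      using measurable_weak_borel_integral[OF f(1)] by measurable
    from Markov_nn_integral[OF \<mu> r s this A]
    have "(\<integral>\<^sup>+w\<in>A. ennreal (?Z t w) \<partial>P \<mu>) = (\<integral>\<^sup>+w\<in>A. (\<integral>\<^sup>+w'. ennreal (?Z (t - s) w') \<partial>P (w s)) \<partial>P \<mu>)"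
      by simp
    also have "\<dots> = (\<integral>\<^sup>+w. ennreal (exp (- l * (t - s)) * (indicator A w * ?Z s w)) \<partial>P \<mu>)"
      using inner[OF path_space_coordinate[OF _ s]]
      by (intro nn_integral_cong) (auto simp: P_prob_space[OF \<mu>] split: split_indicator)
    also have "\<dots> = ennreal (\<integral>w. exp (- l * (t - s)) * (indicator A w * ?Z s w) \<partial>P \<mu>)"
      by (rule nn_integral_eq_integral) (use intA[OF s] Z0 in \<open>auto intro!: AE_I2 mult_nonneg_nonneg\<close>)
    finally have "ennreal (\<integral>w. indicator A w * ?Z t w \<partial>P \<mu>) = ennreal (exp (- l * (t - s)) * (\<integral>w. indicator A w * ?Z s w \<partial>P \<mu>))"
    proof -
      assume *: "(\<integral>\<^sup>+w\<in>A. ennreal (?Z t w) \<partial>P \<mu>) = ennreal (\<integral>w. exp (- l * (t - s)) * (indicator A w * ?Z s w) \<partial>P \<mu>)"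
      have "ennreal (\<integral>w. indicator A w * ?Z t w \<partial>P \<mu>) = (\<integral>\<^sup>+w. ennreal (indicator A w * ?Z t w) \<partial>P \<mu>)"
        by (rule nn_integral_eq_integral[symmetric]) (use intA[OF t] Z0 in \<open>auto intro!: AE_I2 mult_nonneg_nonneg\<close>)
      also have "\<dots> = (\<integral>\<^sup>+w\<in>A. ennreal (?Z t w) \<partial>P \<mu>)"
        by (intro nn_integral_cong) (auto split: split_indicator)
      finally show ?thesis unfolding * by simp
    qed
    \<comment> \<open>Both integrals are nonnegative, so the identity descends from
      \<open>ennreal\<close> to the reals.\<close>
    then have *: "(\<integral>w. indicator A w * ?Z t w \<partial>P \<mu>) = exp (- l * (t - s)) * (\<integral>w. indicator A w * ?Z s w \<partial>P \<mu>)"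
      by (subst (asm) ennreal_inj) (auto intro!: Bochner_Integration.integral_nonneg mult_nonneg_nonneg simp: Z0)
    have "exp (l * t) * exp (- l * (t - s)) = exp (l * s)"
      by (simp add: exp_add[symmetric] algebra_simps)
    with * show "(\<integral>w\<in>A. exp (l * t) * ?Z t w \<partial>P \<mu>) = (\<integral>w\<in>A. exp (l * s) * ?Z s w \<partial>P \<mu>)"
      by (simp add: set_lebesgue_integral_def mult.left_commute)
  next
    show "(\<lambda>w. exp (l * s) * ?Z s w) \<in> borel_measurable (path_filtration s)"
      using meas[OF s] by (intro borel_measurable_times) auto
  qed
qed

text \<open>Shows that \<open>exp (- l * t) * f x\<close> solves the mild equation of the mean, and
  concludes by uniqueness.\<close>

lemma mean_eigenfunction:
  assumes f: "f \<in> bounded_continuous" "\<And>x. 0 \<le> f x"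
    and weak: "\<forall>w\<in>dirichlet_domain m S. Q_form m S a (gamma_kernel c \<pi> \<Pi>NL) f w = l * L2_inner m f w"
    and t: "0 \<le> t"
  shows "mean f t x = exp (- l * t) * f x"
proof -
  note fb = bounded_continuous_bounded_borel[OF f(1)]
  have fc: "continuous_on UNIV f" using f(1) by (simp add: bounded_continuous_def)
  have [measurable]: "f \<in> borel_measurable borel" using fb by measurable
  obtain C where C: "0 < C" "\<And>x. \<bar>f x\<bar> \<le> C" using fb by (metis bounded_borelE)
  obtain K where K: "0 < K" "\<And>x. \<bar>a x\<bar> + mean_offspring x \<le> K" by (metis rates_bounded)
  \<comment> \<open>The weak eigenvalue equation with all terms except the Dirichlet form moved to
    the right-hand side.\<close>
  define g where "g x = l * f x - linear_part x f" for x
  have g_meas [measurable]: "g \<in> borel_measurable borel"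
    unfolding g_def[abs_def] by (intro borel_measurable_diff measurable_linear_part) measurable
  have g: "g \<in> bounded_borel"
  proof (rule bounded_borelI[OF g_meas])
    fix x
    have "\<bar>l * f x\<bar> \<le> \<bar>l\<bar> * C" using C by (auto simp: abs_mult intro!: mult_left_mono)
    moreover have "\<bar>linear_part x f\<bar> \<le> K * C" by (rule linear_part_le[OF C(2) K(2)])
    ultimately show "\<bar>g x\<bar> \<le> \<bar>l\<bar> * C + K * C" unfolding g_def by linarith
  qed
  obtain D where D: "0 < D" "\<And>x. \<bar>g x\<bar> \<le> D" using g by (metis bounded_borelE)
  have mild: "f x - S t f x = (LINT s:{0..t}|lborel. S s g x)" if t: "0 \<le> t" for t x
  proof (rule mild_equation[OF fc fb g _ t])
    fix w assume w: "w \<in> dirichlet_domain m S" "w \<in> bounded_borel" "\<And>x. 0 \<le> w x" "integrable m w"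
    have ab: "a \<in> bounded_borel" by (rule a)
    have \<gamma>: "(\<lambda>x. mean_offspring x * (\<integral>y. f y \<partial>\<pi> x)) \<in> bounded_borel"
    proof (rule bounded_borelI)
      show "(\<lambda>x. mean_offspring x * (\<integral>y. f y \<partial>\<pi> x)) \<in> borel_measurable borel"
        by (intro borel_measurable_times measurable_mean_offspring measurable_\<pi>_integral) measurable
      fix x
      have "mean_offspring x \<le> K" using K(2)[of x] by simp
      then show "\<bar>mean_offspring x * (\<integral>y. f y \<partial>\<pi> x)\<bar> \<le> K * C"
        using mean_offspring_nonneg[of x] abs_integral_\<pi>_le[OF C(2), of x]
        by (auto simp: abs_mult intro!: mult_mono)
    qed
    have af: "(\<lambda>x. a x * f x) \<in> bounded_borel"
    proof (rule bounded_borelI)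
      show "\<bar>a x * f x\<bar> \<le> K * C" for x
        using K(2)[of x] mean_offspring_nonneg[of x] C(2)[of x] by (auto simp: abs_mult intro!: mult_mono)
    qed measurable
    have "(\<integral>y. f y \<partial>gamma_kernel c \<pi> \<Pi>NL x) = mean_offspring x * (\<integral>y. f y \<partial>\<pi> x)" for x
      by (rule integral_gamma_kernel) measurable
    then have "dirichlet_form m S f w + (\<integral>x. a x * f x * w x \<partial>m)
       - (\<integral>x. mean_offspring x * (\<integral>y. f y \<partial>\<pi> x) * w x \<partial>m) = l * (\<integral>x. f x * w x \<partial>m)"
      using weak w(1) by (simp add: Q_form_def L2_inner_def)
    moreover have "(\<integral>x. g x * w x \<partial>m) = l * (\<integral>x. f x * w x \<partial>m) - ((\<integral>x. a x * f x * w x \<partial>m)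
       - (\<integral>x. mean_offspring x * (\<integral>y. f y \<partial>\<pi> x) * w x \<partial>m))"
      using integrable_bounded_mult(1)[OF fb w(4)] integrable_bounded_mult(1)[OF af w(4)]
        integrable_bounded_mult(1)[OF \<gamma> w(4)]
      by (simp add: g_def linear_part_def left_diff_distrib mult.assoc)
    ultimately show "dirichlet_form m S f w = (\<integral>x. g x * w x \<partial>m)" by simp
  qed
  show ?thesis
  proof (rule mean_eq[OF f, where H = "\<lambda>t x. exp (- l * t) * f x"])
    show "(\<lambda>(s, y). exp (- l * max 0 s) * f y) \<in> borel_measurable (borel \<Otimes>\<^sub>M borel)" by measurable
    show "\<exists>B. \<forall>s\<in>{0..t}. \<forall>y. \<bar>exp (- l * s) * f y\<bar> \<le> B" if "0 \<le> t" for t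
    proof (intro exI[of _ "exp (\<bar>l\<bar> * t) * C"] ballI allI)
      fix s y assume s: "s \<in> {0..t}"
      have "- l * s \<le> \<bar>l\<bar> * t" using s by (intro mult_mono) auto
      then show "\<bar>exp (- l * s) * f y\<bar> \<le> exp (\<bar>l\<bar> * t) * C"
        using C(2)[of y] by (auto simp: abs_mult intro!: mult_mono)
    qed
    fix t :: real and x assume t: "0 \<le> t"
    have "(LINT s:{0..t}|lborel. S s (\<lambda>y. linear_part y (\<lambda>z. exp (- l * max 0 (t - s)) * f z)) x)
      = (LINT s:{0..t}|lborel. exp (- l * (t - s)) * (l * S s f x - S s g x))"
    proof (rule set_lebesgue_integral_cong)
      \<comment> \<open>Solving the definition of g for \<open>linear_part\<close> expresses the
        integrand through f and g, for which \<open>mild\<close> is known.\<close>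
      have lin: "linear_part y (\<lambda>z. k * f z) = k * (l * f y - g y)" for k y
        by (simp add: g_def linear_part_def algebra_simps)
      have lf: "(\<lambda>y. l * f y) \<in> bounded_borel"
        by (rule bounded_borelI[where C = "\<bar>l\<bar> * C"]) (use C in \<open>auto simp: abs_mult intro!: mult_left_mono\<close>)
      show "\<forall>s. s \<in> {0..t} \<longrightarrow> S s (\<lambda>y. linear_part y (\<lambda>z. exp (- l * max 0 (t - s)) * f z)) x
        = exp (- l * (t - s)) * (l * S s f x - S s g x)"
        unfolding lin S_cmult S_diff[OF lf g] by auto
    qed simp
    also have "\<dots> = S t f x - exp (- l * t) * f x"
    \<comment> \<open>Applied with x fixed to \<open>F s = S s f x\<close> and
      \<open>G s = S s g x\<close>, with initial value \<open>f x\<close>; the required relation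
      between them is \<open>mild\<close>.\<close>
    proof (rule variation_of_constants[OF _ _ _ t])
      show "(\<lambda>s. S s g x) \<in> borel_measurable borel" by measurable
      show "\<bar>S s g x\<bar> \<le> D" for s by (rule abs_S_le[OF D(2)])
      show "S s f x = f x - (LINT q:{0..s}|lborel. S q g x)" if "0 \<le> s" for s
        using mild[OF that, of x] by simp
    qed
    finally show "exp (- l * t) * f x
      = S t f x - (LINT s:{0..t}|lborel. S s (\<lambda>y. linear_part y (\<lambda>z. exp (- l * max 0 (t - s)) * f z)) x)"
      by simp
  qed (rule t)
qed

end

theorem theorem3p2:
  fixes \<Omega> :: "'w set"
    and \<xi> :: "ennreal \<Rightarrow> 'w \<Rightarrow> 'a::{metric_space, second_countable_topology} option"
    and \<tau> :: "ennreal \<Rightarrow> 'w \<Rightarrow> 'w"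
    and Pr :: "'a option \<Rightarrow> 'w measure"
    and m :: "'a measure"
    and p :: "real \<Rightarrow> 'a \<Rightarrow> 'a \<Rightarrow> ennreal"
    and a b c h h_hat :: "'a \<Rightarrow> real"
    and \<Pi>L \<Pi>NL :: "'a \<Rightarrow> real measure"
    and \<pi> :: "'a \<Rightarrow> 'a measure"
    and V :: "real \<Rightarrow> ('a \<Rightarrow> real) \<Rightarrow> 'a \<Rightarrow> real"
    and P :: "'a measure \<Rightarrow> (real \<Rightarrow> 'a measure) measure"
    and lam1 :: real
  defines "S \<equiv> transition_semigroup \<xi> Pr"
    and "\<gamma> \<equiv> gamma_kernel c \<pi> \<Pi>NL"
  assumes "superprocess \<Omega> \<xi> \<tau> Pr m p a b \<Pi>L c \<pi> \<Pi>NL V P"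
    and assumption1: "mix_measure m \<gamma> \<in> kato_class \<Omega> \<xi> \<tau> Pr m p"
    and assumption2:
      "h \<in> dirichlet_domain m S" "\<forall>x. 0 < h x" "h \<in> bounded_continuous"
      "h_hat \<in> dirichlet_domain m S" "\<forall>x. 0 < h_hat x"
      "L2_norm m h = 1" "L2_inner m h h_hat = 1"
      "\<forall>v\<in>dirichlet_domain m S. Q_form m S a \<gamma> h v = lam1 * L2_inner m h v"
      "\<forall>v\<in>dirichlet_domain m S. quasi_continuous m S v \<longrightarrow>
         Q_form m S a \<gamma> v h_hat = lam1 * L2_inner m v h_hat"
    and "\<mu> \<in> finite_borel_measures"
  shows "(\<forall>t\<ge>0. \<forall>w\<in>path_space. 0 \<le> exp (lam1 * t) * (\<integral>x. h x \<partial>w t)) \<and>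
    martingale (P \<mu>) path_filtration (\<lambda>t w. exp (lam1 * t) * (\<integral>x. h x \<partial>w t))"
proof -
  interpret superprocess \<Omega> \<xi> \<tau> Pr m p a b \<Pi>L c \<pi> \<Pi>NL V P by fact
  have h: "0 \<le> h x" for x using assumption2(2) by (simp add: less_imp_le)
  \<comment> \<open>\<open>assumption2(8)\<close> is the eigenvalue equation tested from the right,
    and \<open>assms(14)\<close> is the finiteness of \<mu>.\<close>
  have "martingale (P \<mu>) path_filtration (\<lambda>t w. exp (lam1 * t) * (\<integral>x. h x \<partial>w t))"
    by (rule martingale_of_eigenfunction[OF assumption2(3) h mean_eigenfunction[OF assumption2(3) h]])
       (use assumption2(8) assms(14) in \<open>simp_all add: S_def \<gamma>_def\<close>)
  then show ?thesis using h by (auto intro!: mult_nonneg_nonneg Bochner_Integration.integral_nonneg)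
qed

end
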